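(* Let $d$ be an even positive integer and let $f$ be a form of degree $d$ in $n$ variables such that $y^TH_f(x)y>0$ for all $(x,y)\in S^{n-1}\times S^{n-1}$. Let $$\eta(f):=\frac{\min\{y^TH_f(x)y : (x,y)\in S^{n-1}\times S^{n-1}\}}{\max\{y^TH_f(x)y : (x,y)\in S^{n-1}\times S^{n-1}\}} .$$ If $$r\ \ge\ \frac{n(d-2)(d-3)}{4\log(2)\,\eta(f)}-\frac{n+d-2}{2}-d,$$ then $f$ is $r$-sos-convex.
   Context: A form is a homogeneous polynomial. $H_f(x)$ is the Hessian of $f$ at $x$, and $S^{n-1}$ is the unit sphere in $\mathbb{R}^n$. Here $r$ is a nonnegative integer; a polynomial $f$ in $n$ variables is called $r$-sos-convex if the polynomial $y^TH_f(x)y\cdot(\sum_{i=1}^n x_i^2)^r$ in the variables $(x,y)$ is a sum of squares of polynomials. *)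

theory Defs
  imports "HOL-Analysis.Analysis" "HOL-Library.Poly_Mapping"
begin

text \<open>
  Polynomials with coefficients in \<open>'a\<close> and variables indexed by \<open>'v\<close>: finitely supported maps
  from exponent vectors to coefficients, multiplied by convolution.
\<close>

type_synonym ('v, 'a) mpoly = "('v \<Rightarrow>\<^sub>0 nat) \<Rightarrow>\<^sub>0 'a"

definition mconst :: "'a::zero \<Rightarrow> ('v, 'a) mpoly" where
  "mconst c = Poly_Mapping.single 0 c"

definition mvar :: "'v \<Rightarrow> ('v, 'a::zero_neq_one) mpoly" where
  "mvar v = Poly_Mapping.single (Poly_Mapping.single v 1) 1"

text \<open>Substitution of \<open>s v\<close> for the variable \<open>v\<close>, with \<open>c\<close> applied to the coefficients.\<close>

definition msubst ::
    "('a::zero \<Rightarrow> 'b::comm_semiring_1) \<Rightarrow> ('v \<Rightarrow> 'b) \<Rightarrow> ('v, 'a) mpoly \<Rightarrow> 'b" where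
  "msubst c s p =
     (\<Sum>m\<in>Poly_Mapping.keys p. c (Poly_Mapping.lookup p m) *
        (\<Prod>v\<in>Poly_Mapping.keys m. s v ^ Poly_Mapping.lookup m v))"

abbreviation meval :: "('v \<Rightarrow> 'a::comm_semiring_1) \<Rightarrow> ('v, 'a) mpoly \<Rightarrow> 'a" where
  "meval \<equiv> msubst (\<lambda>c. c)"

definition is_form :: "nat \<Rightarrow> ('v, 'a::zero) mpoly \<Rightarrow> bool" where
  "is_form d p \<longleftrightarrow>
     (\<forall>m\<in>Poly_Mapping.keys p. (\<Sum>v\<in>Poly_Mapping.keys m. Poly_Mapping.lookup m v) = d)"

text \<open>
  Truncated subtraction of exponents is harmless: if \<open>v\<close> does not occur in \<open>m\<close>, the
  coefficient is zero.
\<close>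

definition mpartial :: "'v \<Rightarrow> ('v, 'a::comm_semiring_1) mpoly \<Rightarrow> ('v, 'a) mpoly" where
  "mpartial v p =
     (\<Sum>m\<in>Poly_Mapping.keys p.
        Poly_Mapping.single (m - Poly_Mapping.single v 1)
          (of_nat (Poly_Mapping.lookup m v) * Poly_Mapping.lookup p m))"

definition sum_of_squares :: "('v, real) mpoly \<Rightarrow> bool" where
  "sum_of_squares p \<longleftrightarrow> (\<exists>qs. p = (\<Sum>q\<leftarrow>qs. q\<^sup>2))"

definition hessian :: "('n::finite, real) mpoly \<Rightarrow> ('n, real) mpoly ^ 'n ^ 'n" where
  "hessian f = (\<chi> i j. mpartial i (mpartial j f))"

definition hessian_at :: "('n::finite, real) mpoly \<Rightarrow> real ^ 'n \<Rightarrow> real ^ 'n ^ 'n" where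
  "hessian_at f x = (\<chi> i j. meval (\<lambda>k. x $ k) (hessian f $ i $ j))"

text \<open>
  For polynomials in \<open>(x, y)\<close> the variables are indexed by \<open>'n + 'n\<close>: \<open>Inl i\<close> stands for \<open>x\<^sub>i\<close>
  and \<open>Inr i\<close> for \<open>y\<^sub>i\<close>.
\<close>

abbreviation xvar :: "'n \<Rightarrow> ('n + 'n, real) mpoly" where "xvar i \<equiv> mvar (Inl i)"
abbreviation yvar :: "'n \<Rightarrow> ('n + 'n, real) mpoly" where "yvar i \<equiv> mvar (Inr i)"

definition in_x :: "('n, real) mpoly \<Rightarrow> ('n + 'n, real) mpoly" where
  "in_x = msubst mconst xvar"

text \<open>The polynomial \<open>y\<^sup>T H\<^sub>f(x) y\<close>.\<close>

definition hessian_form :: "('n::finite, real) mpoly \<Rightarrow> ('n + 'n, real) mpoly" where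
  "hessian_form f = (\<Sum>i\<in>UNIV. \<Sum>j\<in>UNIV. yvar i * in_x (hessian f $ i $ j) * yvar j)"

definition r_sos_convex :: "nat \<Rightarrow> ('n::finite, real) mpoly \<Rightarrow> bool" where
  "r_sos_convex r f \<longleftrightarrow> sum_of_squares (hessian_form f * (\<Sum>i\<in>UNIV. (xvar i)\<^sup>2) ^ r)"

definition sphere_values :: "('n::finite, real) mpoly \<Rightarrow> real set" where
  "sphere_values f =
     {y \<bullet> (hessian_at f x *v y) | x y. (x, y) \<in> sphere 0 1 \<times> sphere 0 1}"

text \<open>
  Minimum and maximum are taken literally, as least and greatest element; both exist because
  \<open>sphere 0 1 \<times> sphere 0 1\<close> is compact and nonempty.
\<close>

definition eta :: "('n::finite, real) mpoly \<Rightarrow> real" where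
  "eta f = (LEAST t. t \<in> sphere_values f) / (GREATEST t. t \<in> sphere_values f)"

end

theory Submission
  imports Defs
begin

text \<open>
  Let \<open>p (x, y) = y\<^sup>T H\<^sub>f(x) y\<close>, a form of degree \<open>m = d - 2\<close> in \<open>x\<close> with values in \<open>[\<mu>, M]\<close> on the product
  of spheres, where \<open>\<eta> = \<mu> / M\<close>. Gaussian integration by parts gives Reznick's representation: up to
  a positive constant, \<open>|x|\<^bsup>2r\<^esup> p (x, y)\<close> is the Gaussian mean over \<open>u\<close> of \<open>q (u, y) (x \<bullet> u)\<^bsup>m+2r\<^esup>\<close>, where
  \<open>q = (\<Sum>l. c\<^sub>l |u|\<^bsup>2l\<^esup> \<Delta>\<^bsup>l\<^esup> p)\<close>. Gauss--Hermite cubature turns this mean into a finite positive combination,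
  so that \<open>q \<ge> 0\<close> suffices. This holds if \<open>exp (n m (m - 1) / (2 (n + m + 2 r))) \<le> 1 + \<eta>\<close>, because
  \<open>|\<Delta>\<^bsup>l\<^esup> p| \<le> (n m (m - 1))\<^bsup>l\<^esup> M\<close> on the sphere by an extremal property of Chebyshev polynomials.

  In general this needs an \<open>r\<close> larger by \<open>d\<close> than assumed. But \<open>\<eta> \<le> 1 / (d - 1)\<close> if \<open>n \<ge> 2\<close>, which makes
  up for the difference if \<open>d \<ge> 6\<close>. If \<open>d = 4\<close>, then \<open>p\<close> is symmetric in \<open>x\<close> and \<open>y\<close>, and polarization
  improves the bound for \<open>\<Delta> p\<close>. It suffices except for large \<open>\<eta>\<close> and \<open>n \<le> 3\<close>, where the
  catalecticant matrix of \<open>f\<close> is positive semidefinite and \<open>p\<close> itself is a sum of squares.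
\<close>

section \<open>Multivariate polynomials\<close>

text \<open>The Gaussian mean is a linear functional on polynomials given by the moments; no
  integral occurs, and integration by parts is the recursion of the moments. What has to be
  constructed is a rule with finitely many nodes and nonnegative weights, since only a finite sum
  can be a sum of squares; this is why Hermite polynomials and their real roots are needed.

  The two groups of variables play different roles. The representation acts on \<open>x\<close>
  alone, entry by entry on the Hessian, and \<open>y\<close> enters only through the matrix indices.
  At each node \<open>u\<close>, \<open>q (u, y)\<close> is a quadratic form in \<open>y\<close>,
  and a nonnegative quadratic form is a sum of squares of linear forms; the power of
  \<open>x \<bullet> u\<close> is a square because \<open>m\<close> is even.

  If \<open>n = 1\<close>, no direction is orthogonal to \<open>x\<close> and the bound on
  \<open>\<eta>\<close> may fail; the Hessian form is then a positive multiple of one square. If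
  \<open>d = 2\<close>, then \<open>p\<close> does not depend on \<open>x\<close> and
  \<open>q = p\<close>.\<close>

lemma mpoly_single_induct [case_names single add]:
  fixes p :: "('v, 'a::comm_monoid_add) mpoly"
  assumes single: "\<And>m c. P (Poly_Mapping.single m c)"
    and add: "\<And>p q. P p \<Longrightarrow> P q \<Longrightarrow> P (p + q)"
  shows "P p"
proof (induction p rule: update_induct)
  case const
  show ?case using single[of 0 0] by simp
next
  case (update f a b)
  have "Poly_Mapping.update a b f = f + Poly_Mapping.single a b"
    by (rule poly_mapping_eqI)
      (use update(1) in \<open>auto simp: lookup_update lookup_add lookup_single when_def in_keys_iff\<close>)
  then show ?case using add[OF update(3) single] by simp
qed

definition mdeg :: "('v::finite \<Rightarrow>\<^sub>0 nat) \<Rightarrow> nat" where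
  "mdeg m = (\<Sum>v\<in>UNIV. Poly_Mapping.lookup m v)"

lemma mdeg_add: "mdeg (m + m') = mdeg m + mdeg m'"
  by (simp add: mdeg_def lookup_add sum.distrib)

lemma mdeg_single [simp]: "mdeg (Poly_Mapping.single v k) = k"
  by (simp add: mdeg_def lookup_single when_def)

lemma mdeg_eq_0_iff: "mdeg m = 0 \<longleftrightarrow> m = 0"
  by (auto simp: mdeg_def poly_mapping_eq_iff fun_eq_iff)

lemma is_form_iff:
  fixes p :: "('v::finite, 'a::zero) mpoly"
  shows "is_form d p \<longleftrightarrow> (\<forall>m. Poly_Mapping.lookup p m \<noteq> 0 \<longrightarrow> mdeg m = d)"
proof -
  have "(\<Sum>v\<in>Poly_Mapping.keys m. Poly_Mapping.lookup m v) = mdeg m" for m :: "'v \<Rightarrow>\<^sub>0 nat"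
    unfolding mdeg_def by (rule sum.mono_neutral_left) (auto simp: in_keys_iff)
  then show ?thesis by (auto simp: is_form_def in_keys_iff)
qed

definition mmon :: "('v::finite \<Rightarrow> 'b::comm_semiring_1) \<Rightarrow> ('v \<Rightarrow>\<^sub>0 nat) \<Rightarrow> 'b" where
  "mmon s m = (\<Prod>v\<in>UNIV. s v ^ Poly_Mapping.lookup m v)"

lemma mmon_0 [simp]: "mmon s 0 = 1"
  by (simp add: mmon_def)

lemma mmon_add: "mmon s (m + m') = mmon s m * mmon s m'"
  by (simp add: mmon_def lookup_add power_add prod.distrib)

lemma mmon_single [simp]: "mmon s (Poly_Mapping.single v k) = s v ^ k"
proof -
  have "mmon s (Poly_Mapping.single v k) = (\<Prod>w\<in>UNIV. if w = v then s v ^ k else 1)"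
    unfolding mmon_def by (rule prod.cong) (auto simp: lookup_single when_def)
  then show ?thesis by simp
qed

lemma mmon_scale: "mmon (\<lambda>i. t * s i) m = t ^ mdeg m * mmon s m"
  by (simp add: mmon_def mdeg_def power_mult_distrib prod.distrib power_sum)

lemma msubst_superset:
  fixes p :: "('v::finite, 'a::zero) mpoly"
  assumes "finite A" "Poly_Mapping.keys p \<subseteq> A" "c 0 = 0"
  shows "msubst c s p = (\<Sum>m\<in>A. c (Poly_Mapping.lookup p m) * mmon s m)"
proof -
  have "(\<Prod>v\<in>Poly_Mapping.keys m. s v ^ Poly_Mapping.lookup m v) = mmon s m" for m
    unfolding mmon_def by (rule prod.mono_neutral_left) (auto simp: in_keys_iff)
  then have "msubst c s p = (\<Sum>m\<in>Poly_Mapping.keys p. c (Poly_Mapping.lookup p m) * mmon s m)"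
    by (simp add: msubst_def)
  also have "\<dots> = (\<Sum>m\<in>A. c (Poly_Mapping.lookup p m) * mmon s m)"
    by (rule sum.mono_neutral_left) (use assms in \<open>auto simp: in_keys_iff\<close>)
  finally show ?thesis .
qed

text \<open>Three coefficient maps occur: the identity for evaluation, \<open>mconst\<close> for
  \<open>in_x\<close>, and constant univariate polynomials for restriction to a line. The
  homomorphism laws of substitution are proved here for all of them.\<close>

locale coeff_hom =
  fixes c :: "'a::comm_semiring_1 \<Rightarrow> 'b::comm_semiring_1"
  assumes hom_0 [simp]: "c 0 = 0" and hom_1 [simp]: "c 1 = 1"
    and hom_add: "c (a + b) = c a + c b" and hom_mult: "c (a * b) = c a * c b"
begin

lemma msubst_single [simp]:
  fixes s :: "'v::finite \<Rightarrow> 'b"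
  shows "msubst c s (Poly_Mapping.single m a) = c a * mmon s m"
  by (subst msubst_superset[of "{m}"]) (auto simp: lookup_single)

lemma msubst_0 [simp]: "msubst c s 0 = 0"
  by (simp add: msubst_def)

lemma msubst_add:
  fixes s :: "'v::finite \<Rightarrow> 'b"
  shows "msubst c s (p + q) = msubst c s p + msubst c s q"
proof -
  let ?A = "Poly_Mapping.keys p \<union> Poly_Mapping.keys q"
  have "finite ?A" by simp
  then show ?thesis
    using keys_add[of p q]
    by (simp add: msubst_superset[of ?A] lookup_add hom_add distrib_right sum.distrib)
qed

lemma msubst_sum:
  fixes s :: "'v::finite \<Rightarrow> 'b"
  shows "msubst c s (\<Sum>x\<in>A. f x) = (\<Sum>x\<in>A. msubst c s (f x))"
  by (induction A rule: infinite_finite_induct) (auto simp: msubst_add)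

lemma msubst_mult:
  fixes s :: "'v::finite \<Rightarrow> 'b"
  shows "msubst c s (p * q) = msubst c s p * msubst c s q"
proof (induction p rule: mpoly_single_induct)
  case (single m a)
  show ?case
  proof (induction q rule: mpoly_single_induct)
    case (single m' b)
    show ?case by (simp add: mult_single hom_mult mmon_add mult_ac)
  next
    case (add p q)
    then show ?case by (simp add: msubst_add distrib_left)
  qed
next
  case (add p q)
  then show ?case by (simp add: msubst_add distrib_right)
qed

lemma msubst_mconst [simp]:
  fixes s :: "'v::finite \<Rightarrow> 'b"
  shows "msubst c s (mconst a) = c a"
  by (simp add: mconst_def)

lemma msubst_1 [simp]:
  fixes s :: "'v::finite \<Rightarrow> 'b"
  shows "msubst c s 1 = 1"
  using msubst_single[of s 0 1] by simp

lemma msubst_power: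
  fixes s :: "'v::finite \<Rightarrow> 'b"
  shows "msubst c s (p ^ k) = msubst c s p ^ k"
  by (induction k) (auto simp: msubst_mult)

end

lemma coeff_hom_id: "coeff_hom (\<lambda>c. c)"
  by standard auto

lemma coeff_hom_mconst: "coeff_hom (mconst :: 'a::comm_semiring_1 \<Rightarrow> ('v, 'a) mpoly)"
  by standard (auto simp: mconst_def single_add mult_single)

lemma coeff_hom_poly: "coeff_hom (\<lambda>c :: 'a::comm_ring_1. [:c:])"
  by standard (auto simp: one_pCons mult.commute)

context
  fixes s :: "'v::finite \<Rightarrow> 'a::comm_semiring_1"
begin

interpretation coeff_hom "\<lambda>c::'a. c" by (rule coeff_hom_id)

lemmas meval_simps [simp] = msubst_single[of s] msubst_0[of s] msubst_add[of s] msubst_sum[of s]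
  msubst_mult[of s] msubst_mconst[of s] msubst_1[of s] msubst_power[of s]

end

lemma meval_mvar [simp]: "meval s (mvar v) = s (v :: 'v::finite)"
  by (simp add: mvar_def)

lemma mpoly_ring_induct [case_names const var add mult]:
  fixes p :: "('v::finite, 'a::comm_ring_1) mpoly"
  assumes const: "\<And>c. P (mconst c)" and var: "\<And>v. P (mvar v)"
    and add: "\<And>p q. P p \<Longrightarrow> P q \<Longrightarrow> P (p + q)" and mult: "\<And>p q. P p \<Longrightarrow> P q \<Longrightarrow> P (p * q)"
  shows "P p"
proof (induction p rule: mpoly_single_induct)
  case (single m c)
  have one: "P 1" using const[of 1] by (simp add: mconst_def)
  have "P (Poly_Mapping.single (Poly_Mapping.single v k) 1)" for v k
  proof (induction k)
    case (Suc k)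
    have "Poly_Mapping.single (Poly_Mapping.single v (Suc k)) (1::'a)
        = mvar v * Poly_Mapping.single (Poly_Mapping.single v k) 1"
      by (simp add: mvar_def mult_single flip: single_add)
    then show ?case using mult[OF var Suc] by metis
  qed (simp add: one)
  then have pw: "P (Poly_Mapping.single m 1)" for m
  proof (induction m rule: update_induct)
    case const
    show ?case by (simp add: one)
  next
    case (update f a b)
    have "Poly_Mapping.update a b f = f + Poly_Mapping.single a b"
      by (rule poly_mapping_eqI)
        (use update(1) in \<open>auto simp: lookup_update lookup_add lookup_single when_def in_keys_iff\<close>)
    then have "Poly_Mapping.single (Poly_Mapping.update a b f) (1::'a)
        = Poly_Mapping.single f 1 * Poly_Mapping.single (Poly_Mapping.single a b) 1"
      by (simp add: mult_single)
    then show ?case using mult[OF update(3)[OF update(4)] update(4)] by metis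
  qed
  have "Poly_Mapping.single m c = mconst c * Poly_Mapping.single m 1"
    by (simp add: mconst_def mult_single)
  then show ?case using mult[OF const pw] by metis
next
  case (add p q)
  then show ?case using assms(3) by blast
qed

section \<open>Formal partial derivatives and forms\<close>

lemma mpartial_superset:
  fixes p :: "('v, 'a::comm_semiring_1) mpoly"
  assumes "finite A" "Poly_Mapping.keys p \<subseteq> A"
  shows "mpartial v p = (\<Sum>m\<in>A. Poly_Mapping.single (m - Poly_Mapping.single v 1)
          (of_nat (Poly_Mapping.lookup m v) * Poly_Mapping.lookup p m))"
  unfolding mpartial_def
  by (rule sum.mono_neutral_left) (use assms in \<open>auto simp: in_keys_iff\<close>)

lemma mpartial_single:
  "mpartial v (Poly_Mapping.single m a)
    = Poly_Mapping.single (m - Poly_Mapping.single v 1) (of_nat (Poly_Mapping.lookup m v) * a)"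
  by (subst mpartial_superset[of "{m}"]) auto

lemma mpartial_add [simp]: "mpartial v (p + q) = mpartial v p + mpartial v q"
proof -
  let ?A = "Poly_Mapping.keys p \<union> Poly_Mapping.keys q"
  have "finite ?A" by simp
  then show ?thesis
    using keys_add[of p q]
    by (simp add: mpartial_superset[of ?A] lookup_add distrib_left single_add sum.distrib)
qed

lemma mpartial_0 [simp]: "mpartial v 0 = 0"
  by (simp add: mpartial_def)

lemma mpartial_sum [simp]: "mpartial v (\<Sum>x\<in>A. f x) = (\<Sum>x\<in>A. mpartial v (f x))"
  by (induction A rule: infinite_finite_induct) auto

lemma mpartial_mconst [simp]: "mpartial v (mconst a) = 0"
  by (simp add: mconst_def mpartial_single)

lemma mpartial_mvar [simp]: "mpartial v (mvar w) = (if v = w then 1 else 0)"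
  by (auto simp: mvar_def mpartial_single lookup_single)

lemma lookup_mpartial:
  "Poly_Mapping.lookup (mpartial v p) m
    = of_nat (Suc (Poly_Mapping.lookup m v)) * Poly_Mapping.lookup p (m + Poly_Mapping.single v 1)"
proof (induction p rule: mpoly_single_induct)
  case (single m' a)
  show ?case
  proof (cases "Poly_Mapping.lookup m' v = 0")
    case True
    then have "m' \<noteq> m + Poly_Mapping.single v 1"
      by (auto simp: lookup_add)
    then show ?thesis using True by (simp add: mpartial_single lookup_single)
  next
    case False
    have "m' - Poly_Mapping.single v 1 = m \<longleftrightarrow> m' = m + Poly_Mapping.single v 1"
    proof
      assume *: "m' - Poly_Mapping.single v 1 = m"
      show "m' = m + Poly_Mapping.single v 1"
        unfolding *[symmetric]
        by (rule poly_mapping_eqI)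
          (use False in \<open>auto simp: lookup_add lookup_minus lookup_single when_def\<close>)
    qed auto
    then show ?thesis by (auto simp: mpartial_single lookup_single when_def lookup_add)
  qed
next
  case (add p q)
  then show ?case by (simp add: lookup_add algebra_simps)
qed

lemma mpartial_mult: "mpartial v (p * q) = mpartial v p * q + p * mpartial v q"
proof (induction p rule: mpoly_single_induct)
  case (single m a)
  show ?case
  proof (induction q rule: mpoly_single_induct)
    case (single m' b)
    have *: "m + m' - Poly_Mapping.single v 1 = m - Poly_Mapping.single v 1 + m'"
      if "Poly_Mapping.lookup m v \<noteq> 0" for m m' :: "'a \<Rightarrow>\<^sub>0 nat"
      by (rule poly_mapping_eqI)
        (use that in \<open>auto simp: lookup_add lookup_minus lookup_single when_def\<close>)
    show ?case
      using *[of m m'] *[of m' m]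
      by (cases "Poly_Mapping.lookup m v = 0"; cases "Poly_Mapping.lookup m' v = 0")
        (auto simp: mult_single mpartial_single lookup_add algebra_simps simp flip: single_add)
  next
    case (add p q)
    then show ?case by (simp add: algebra_simps)
  qed
next
  case (add p q)
  then show ?case by (simp add: algebra_simps)
qed

lemma mpartial_1 [simp]: "mpartial v 1 = 0"
  using mpartial_mconst[of v 1] by (simp add: mconst_def)

lemma mpartial_mconst_mult [simp]: "mpartial v (mconst c * p) = mconst c * mpartial v p"
  by (simp add: mpartial_mult)

lemma mpartial_power_Suc:
  "mpartial v (p ^ Suc k) = of_nat (Suc k) * p ^ k * mpartial v p"
  by (induction k) (auto simp: mpartial_mult algebra_simps)

lemma mpartial_commute:
  fixes p :: "('v::finite, 'a::comm_ring_1) mpoly"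
  shows "mpartial v (mpartial w p) = mpartial w (mpartial v p)"
  by (induction p rule: mpoly_ring_induct) (auto simp: mpartial_mult algebra_simps)

text \<open>Both sides obey the same sum and product rules in \<open>p\<close>, so it suffices to
  compare them on constants and variables. The derivation \<open>D\<close> is abstract;
  \<open>pderiv\<close> is the one used below.\<close>

lemma msubst_chain_rule:
  fixes s :: "'v::finite \<Rightarrow> 'b::comm_ring_1" and c :: "'a::comm_ring_1 \<Rightarrow> 'b"
  assumes "coeff_hom c"
    and D_add: "\<And>a b. D (a + b) = D a + D b" and D_mult: "\<And>a b. D (a * b) = D a * b + a * D b"
    and D_const: "\<And>a. D (c a) = 0"
  shows "D (msubst c s p) = (\<Sum>i\<in>UNIV. D (s i) * msubst c s (mpartial i p))"
proof -
  interpret coeff_hom c by fact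
  have D0: "D 0 = 0" using D_const[of 0] by simp
  show ?thesis
  proof (induction p rule: mpoly_ring_induct)
    case (const a)
    then show ?case by (simp add: D_const)
  next
    case (var v)
    have "(\<Sum>i\<in>UNIV. D (s i) * msubst c s (mpartial i (mvar v)))
        = (\<Sum>i\<in>UNIV. if i = v then D (s i) else 0)"
      by (rule sum.cong) auto
    then show ?case by (simp add: mvar_def)
  next
    case (add p q)
    then show ?case by (simp add: D_add msubst_add distrib_left sum.distrib)
  next
    case (mult p q)
    then show ?case
      by (simp add: D_mult msubst_mult msubst_add mpartial_mult distrib_left sum.distrib
          sum_distrib_left sum_distrib_right mult_ac)
  qed
qed

lemma is_form_0 [simp]: "is_form d 0"
  by (simp add: is_form_def)

lemma is_form_add: "is_form d p \<Longrightarrow> is_form d q \<Longrightarrow> is_form d (p + q)"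
  unfolding is_form_def using keys_add[of p q] by blast

lemma is_form_sum: "(\<And>x. x \<in> A \<Longrightarrow> is_form d (f x)) \<Longrightarrow> is_form d (\<Sum>x\<in>A. f x)"
  by (induction A rule: infinite_finite_induct) (auto intro: is_form_add)

lemma is_form_mult:
  fixes p q :: "('v::finite, 'a::comm_semiring_1) mpoly"
  assumes "is_form d p" "is_form e q"
  shows "is_form (d + e) (p * q)"
  unfolding is_form_iff
proof (intro allI impI)
  fix m assume "Poly_Mapping.lookup (p * q) m \<noteq> 0"
  then have "m \<in> Poly_Mapping.keys (p * q)" by (simp add: in_keys_iff)
  then obtain a b where "m = a + b" "a \<in> Poly_Mapping.keys p" "b \<in> Poly_Mapping.keys q"
    using keys_mult[of p q] by blast
  then show "mdeg m = d + e"
    using assms by (auto simp: is_form_iff mdeg_add in_keys_iff)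
qed

lemma is_form_mconst [simp]: "is_form 0 (mconst c)"
  by (simp add: is_form_def mconst_def)

lemma is_form_1 [simp]: "is_form 0 1"
  by (simp add: is_form_def)

lemma is_form_mvar [simp]: "is_form 1 (mvar (v::'v::finite))"
  by (auto simp: is_form_iff mvar_def lookup_single when_def split: if_splits)

lemma is_form_power:
  fixes p :: "('v::finite, 'a::comm_semiring_1) mpoly"
  shows "is_form d p \<Longrightarrow> is_form (d * k) (p ^ k)"
  by (induction k) (auto dest: is_form_mult)

lemma is_form_mconst_mult:
  fixes p :: "('v::finite, 'a::comm_semiring_1) mpoly"
  shows "is_form d p \<Longrightarrow> is_form d (mconst c * p)"
  using is_form_mult[OF is_form_mconst] by fastforce

lemma is_form_mpartial:
  fixes p :: "('v::finite, 'a::comm_semiring_1) mpoly"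
  assumes "is_form d p"
  shows "is_form (d - 1) (mpartial v p)"
  unfolding is_form_iff
proof (intro allI impI)
  fix m assume "Poly_Mapping.lookup (mpartial v p) m \<noteq> 0"
  then have "Poly_Mapping.lookup p (m + Poly_Mapping.single v 1) \<noteq> 0"
    by (auto simp: lookup_mpartial)
  then have "mdeg (m + Poly_Mapping.single v 1) = d"
    using assms by (simp add: is_form_iff)
  then show "mdeg m = d - 1" by (simp add: mdeg_add)
qed

lemma form_0_eq_mconst:
  fixes p :: "('v::finite, 'a::comm_semiring_1) mpoly"
  assumes "is_form 0 p"
  shows "p = mconst (Poly_Mapping.lookup p 0)"
proof (rule poly_mapping_eqI)
  fix m
  show "Poly_Mapping.lookup p m = Poly_Mapping.lookup (mconst (Poly_Mapping.lookup p 0)) m"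
    using assms by (cases "m = 0") (auto simp: is_form_iff mconst_def lookup_single mdeg_eq_0_iff)
qed

lemma mpoly_eq_sum_single:
  fixes p :: "('v, 'a::comm_monoid_add) mpoly"
  shows "p = (\<Sum>m\<in>Poly_Mapping.keys p. Poly_Mapping.single m (Poly_Mapping.lookup p m))"
  by (rule poly_mapping_eqI) (auto simp: lookup_sum lookup_single when_def in_keys_iff)

text \<open>On a monomial, \<open>mvar v * mpartial v\<close> multiplies by the exponent of
  \<open>v\<close>, and the exponents add up to the degree.\<close>

lemma euler_identity:
  fixes p :: "('v::finite, 'a::comm_semiring_1) mpoly"
  assumes "is_form d p"
  shows "(\<Sum>v\<in>UNIV. mvar v * mpartial v p) = of_nat d * p"
proof -
  have single: "(\<Sum>v\<in>UNIV. mvar v * mpartial v (Poly_Mapping.single m a))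
      = of_nat (mdeg m) * Poly_Mapping.single m a" for m :: "'v \<Rightarrow>\<^sub>0 nat" and a :: 'a
  proof -
    have "mvar v * mpartial v (Poly_Mapping.single m a)
        = of_nat (Poly_Mapping.lookup m v) * Poly_Mapping.single m a" for v
    proof (cases "Poly_Mapping.lookup m v = 0")
      case False
      have "Poly_Mapping.single v 1 + (m - Poly_Mapping.single v 1) = m"
        by (rule poly_mapping_eqI)
          (use False in \<open>auto simp: lookup_add lookup_minus lookup_single when_def\<close>)
      then show ?thesis
        by (simp add: mvar_def mpartial_single mult_single flip: single_of_nat)
    qed (simp add: mpartial_single)
    then show ?thesis by (simp add: mdeg_def sum_distrib_right)
  qed
  let ?t = "\<lambda>m. Poly_Mapping.single m (Poly_Mapping.lookup p m)"
  have "(\<Sum>v\<in>UNIV. mvar v * mpartial v (\<Sum>m\<in>Poly_Mapping.keys p. ?t m))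
      = (\<Sum>m\<in>Poly_Mapping.keys p. \<Sum>v\<in>UNIV. mvar v * mpartial v (?t m))"
    by (simp add: sum_distrib_left) (rule sum.swap)
  also have "\<dots> = (\<Sum>m\<in>Poly_Mapping.keys p. of_nat d * ?t m)"
    by (rule sum.cong) (use assms in \<open>auto simp: single is_form_iff in_keys_iff\<close>)
  finally show ?thesis
    unfolding mpoly_eq_sum_single[symmetric] by (simp add: mpoly_eq_sum_single[symmetric] flip: sum_distrib_left)
qed

lemma meval_scale:
  fixes p :: "('v::finite, 'a::comm_semiring_1) mpoly"
  assumes "is_form d p"
  shows "meval (\<lambda>i. t * s i) p = t ^ d * meval s p"
proof -
  have *: "meval s' p = (\<Sum>m\<in>Poly_Mapping.keys p. Poly_Mapping.lookup p m * mmon s' m)" for s'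
    by (rule msubst_superset) auto
  show ?thesis
    unfolding * sum_distrib_left
    by (rule sum.cong) (use assms in \<open>auto simp: mmon_scale is_form_iff in_keys_iff mult_ac\<close>)
qed

lemma poly_msubst:
  fixes s :: "'v::finite \<Rightarrow> real poly"
  shows "poly (msubst (\<lambda>c. [:c:]) s p) t = meval (\<lambda>i. poly (s i) t) p"
proof -
  interpret coeff_hom "\<lambda>c::real. [:c:]" by (rule coeff_hom_poly)
  have "poly (msubst (\<lambda>c. [:c:]) s (mvar v)) t = poly (s v) t" for v
    by (simp add: mvar_def)
  then show ?thesis
    by (induction p rule: mpoly_ring_induct) (simp_all add: msubst_add msubst_mult)
qed

lemma pderiv_msubst:
  fixes s :: "'v::finite \<Rightarrow> real poly"
  shows "pderiv (msubst (\<lambda>c. [:c:]) s p)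
    = (\<Sum>i\<in>UNIV. pderiv (s i) * msubst (\<lambda>c. [:c:]) s (mpartial i p))"
  by (rule msubst_chain_rule[OF coeff_hom_poly]) (auto simp: pderiv_add pderiv_mult pderiv_pCons)

text \<open>Induction on a bound for the degree: if the function vanishes, so do its partial
  derivatives, which have smaller degree and are therefore zero as polynomials. In characteristic 0
  this kills every coefficient but the constant one, which is the value at the origin.\<close>

lemma meval_eq_0_imp:
  fixes p :: "('v::finite, real) mpoly"
  assumes "\<And>s. meval s p = 0"
  shows "p = 0"
proof -
  have "p = 0" if "\<And>s. meval s p = 0" "\<And>m. Poly_Mapping.lookup p m \<noteq> 0 \<Longrightarrow> mdeg m < N" for N
    using that
  proof (induction N arbitrary: p)
    case 0
    then have "Poly_Mapping.lookup p m = 0" for m by auto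
    then show ?case by (auto intro!: poly_mapping_eqI)
  next
    case (Suc N)
    have "mpartial v p = 0" for v
    proof (rule Suc.IH)
      fix s :: "'v \<Rightarrow> real"
      \<comment> \<open>The line through \<open>s\<close> in the direction of the coordinate
        \<open>v\<close>; the derivative at parameter 0 is the partial derivative at
        \<open>s\<close>.\<close>
      let ?s = "\<lambda>i. [:s i, if i = v then 1 else 0:]"
      have "msubst (\<lambda>c. [:c:]) ?s p = 0"
        by (subst poly_all_0_iff_0[symmetric]) (simp add: poly_msubst Suc.prems)
      then have "(\<Sum>i\<in>UNIV. pderiv (?s i) * msubst (\<lambda>c. [:c:]) ?s (mpartial i p)) = 0"
        using pderiv_msubst[of ?s p] by (simp add: pderiv_0)
      also have "(\<Sum>i\<in>UNIV. pderiv (?s i) * msubst (\<lambda>c. [:c:]) ?s (mpartial i p))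
          = (\<Sum>i\<in>UNIV. if i = v then msubst (\<lambda>c. [:c:]) ?s (mpartial i p) else 0)"
        by (rule sum.cong) (auto simp: pderiv_pCons)
      finally have "poly (msubst (\<lambda>c. [:c:]) ?s (mpartial v p)) 0 = 0" by simp
      then show "meval s (mpartial v p) = 0" by (simp add: poly_msubst)
    next
      fix m assume "Poly_Mapping.lookup (mpartial v p) m \<noteq> 0"
      then have "mdeg (m + Poly_Mapping.single v 1) < Suc N"
        by (intro Suc.prems) (auto simp: lookup_mpartial)
      then show "mdeg m < N" by (simp add: mdeg_add)
    qed
    then have "Poly_Mapping.lookup p (m + Poly_Mapping.single v 1) = 0" for m v
      using lookup_mpartial[of v p m] by simp
    moreover have "\<exists>v m'. m = m' + Poly_Mapping.single v 1" if nz: "m \<noteq> 0" for m :: "'v \<Rightarrow>\<^sub>0 nat"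
    proof -
      obtain v where "Poly_Mapping.lookup m v \<noteq> 0"
        using nz by (metis poly_mapping_eqI lookup_zero)
      then have "m = (m - Poly_Mapping.single v 1) + Poly_Mapping.single v 1"
        by (intro poly_mapping_eqI) (auto simp: lookup_add lookup_minus lookup_single when_def)
      then show ?thesis by blast
    qed
    ultimately have zero: "Poly_Mapping.lookup p m = 0" if "m \<noteq> 0" for m
      using that by metis
    then have "is_form 0 p" by (metis is_form_iff mdeg_eq_0_iff)
    then have "p = mconst (Poly_Mapping.lookup p 0)" by (rule form_0_eq_mconst)
    then show ?case
      using Suc.prems(1)[of "\<lambda>_. 0"] by (metis meval_simps(6) mconst_def single_zero)
  qed
  from this[of "Suc (Max (mdeg ` Poly_Mapping.keys p))"] show ?thesis
    using assms by (auto simp: in_keys_iff less_Suc_eq_le)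
qed

text \<open>Explicit sums of squares are verified below by comparing values at real points.\<close>

lemma mpoly_eqI_meval:
  fixes p q :: "('v::finite, real) mpoly"
  assumes "\<And>s. meval s p = meval s q"
  shows "p = q"
proof -
  have "meval s p = meval s (p - q) + meval s q" for s
    by (subst meval_simps(3)[symmetric]) simp
  then have "p - q = 0" by (intro meval_eq_0_imp) (use assms in auto)
  then show ?thesis by simp
qed

section \<open>Gauss--Hermite quadrature\<close>

text \<open>The moments of the standard normal distribution; the recursion is integration by parts
  against its density.\<close>

fun gauss_moment :: "nat \<Rightarrow> real" where
  "gauss_moment 0 = 1"
| "gauss_moment (Suc 0) = 0"
| "gauss_moment (Suc (Suc k)) = real (Suc k) * gauss_moment k"

definition gauss_poly :: "real poly \<Rightarrow> real" where
  "gauss_poly p = (\<Sum>i\<le>degree p. coeff p i * gauss_moment i)"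

lemma gauss_poly_bound:
  assumes "degree p \<le> N"
  shows "gauss_poly p = (\<Sum>i\<le>N. coeff p i * gauss_moment i)"
  unfolding gauss_poly_def
  by (rule sum.mono_neutral_left) (use assms in \<open>auto simp: coeff_eq_0\<close>)

lemma gauss_poly_0 [simp]: "gauss_poly 0 = 0"
  by (simp add: gauss_poly_def)

lemma gauss_poly_add: "gauss_poly (p + q) = gauss_poly p + gauss_poly q"
  by (simp add: gauss_poly_bound[of _ "max (degree p) (degree q)"] degree_add_le
      distrib_right sum.distrib)

lemma gauss_poly_smult: "gauss_poly (smult c p) = c * gauss_poly p"
  by (simp add: gauss_poly_bound[of _ "degree p"] degree_smult_le sum_distrib_left mult_ac)

lemma gauss_poly_minus: "gauss_poly (- p) = - gauss_poly p"
  using gauss_poly_smult[of "-1" p] by simp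

lemma gauss_poly_diff: "gauss_poly (p - q) = gauss_poly p - gauss_poly q"
  using gauss_poly_add[of p "- q"] by (simp add: gauss_poly_minus)

lemma gauss_poly_sum: "gauss_poly (\<Sum>x\<in>A. f x) = (\<Sum>x\<in>A. gauss_poly (f x))"
  by (induction A rule: infinite_finite_induct) (auto simp: gauss_poly_add)

lemma gauss_poly_const [simp]: "gauss_poly [:c:] = c"
  by (simp add: gauss_poly_def)

lemma gauss_poly_monom: "gauss_poly (monom 1 k) = gauss_moment k"
proof -
  have "gauss_poly (monom 1 k) = (\<Sum>i\<le>k. if i = k then gauss_moment k else 0)"
    by (subst gauss_poly_bound[of _ k], rule degree_monom_le, rule sum.cong) auto
  then show ?thesis by simp
qed

text \<open>Stein's identity: the mean of \<open>X p(X)\<close> is the mean of \<open>p'(X)\<close>.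
  Coefficient by coefficient it is the recursion of the moments.\<close>

lemma gauss_poly_pCons_0: "gauss_poly (pCons 0 p) = gauss_poly (pderiv p)"
proof -
  define N where "N = Suc (degree p)"
  have "gauss_poly (pCons 0 p) = (\<Sum>i\<le>Suc N. coeff (pCons 0 p) i * gauss_moment i)"
    by (rule gauss_poly_bound) (use degree_pCons_le[of 0 p] in \<open>simp add: N_def\<close>)
  also have "\<dots> = (\<Sum>i\<le>N. coeff p i * gauss_moment (Suc i))"
    by (subst sum.atMost_Suc_shift) simp
  also have "\<dots> = (\<Sum>i\<le>degree p. coeff p (Suc i) * gauss_moment (Suc (Suc i)))"
    unfolding N_def by (subst sum.atMost_Suc_shift) simp
  also have "\<dots> = (\<Sum>i\<le>degree p. coeff (pderiv p) i * gauss_moment i)"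
    by (simp add: coeff_pderiv algebra_simps)
  also have "\<dots> = gauss_poly (pderiv p)"
    by (rule gauss_poly_bound[symmetric]) (simp add: degree_pderiv)
  finally show ?thesis .
qed

text \<open>The monic Hermite polynomials in the normalization of probability theory. By Stein's
  identity, multiplication by the variable minus differentiation is the adjoint of
  differentiation.\<close>

fun hermite :: "nat \<Rightarrow> real poly" where
  "hermite 0 = 1"
| "hermite (Suc k) = pCons 0 (hermite k) - pderiv (hermite k)"

lemma hermite_degree_coeff: "degree (hermite k) = k \<and> coeff (hermite k) k = 1"
proof (induction k)
  case (Suc k)
  have c: "coeff (hermite (Suc k)) (Suc k) = 1"
    using Suc by (simp add: coeff_pderiv coeff_eq_0)
  have "degree (hermite (Suc k)) \<le> Suc k"
    using Suc by (auto intro!: degree_diff_le degree_pCons_le[THEN order_trans] simp: degree_pderiv)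
  with c show ?case
    by (metis le_degree le_antisym zero_neq_one)
qed simp

lemmas degree_hermite [simp] = hermite_degree_coeff[THEN conjunct1]
lemmas coeff_hermite [simp] = hermite_degree_coeff[THEN conjunct2]

lemma hermite_nonzero [simp]: "hermite k \<noteq> 0"
  using coeff_hermite[of k] by (metis coeff_0 zero_neq_one)

lemma gauss_poly_hermite_Suc:
  "gauss_poly (hermite (Suc k) * p) = gauss_poly (hermite k * pderiv p)"
proof -
  have "gauss_poly (pCons 0 (hermite k * p))
      = gauss_poly (pderiv (hermite k) * p) + gauss_poly (hermite k * pderiv p)"
    by (simp add: gauss_poly_pCons_0 pderiv_mult gauss_poly_add mult_ac)
  moreover have "hermite (Suc k) * p = pCons 0 (hermite k * p) - pderiv (hermite k) * p"
    by (simp add: left_diff_distrib)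
  ultimately show ?thesis by (simp only: gauss_poly_diff)
qed

text \<open>Moving all \<open>k\<close> derivatives onto \<open>p\<close> leaves the constant
  \<open>k\<close>-th derivative. For \<open>degree p < k\<close> this is the orthogonality of the
  Hermite polynomials.\<close>

lemma gauss_poly_hermite_mult:
  "degree p \<le> k \<Longrightarrow> gauss_poly (hermite k * p) = fact k * coeff p k"
proof (induction k arbitrary: p)
  case 0
  then obtain c where "p = [:c:]" by (auto elim: degree_eq_zeroE)
  then show ?case by simp
next
  case (Suc k)
  then have "gauss_poly (hermite (Suc k) * p) = fact k * coeff (pderiv p) k"
    unfolding gauss_poly_hermite_Suc by (intro Suc.IH) (simp add: degree_pderiv)
  then show ?case by (simp add: coeff_pderiv algebra_simps)
qed

text \<open>The leading term is split off as a multiple of \<open>hermite k\<close>. The remainder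
  has smaller degree and is orthogonal to it, so the means of the two squares add up.\<close>

lemma gauss_poly_square_pos:
  "p \<noteq> 0 \<Longrightarrow> gauss_poly (p * p) > 0"
proof (induction "degree p" arbitrary: p rule: less_induct)
  case less
  define k where "k = degree p"
  define a where "a = coeff p k"
  define q where "q = p - smult a (hermite k)"
  have a: "a \<noteq> 0" using less.prems by (simp add: a_def k_def)
  have p: "p = smult a (hermite k) + q" by (simp add: q_def)
  have qk: "coeff q k = 0" by (simp add: q_def a_def)
  have deg: "degree q \<le> k" by (auto simp: q_def k_def intro!: degree_diff_le degree_smult_le[THEN order_trans])
  have hq: "gauss_poly (hermite k * q) = 0" using gauss_poly_hermite_mult[OF deg] qk by simp
  have hh: "gauss_poly (hermite k * hermite k) = fact k" using gauss_poly_hermite_mult[of "hermite k" k] by simp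
  have "p * p = smult (a * a) (hermite k * hermite k) + smult (2 * a) (hermite k * q) + q * q"
    unfolding p poly_eq_poly_eq_iff[symmetric] fun_eq_iff by (simp add: algebra_simps)
  then have "gauss_poly (p * p) = a * a * fact k + gauss_poly (q * q)"
    by (simp only: gauss_poly_add gauss_poly_smult hh hq)
  moreover have "gauss_poly (q * q) \<ge> 0"
  proof (cases "q = 0")
    case False
    then have "degree q < k" using deg qk by (metis le_neq_implies_less leading_coeff_0_iff)
    then show ?thesis using less.hyps[of q] False by (simp add: k_def)
  qed simp
  moreover have "a * a * fact k > 0"
    using a by (metis fact_gt_zero mult_pos_pos not_real_square_gt_zero)
  ultimately show ?case by linarith
qed

lemma real_poly_bounded_below_attains_min:
  fixes p :: "real poly"
  assumes "\<And>x. poly p x \<ge> 0"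
  shows "\<exists>x0. \<forall>x. poly p x0 \<le> poly p x"
proof (cases "degree p = 0")
  case True
  then obtain c where "p = [:c:]" by (auto elim: degree_eq_zeroE)
  then show ?thesis by auto
next
  case False
  have "filterlim (poly p) at_infinity at_infinity"
    using False by (intro filterlim_poly_at_infinity) auto
  then have "eventually (\<lambda>x. norm (poly p x) \<ge> poly p 0) at_infinity"
    by (simp add: filterlim_at_infinity[where c = 0 and f = "poly p"] filterlim_at_infinity_conv_norm_at_top filterlim_at_top)
  then obtain b where b: "\<And>x. norm x \<ge> b \<Longrightarrow> poly p x \<ge> poly p 0"
    using assms by (auto simp: eventually_at_infinity)
  have "\<exists>x0\<in>cball 0 \<bar>b\<bar>. \<forall>x\<in>cball 0 \<bar>b\<bar>. poly p x0 \<le> poly p x"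
    by (intro continuous_attains_inf) (auto intro!: continuous_intros)
  then obtain x0 where x0: "x0 \<in> cball 0 \<bar>b\<bar>" "\<And>x. x \<in> cball 0 \<bar>b\<bar> \<Longrightarrow> poly p x0 \<le> poly p x"
    by blast
  have "poly p x0 \<le> poly p x" for x
  proof (cases "x \<in> cball 0 \<bar>b\<bar>")
    case False
    then have "poly p 0 \<le> poly p x" by (intro b) auto
    moreover have "poly p x0 \<le> poly p 0" by (intro x0) auto
    ultimately show ?thesis by simp
  qed (use x0 in auto)
  then show ?thesis by blast
qed

text \<open>
  Subtracting the minimum of a nonnegative polynomial leaves a double root to divide out; this
  makes it a sum of squares.
\<close>

lemma gauss_poly_nonneg_pos:
  fixes p q :: "real poly"
  assumes "\<And>x. poly p x \<ge> 0" "p \<noteq> 0" "q \<noteq> 0"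
  shows "gauss_poly (p * q * q) > 0"
  using assms
proof (induction "degree p" arbitrary: p q rule: less_induct)
  case less
  obtain x0 where x0: "\<And>x. poly p x0 \<le> poly p x"
    using real_poly_bounded_below_attains_min less.prems(1) by blast
  define m where "m = poly p x0"
  have m: "m \<ge> 0" using less.prems by (simp add: m_def)
  have "poly (p - [:m:]) x0 = 0" by (simp add: m_def)
  then obtain p1 where p1: "p - [:m:] = [:-x0, 1:] * p1" by (metis dvdE poly_eq_0_iff_dvd)
  have "poly (pderiv p) x0 = 0"
    by (rule DERIV_local_min[OF poly_DERIV, of 1]) (use x0 in auto)
  moreover have "pderiv (p - [:m:]) = pderiv p" by (simp add: pderiv_diff pderiv_pCons)
  ultimately have "poly p1 x0 = 0"
    using arg_cong[OF p1, of "\<lambda>q. poly (pderiv q) x0"]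
    by (simp only: pderiv_mult) (simp add: pderiv_pCons)
  then obtain p2 where p2: "p1 = [:-x0, 1:] * p2" by (metis dvdE poly_eq_0_iff_dvd)
  have p: "p = [:m:] + [:-x0, 1:] * [:-x0, 1:] * p2"
    using p1 unfolding p2 mult.assoc by (metis add.commute diff_add_cancel)
  have nonneg: "poly p2 x \<ge> 0" for x
  proof -
    have off: "poly p2 x \<ge> 0" if "x \<noteq> x0" for x
    proof -
      have "(x - x0) * (x - x0) * poly p2 x \<ge> 0"
        using x0[of x] arg_cong[OF p, of "\<lambda>q. poly q x"] by (simp add: m_def algebra_simps)
      moreover have "(x - x0) * (x - x0) > 0" using that by (metis eq_iff_diff_eq_0 not_real_square_gt_zero)
      ultimately show ?thesis by (simp add: zero_le_mult_iff)
    qed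
    have "poly p2 x0 \<ge> 0"
    proof (rule tendsto_lowerbound)
      show "(poly p2 \<longlongrightarrow> poly p2 x0) (at x0)"
        using poly_isCont[of x0 p2] by (simp add: isCont_def)
      show "\<forall>\<^sub>F x in at x0. 0 \<le> poly p2 x"
        using off by (auto simp: eventually_at_filter)
    qed simp
    then show ?thesis using off by metis
  qed
  \<comment> \<open>The square \<open>q * q\<close> in the statement absorbs the double factor
    \<open>X - x0\<close>, so that the induction hypothesis applies to \<open>p2\<close>.\<close>
  have split: "gauss_poly (p * q * q)
      = m * gauss_poly (q * q) + gauss_poly (p2 * ([:-x0, 1:] * q) * ([:-x0, 1:] * q))"
  proof -
    have "p * q * q = smult m (q * q) + p2 * ([:-x0, 1:] * q) * ([:-x0, 1:] * q)"
      by (subst p, unfold poly_eq_poly_eq_iff[symmetric] fun_eq_iff) (simp add: algebra_simps)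
    then show ?thesis by (simp only: gauss_poly_add gauss_poly_smult)
  qed
  have q: "gauss_poly (q * q) > 0" using less.prems by (intro gauss_poly_square_pos)
  show ?case
  proof (cases "p2 = 0")
    case True
    then have "m > 0" using m less.prems(2) p by (cases "m = 0") auto
    then show ?thesis unfolding split using True q by simp
  next
    case False
    have "degree ([:-x0, 1:] * [:-x0, 1:] * p2) = 2 + degree p2"
      using False by (simp add: degree_mult_eq del: mult_pCons_left mult_pCons_right)
    moreover have "p - [:m:] = [:-x0, 1:] * [:-x0, 1:] * p2" by (subst p) simp
    ultimately have "degree p = 2 + degree p2"
      by (metis add.commute degree_add_eq_left degree_pCons_0 diff_add_cancel add_pos_nonneg zero_le zero_less_numeral)
    then have "gauss_poly (p2 * ([:-x0, 1:] * q) * ([:-x0, 1:] * q)) > 0"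
      using False nonneg less.prems(3) by (intro less.hyps) (auto simp del: mult_pCons_left)
    then show ?thesis unfolding split using q m by (simp add: add_nonneg_pos)
  qed
qed

text \<open>\<open>A\<close> is the set of roots of odd multiplicity: each root that is divided out
  toggles its membership. The product then has only roots of even multiplicity, and a polynomial
  without roots keeps its sign.\<close>

lemma real_poly_sign_change_factor:
  fixes p :: "real poly"
  assumes "p \<noteq> 0"
  shows "\<exists>A \<sigma>. finite A \<and> A \<subseteq> {x. poly p x = 0} \<and> \<sigma> \<noteq> 0
    \<and> (\<forall>x. \<sigma> * poly (p * (\<Prod>a\<in>A. [:-a, 1:])) x \<ge> 0)"
  using assms
proof (induction "degree p" arbitrary: p rule: less_induct)
  case less
  show ?case
  proof (cases "\<exists>a. poly p a = 0")
    case False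
    have *: "poly p x * poly p y > 0" for x y
    proof (rule ccontr)
      assume "\<not> ?thesis"
      then have neg: "poly p x * poly p y < 0" using False by (metis linorder_neqE_linordered_idom mult_eq_0_iff)
      then have "x \<noteq> y" by (metis not_square_less_zero)
      then show False
        using neg poly_IVT[of x y p] poly_IVT[of y x p] False
        by (metis linorder_neqE_linordered_idom mult.commute)
    qed
    have "poly p 0 \<noteq> 0" using False by blast
    moreover have "poly p 0 * poly (p * (\<Prod>a\<in>{}. [:-a, 1:])) x \<ge> 0" for x
      using *[of 0 x] by simp
    ultimately show ?thesis by (intro exI[of _ "{}"] exI[of _ "poly p 0"]) auto
  next
    case True
    then obtain a p1 where p1: "p = [:-a, 1:] * p1" by (metis dvdE poly_eq_0_iff_dvd)
    then have "p1 \<noteq> 0" using less.prems by auto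
    moreover have "degree p = Suc (degree p1)"
      unfolding p1 using \<open>p1 \<noteq> 0\<close> by (simp add: degree_mult_eq del: mult_pCons_left)
    ultimately obtain A \<sigma> where A: "finite A" "A \<subseteq> {x. poly p1 x = 0}" "\<sigma> \<noteq> 0"
        "\<And>x. \<sigma> * poly (p1 * (\<Prod>a\<in>A. [:-a, 1:])) x \<ge> 0"
      using less.hyps[of p1] by auto
    show ?thesis
    proof (cases "a \<in> A")
      case True
      have "p * (\<Prod>a\<in>A - {a}. [:-a, 1:]) = p1 * (\<Prod>a\<in>A. [:-a, 1:])"
        unfolding p1 by (subst prod.remove[OF A(1) True]) (simp only: mult_ac)
      then show ?thesis
        using A by (intro exI[of _ "A - {a}"] exI[of _ \<sigma>]) (auto simp: p1)
    next
      case False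
      have "p * (\<Prod>a\<in>insert a A. [:-a, 1:]) = [:-a, 1:] * [:-a, 1:] * (p1 * (\<Prod>a\<in>A. [:-a, 1:]))"
        unfolding p1 by (subst prod.insert[OF A(1) False]) (simp only: mult_ac)
      then have "\<sigma> * poly (p * (\<Prod>a\<in>insert a A. [:-a, 1:])) x
          = (x - a) * (x - a) * (\<sigma> * poly (p1 * (\<Prod>a\<in>A. [:-a, 1:])) x)" for x
        by (simp only: poly_mult) simp
      then have "\<sigma> * poly (p * (\<Prod>a\<in>insert a A. [:-a, 1:])) x \<ge> 0" for x
        using A(4)[of x] by (metis mult_nonneg_nonneg zero_le_square)
      then show ?thesis
        using A by (intro exI[of _ "insert a A"] exI[of _ \<sigma>]) (auto simp: p1)
    qed
  qed
qed

text \<open>With fewer than \<open>N\<close> sign changes, the product \<open>Q\<close> over them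
  would have degree below \<open>N\<close>. Then \<open>hermite N * Q\<close> would have mean 0 by
  orthogonality, although it has constant sign and is not zero.\<close>

lemma hermite_roots:
  obtains A where "finite A" "card A = N" "\<And>a. a \<in> A \<Longrightarrow> poly (hermite N) a = 0"
proof -
  obtain A \<sigma> where A: "finite A" "A \<subseteq> {x. poly (hermite N) x = 0}" "\<sigma> \<noteq> 0"
      "\<And>x. \<sigma> * poly (hermite N * (\<Prod>a\<in>A. [:-a, 1:])) x \<ge> 0"
    using real_poly_sign_change_factor[of "hermite N"] by auto
  define Q where "Q = (\<Prod>a\<in>A. [:-a, 1:])"
  have Q: "Q \<noteq> 0" using A(1) by (auto simp: Q_def)
  have degQ: "degree Q = card A"
    unfolding Q_def by (subst degree_prod_eq_sum_degree) auto
  have "\<not> card A < N"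
  proof
    assume less: "card A < N"
    have "gauss_poly (smult \<sigma> (hermite N * Q) * 1 * 1) > 0"
      by (intro gauss_poly_nonneg_pos) (use A Q in \<open>auto simp: Q_def\<close>)
    moreover have "gauss_poly (hermite N * Q) = 0"
      using gauss_poly_hermite_mult[of Q N] less degQ by (simp add: coeff_eq_0)
    ultimately show False by (simp add: gauss_poly_smult)
  qed
  moreover have "card A \<le> N"
    using card_mono[OF poly_roots_finite[of "hermite N"] A(2)] card_poly_roots_bound[of "hermite N"]
    by simp
  ultimately show ?thesis using A that by (metis (mono_tags) mem_Collect_eq not_less le_antisym subsetD)
qed

definition lagrange_basis :: "real set \<Rightarrow> real \<Rightarrow> real poly" where
  "lagrange_basis A a = (\<Prod>b\<in>A - {a}. smult (1 / (a - b)) [:-b, 1:])"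

lemma poly_lagrange_basis:
  assumes "finite A" "a \<in> A" "b \<in> A"
  shows "poly (lagrange_basis A a) b = (if a = b then 1 else 0)"
proof (cases "a = b")
  case True
  then show ?thesis
    by (auto simp: lagrange_basis_def poly_prod diff_divide_distrib[symmetric] intro!: prod.neutral)
next
  case False
  then show ?thesis
    using assms by (auto simp: lagrange_basis_def poly_prod intro!: prod_zero)
qed

lemma degree_lagrange_basis:
  assumes "finite A" "a \<in> A"
  shows "degree (lagrange_basis A a) < card A"
proof -
  have "degree (lagrange_basis A a) \<le> (\<Sum>b\<in>A - {a}. degree (smult (1 / (a - b)) [:-b, 1:]))"
    unfolding lagrange_basis_def
    using degree_prod_sum_le[of "A - {a}" "\<lambda>b. smult (1 / (a - b)) [:-b, 1:]"] assms
    by (simp only: o_def finite_Diff)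
  also have "\<dots> \<le> (\<Sum>b\<in>A - {a}. 1)"
    by (intro sum_mono) simp
  also have "\<dots> < card A" using card_Diff1_less[OF assms] by simp
  finally show ?thesis .
qed

lemma lagrange_interpolation:
  assumes "finite A" "degree p < card A"
  shows "p = (\<Sum>a\<in>A. smult (poly p a) (lagrange_basis A a))"
proof (rule poly_eqI_degree[of A])
  fix x assume "x \<in> A"
  then have "(\<Sum>a\<in>A. poly (smult (poly p a) (lagrange_basis A a)) x)
      = (\<Sum>a\<in>A. if a = x then poly p x else 0)"
    by (intro sum.cong) (use assms in \<open>auto simp: poly_lagrange_basis\<close>)
  also have "\<dots> = poly p x"
    using \<open>x \<in> A\<close> assms(1) by simp
  finally show "poly p x = poly (\<Sum>a\<in>A. smult (poly p a) (lagrange_basis A a)) x"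
    by (simp only: poly_sum)
next
  have "degree (smult (poly p a) (lagrange_basis A a)) \<le> card A - 1" if "a \<in> A" for a
    using degree_smult_le[of "poly p a" "lagrange_basis A a"] degree_lagrange_basis[OF assms(1) that]
    by linarith
  then have "degree (\<Sum>a\<in>A. smult (poly p a) (lagrange_basis A a)) \<le> card A - 1"
    by (intro degree_sum_le assms(1))
  then show "card A > degree (\<Sum>a\<in>A. smult (poly p a) (lagrange_basis A a))"
    using assms(2) by linarith
qed (rule assms(2))

text \<open>Division by \<open>hermite N\<close> leaves a quotient of degree below \<open>N\<close>,
  whose product with \<open>hermite N\<close> has mean 0, and a remainder that interpolation at the
  \<open>N\<close> roots reproduces. At the roots the remainder agrees with
  \<open>p\<close>.\<close>

lemma gauss_hermite_quadrature:
  obtains A w where "finite A" "\<And>a. a \<in> A \<Longrightarrow> w a \<ge> (0::real)"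
    "\<And>p. degree p < 2 * N \<Longrightarrow> gauss_poly p = (\<Sum>a\<in>A. w a * poly p a)"
proof -
  obtain A where A: "finite A" "card A = N" "\<And>a. a \<in> A \<Longrightarrow> poly (hermite N) a = 0"
    using hermite_roots[of N] by metis
  define w where "w a = gauss_poly (lagrange_basis A a)" for a
  have quad: "gauss_poly p = (\<Sum>a\<in>A. w a * poly p a)" if "degree p < 2 * N" for p
  proof -
    define q where "q = p div hermite N"
    define r where "r = p mod hermite N"
    have p: "p = hermite N * q + r" by (simp add: q_def r_def mult.commute)
    have N: "N > 0" using that by auto
    have r: "degree r < N"
      using degree_mod_less'[of "hermite N" p] N by (cases "r = 0") (auto simp: r_def)
    have q: "degree q < N"
    proof (cases "q = 0")
      case False
      have "degree (hermite N * q) = N + degree q" using False by (simp add: degree_mult_eq)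
      then have "degree p = N + degree q" unfolding p using r by (simp add: degree_add_eq_left)
      then show ?thesis using that by simp
    qed (use N in simp)
    have "gauss_poly (hermite N * q) = 0"
      using gauss_poly_hermite_mult[of q N] q by (simp add: coeff_eq_0)
    then have "gauss_poly p = gauss_poly r" by (subst p) (simp add: gauss_poly_add)
    also have "\<dots> = gauss_poly (\<Sum>a\<in>A. smult (poly r a) (lagrange_basis A a))"
      using lagrange_interpolation[of A r] A r by simp
    also have "\<dots> = (\<Sum>a\<in>A. w a * poly r a)"
      by (simp add: gauss_poly_sum gauss_poly_smult w_def mult.commute)
    also have "\<dots> = (\<Sum>a\<in>A. w a * poly p a)"
      by (subst p) (use A(3) in simp)
    finally show ?thesis .
  qed
  have "w a \<ge> 0" if "a \<in> A" for a
  proof -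
    have l: "degree (lagrange_basis A a) < N" using degree_lagrange_basis[of A a] A that by simp
    have nz: "lagrange_basis A a \<noteq> 0"
      using poly_lagrange_basis[OF A(1) that that] by auto
    \<comment> \<open>The square of a basis polynomial has degree at most \<open>2 * N - 2\<close>
      and vanishes at all nodes but \<open>a\<close>, so the rule gives exactly the weight
      \<open>w a\<close>, as the mean of a square.\<close>
    have "gauss_poly (lagrange_basis A a * lagrange_basis A a)
        = (\<Sum>b\<in>A. w b * poly (lagrange_basis A a * lagrange_basis A a) b)"
      by (rule quad) (use l in \<open>simp add: degree_mult_eq nz\<close>)
    also have "\<dots> = (\<Sum>b\<in>A. if b = a then w a else 0)"
      by (rule sum.cong) (use A that in \<open>auto simp: poly_lagrange_basis\<close>)
    finally have "gauss_poly (lagrange_basis A a * lagrange_basis A a) = w a"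
      using A that by simp
    then show ?thesis using gauss_poly_square_pos[OF nz] by simp
  qed
  with A quad that show ?thesis by blast
qed

lemma gauss_moment_quadrature:
  obtains A w where "finite A" "\<And>a. a \<in> A \<Longrightarrow> w a \<ge> (0::real)"
    "\<And>k. k \<le> N \<Longrightarrow> gauss_moment k = (\<Sum>a\<in>A. w a * a ^ k)"
proof -
  obtain A w where A: "finite A" "\<And>a. a \<in> A \<Longrightarrow> w a \<ge> (0::real)"
    "\<And>p. degree p < 2 * Suc N \<Longrightarrow> gauss_poly p = (\<Sum>a\<in>A. w a * poly p a)"
    using gauss_hermite_quadrature[of "Suc N"] by metis
  have "gauss_moment k = (\<Sum>a\<in>A. w a * a ^ k)" if "k \<le> N" for k
    using A(3)[of "monom 1 k"] that by (simp add: gauss_poly_monom degree_monom_eq poly_monom)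
  with A that show ?thesis by blast
qed

section \<open>Gaussian means of polynomials\<close>

text \<open>The expectation for independent standard normal variables, extended linearly from
  monomials.\<close>

definition gauss_mean :: "('v::finite, real) mpoly \<Rightarrow> real" where
  "gauss_mean p = (\<Sum>m\<in>Poly_Mapping.keys p.
     Poly_Mapping.lookup p m * (\<Prod>v\<in>UNIV. gauss_moment (Poly_Mapping.lookup m v)))"

lemma gauss_mean_superset:
  assumes "finite A" "Poly_Mapping.keys p \<subseteq> A"
  shows "gauss_mean p = (\<Sum>m\<in>A.
     Poly_Mapping.lookup p m * (\<Prod>v\<in>UNIV. gauss_moment (Poly_Mapping.lookup m v)))"
  unfolding gauss_mean_def
  by (rule sum.mono_neutral_left) (use assms in \<open>auto simp: in_keys_iff\<close>)

lemma gauss_mean_single: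
  "gauss_mean (Poly_Mapping.single m a) = a * (\<Prod>v\<in>UNIV. gauss_moment (Poly_Mapping.lookup m v))"
  by (subst gauss_mean_superset[of "{m}"]) auto

lemma gauss_mean_add [simp]: "gauss_mean (p + q) = gauss_mean p + gauss_mean q"
proof -
  let ?A = "Poly_Mapping.keys p \<union> Poly_Mapping.keys q"
  have "finite ?A" by simp
  then show ?thesis
    using keys_add[of p q]
    by (simp add: gauss_mean_superset[of ?A] lookup_add distrib_right sum.distrib)
qed

lemma gauss_mean_0 [simp]: "gauss_mean 0 = 0"
  by (simp add: gauss_mean_def)

lemma gauss_mean_1 [simp]: "gauss_mean 1 = 1"
  using gauss_mean_single[of 0 1] by simp

lemma gauss_mean_sum: "gauss_mean (\<Sum>x\<in>A. f x) = (\<Sum>x\<in>A. gauss_mean (f x))"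
  by (induction A rule: infinite_finite_induct) auto

lemma gauss_mean_mconst_mult [simp]: "gauss_mean (mconst c * p) = c * gauss_mean p"
  by (induction p rule: mpoly_single_induct)
    (auto simp: mconst_def mult_single gauss_mean_single distrib_left)

lemma gauss_mean_diff: "gauss_mean (p - q) = gauss_mean p - gauss_mean q"
  using gauss_mean_add[of "p - q" q] by simp

lemma of_nat_eq_mconst: "(of_nat k :: ('v, 'a::comm_semiring_1) mpoly) = mconst (of_nat k)"
  by (simp add: mconst_def)

lemma gauss_mean_of_nat_mult: "gauss_mean (of_nat k * p) = real k * gauss_mean p"
  by (simp add: of_nat_eq_mconst)

lemma gauss_moment_Suc: "gauss_moment (Suc k) = real k * gauss_moment (k - 1)"
  by (cases k) auto

text \<open>Only the factor of the coordinate \<open>i\<close> changes, and there it is the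
  recursion of the moments. The explicit Gaussian means below are computed from this
  identity.\<close>

lemma gauss_mean_by_parts: "gauss_mean (mvar i * p) = gauss_mean (mpartial i p)"
proof (induction p rule: mpoly_single_induct)
  case (single m a)
  let ?P = "\<Prod>v\<in>UNIV - {i}. gauss_moment (Poly_Mapping.lookup m v)"
  have split: "(\<Prod>v\<in>UNIV. g v) = g i * (\<Prod>v\<in>UNIV - {i}. g v)" for g :: "'a \<Rightarrow> real"
    by (rule prod.remove) auto
  have 1: "(\<Prod>v\<in>UNIV. gauss_moment (Poly_Mapping.lookup (Poly_Mapping.single i 1 + m) v))
      = gauss_moment (Suc (Poly_Mapping.lookup m i)) * ?P"
    by (subst split) (auto simp: lookup_add lookup_single intro!: prod.cong)
  have 2: "(\<Prod>v\<in>UNIV. gauss_moment (Poly_Mapping.lookup (m - Poly_Mapping.single i 1) v))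
      = gauss_moment (Poly_Mapping.lookup m i - 1) * ?P"
    by (subst split) (auto simp: lookup_minus lookup_single intro!: prod.cong)
  show ?case
    unfolding mvar_def mult_single mpartial_single gauss_mean_single 1 2
    by (simp add: gauss_moment_Suc)
next
  case (add p q)
  then show ?case by (simp add: distrib_left)
qed

section \<open>The Laplacian and the backward heat operator\<close>

definition laplacian :: "('v::finite, real) mpoly \<Rightarrow> ('v, real) mpoly" where
  "laplacian p = (\<Sum>v\<in>UNIV. mpartial v (mpartial v p))"

lemma laplacian_add: "laplacian (p + q) = laplacian p + laplacian q"
  by (simp add: laplacian_def sum.distrib)

lemma laplacian_0 [simp]: "laplacian 0 = 0"
  by (simp add: laplacian_def)

lemma laplacian_mconst_mult: "laplacian (mconst c * p) = mconst c * laplacian p"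
  by (simp add: laplacian_def sum_distrib_left)

lemma laplacian_pow_0 [simp]: "(laplacian ^^ l) 0 = 0"
  by (induction l) auto

lemma laplacian_pow_add: "(laplacian ^^ l) (p + q) = (laplacian ^^ l) p + (laplacian ^^ l) q"
  by (induction l) (auto simp: laplacian_add)

lemma laplacian_pow_mconst_mult: "(laplacian ^^ l) (mconst c * p) = mconst c * (laplacian ^^ l) p"
  by (induction l) (auto simp: laplacian_mconst_mult)

lemma laplacian_pow_sum: "(laplacian ^^ l) (\<Sum>x\<in>A. f x) = (\<Sum>x\<in>A. (laplacian ^^ l) (f x))"
  by (induction A rule: infinite_finite_induct) (auto simp: laplacian_pow_add)

lemma mpartial_laplacian: "mpartial i (laplacian p) = laplacian (mpartial i p)"
  by (simp add: laplacian_def) (metis mpartial_commute)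

lemma laplacian_mvar_mult: "laplacian (mvar i * p) = mvar i * laplacian p + 2 * mpartial i p"
proof -
  have "mpartial v (mpartial v (mvar i * p))
      = mvar i * mpartial v (mpartial v p) + (if v = i then 2 * mpartial v p else 0)" for v
    by (simp add: mpartial_mult)
  then show ?thesis by (simp add: laplacian_def sum.distrib sum_distrib_left)
qed

text \<open>The commutator of the Laplacian with multiplication by a variable is
  \<open>2 * mpartial i\<close>, which commutes with the Laplacian; each of the \<open>Suc l\<close>
  factors contributes it once.\<close>

lemma laplacian_pow_mvar_mult:
  "(laplacian ^^ Suc l) (mvar i * p)
    = mvar i * (laplacian ^^ Suc l) p + of_nat (2 * Suc l) * mpartial i ((laplacian ^^ l) p)"
proof (induction l)
  case 0
  then show ?case by (simp add: laplacian_mvar_mult)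
next
  case (Suc l)
  have nat: "laplacian (of_nat k * q) = of_nat k * laplacian q" for k and q :: "('a, real) mpoly"
    by (simp add: of_nat_eq_mconst laplacian_mconst_mult)
  show ?case
    unfolding funpow.simps(2)[of "Suc l"] o_apply Suc laplacian_add laplacian_mvar_mult nat
    by (simp add: mpartial_laplacian algebra_simps)
qed

lemma is_form_laplacian: "is_form d p \<Longrightarrow> is_form (d - 2) (laplacian p)"
  unfolding laplacian_def
  by (intro is_form_sum) (metis diff_diff_left is_form_mpartial one_add_one)

lemma mpartial_form_0: "is_form 0 (p :: ('v::finite, real) mpoly) \<Longrightarrow> mpartial v p = 0"
  by (metis form_0_eq_mconst mpartial_mconst)

lemma laplacian_form_less_2: "is_form d p \<Longrightarrow> d < 2 \<Longrightarrow> laplacian p = 0"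
proof -
  assume "is_form d p" "d < 2"
  then have "is_form 0 (mpartial v p)" for v
    using is_form_mpartial[of d p v] by (auto simp: less_2_cases_iff)
  then show ?thesis by (simp add: laplacian_def mpartial_form_0)
qed

lemma is_form_laplacian_pow: "is_form d p \<Longrightarrow> is_form (d - 2 * l) ((laplacian ^^ l) p)"
proof (induction l)
  case (Suc l)
  then have "is_form (d - 2 * l - 2) (laplacian ((laplacian ^^ l) p))"
    by (intro is_form_laplacian)
  then show ?case by (simp add: algebra_simps)
qed simp

lemma laplacian_pow_form_eq_0: "is_form d p \<Longrightarrow> d < 2 * l \<Longrightarrow> (laplacian ^^ l) p = 0"
proof (induction l arbitrary: d p)
  case (Suc l)
  show ?case
  proof (cases "d < 2")
    case True
    then show ?thesis
      using Suc.prems by (simp add: funpow_Suc_right laplacian_form_less_2 del: funpow.simps)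
  next
    case False
    then show ?thesis
      using Suc.IH[OF is_form_laplacian[OF Suc.prems(1)]] Suc.prems(2)
      by (simp add: funpow_Suc_right del: funpow.simps)
  qed
qed simp

text \<open>The truncation of \<open>exp (- \<Delta> / 2) p\<close>, which turns monomials into Hermite polynomials.\<close>

definition backward_heat :: "nat \<Rightarrow> ('v::finite, real) mpoly \<Rightarrow> ('v, real) mpoly" where
  "backward_heat L p = (\<Sum>l\<le>L. mconst ((- 1 / 2) ^ l / fact l) * (laplacian ^^ l) p)"

lemma backward_heat_mconst_mult: "backward_heat L (mconst c * p) = mconst c * backward_heat L p"
  by (simp add: backward_heat_def laplacian_pow_mconst_mult sum_distrib_left mult.left_commute[of "mconst c"])

lemma backward_heat_sum: "backward_heat L (\<Sum>x\<in>A. f x) = (\<Sum>x\<in>A. backward_heat L (f x))"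
  unfolding backward_heat_def laplacian_pow_sum sum_distrib_left by (rule sum.swap)

lemma mconst_mult: "mconst (a * b) = mconst a * (mconst b :: ('v, 'a::comm_semiring_1) mpoly)"
  by (simp add: mconst_def mult_single)

text \<open>The multivariate form of the recursion for \<open>hermite\<close>: conjugating
  multiplication by \<open>mvar i\<close> with the backward heat operator subtracts
  \<open>mpartial i\<close>. The assumption makes the truncation of the exponential series
  harmless.\<close>

lemma backward_heat_mvar_mult:
  assumes "(laplacian ^^ Suc L) p = 0"
  shows "backward_heat (Suc L) (mvar i * p)
    = mvar i * backward_heat (Suc L) p - mpartial i (backward_heat (Suc L) p)"
proof -
  define c :: "nat \<Rightarrow> real" where "c l = (- 1 / 2) ^ l / fact l" for l
  define D where "D l = (laplacian ^^ l) p" for l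
  \<comment> \<open>The factor \<open>2 * Suc l\<close> of the commutator lowers the index of the
    exponential coefficient and changes its sign.\<close>
  have c: "c (Suc l) * (2 * real (Suc l)) = - c l" for l
    by (simp add: c_def del: of_nat_Suc)
  have c': "mconst (c (Suc l)) * (of_nat (2 * Suc l) * q) = - (mconst (c l) * q)"
    for l and q :: "('a, real) mpoly"
  proof -
    have "mconst (c (Suc l)) * (of_nat (2 * Suc l) * q) = mconst (c (Suc l) * (2 * real (Suc l))) * q"
      by (simp only: mconst_mult of_nat_eq_mconst mult.assoc of_nat_mult of_nat_numeral)
    also have "\<dots> = - (mconst (c l) * q)"
      unfolding c by (simp add: mconst_def single_uminus)
    finally show ?thesis .
  qed
  have "backward_heat (Suc L) (mvar i * p)
      = mconst (c 0) * (mvar i * p) + (\<Sum>l\<le>L. mconst (c (Suc l)) * (laplacian ^^ Suc l) (mvar i * p))"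
    unfolding backward_heat_def c_def[symmetric] by (subst sum.atMost_Suc_shift) simp
  also have "\<dots> = mconst (c 0) * (mvar i * p)
      + (\<Sum>l\<le>L. mvar i * (mconst (c (Suc l)) * D (Suc l)) - mconst (c l) * mpartial i (D l))"
    unfolding laplacian_pow_mvar_mult distrib_left c' D_def by (simp add: mult_ac)
  also have "\<dots> = mvar i * (mconst (c 0) * D 0 + (\<Sum>l\<le>L. mconst (c (Suc l)) * D (Suc l)))
      - mpartial i (\<Sum>l\<le>L. mconst (c l) * D l)"
    by (simp add: sum_subtractf sum_distrib_left D_def algebra_simps)
  also have "mconst (c 0) * D 0 + (\<Sum>l\<le>L. mconst (c (Suc l)) * D (Suc l)) = backward_heat (Suc L) p"
    unfolding backward_heat_def c_def[symmetric] D_def by (subst sum.atMost_Suc_shift) simp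
  also have "(\<Sum>l\<le>L. mconst (c l) * D l) = backward_heat (Suc L) p"
    unfolding backward_heat_def c_def[symmetric] using assms by (simp add: D_def)
  finally show ?thesis .
qed

definition linear_form :: "('v::finite \<Rightarrow> real) \<Rightarrow> ('v, real) mpoly" where
  "linear_form x = (\<Sum>v\<in>UNIV. mconst (x v) * mvar v)"

lemma meval_linear_form: "meval s (linear_form x) = (\<Sum>v\<in>UNIV. x v * s v)"
  by (simp add: linear_form_def)

lemma is_form_linear_form: "is_form 1 (linear_form x)"
  unfolding linear_form_def by (intro is_form_sum is_form_mconst_mult is_form_mvar)

lemma mpartial_linear_form: "mpartial i (linear_form x) = mconst (x i)"
proof -
  have "mpartial i (linear_form x) = (\<Sum>v\<in>UNIV. if v = i then mconst (x v) else 0)"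
    unfolding linear_form_def mpartial_sum by (rule sum.cong) auto
  then show ?thesis by simp
qed

lemma mpartial_linear_form_power:
  "mpartial i (linear_form x ^ k) = mconst (real k * x i) * linear_form x ^ (k - 1)"
proof (cases k)
  case 0
  then show ?thesis by (simp add: mconst_def)
next
  case (Suc j)
  then show ?thesis
    by (simp only: mpartial_power_Suc mpartial_linear_form of_nat_eq_mconst mconst_mult) (simp add: mult_ac)
qed

lemma gauss_mean_linear_form_power_Suc_Suc:
  "gauss_mean (linear_form x ^ Suc (Suc k))
    = real (Suc k) * (\<Sum>v\<in>UNIV. (x v)\<^sup>2) * gauss_mean (linear_form x ^ k)"
proof -
  have "linear_form x ^ Suc (Suc k) = (\<Sum>v\<in>UNIV. mconst (x v) * (mvar v * linear_form x ^ Suc k))"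
    by (subst power_Suc, subst linear_form_def) (simp only: sum_distrib_right mult.assoc)
  then have "gauss_mean (linear_form x ^ Suc (Suc k))
      = (\<Sum>v\<in>UNIV. x v * (real (Suc k) * x v * gauss_mean (linear_form x ^ k)))"
    by (simp only: gauss_mean_sum gauss_mean_mconst_mult gauss_mean_by_parts
        mpartial_linear_form_power diff_Suc_1)
  then show ?thesis by (simp add: sum_distrib_left sum_distrib_right power2_eq_square mult_ac)
qed

lemma gauss_mean_linear_form_power_even:
  "gauss_mean (linear_form x ^ (2 * r)) = gauss_moment (2 * r) * (\<Sum>v\<in>UNIV. (x v)\<^sup>2) ^ r"
  by (induction r) (simp_all add: gauss_mean_linear_form_power_Suc_Suc del: power_Suc, simp add: mult_ac)

text \<open>Multiplication by \<open>mvar i\<close> minus \<open>mpartial i\<close> is adjoint to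
  \<open>mpartial i\<close>. So the mean is that of the differential operator \<open>p(D)\<close>
  applied to the power of the linear form, and each derivative brings out a coordinate of
  \<open>x\<close> and lowers the exponent: \<open>p(D)\<close> yields \<open>meval x p\<close>
  times a falling factorial.\<close>

lemma gauss_mean_backward_heat:
  "is_form m p \<Longrightarrow> m \<le> L \<Longrightarrow> m \<le> k \<Longrightarrow>
    gauss_mean (backward_heat L p * linear_form x ^ k)
      = fact k / fact (k - m) * meval x p * gauss_mean (linear_form x ^ (k - m))"
proof (induction m arbitrary: p k)
  case 0
  have "laplacian p = 0" using 0 by (intro laplacian_form_less_2) auto
  then have "(laplacian ^^ Suc l) p = 0" for l
    by (simp add: funpow_Suc_right del: funpow.simps)
  then have zero: "(laplacian ^^ l) p = 0" if "l \<noteq> 0" for l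
    using that by (cases l) auto
  have "backward_heat L p = (\<Sum>l\<in>{0}. mconst ((- 1 / 2) ^ l / fact l) * (laplacian ^^ l) p)"
    unfolding backward_heat_def by (rule sum.mono_neutral_right) (auto simp: zero)
  then have b: "backward_heat L p = p" by (simp add: mconst_def)
  obtain c where "p = mconst c" using form_0_eq_mconst[OF 0(1)] by blast
  then show ?case unfolding b by simp
next
  case (Suc m)
  obtain L' where L: "L = Suc L'" using Suc.prems by (cases L) auto
  obtain k' where k: "k = Suc k'" using Suc.prems by (cases k) auto
  have form: "is_form m (mpartial i p)" for i
    using is_form_mpartial[OF Suc.prems(1)] by simp
  \<comment> \<open>Euler's identity writes \<open>p\<close> through products
    \<open>mvar i * mpartial i p\<close>, so that one variable can be moved at a time.\<close>
  have euler: "p = mconst (1 / real (Suc m)) * (\<Sum>i\<in>UNIV. mvar i * mpartial i p)"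
    unfolding euler_identity[OF Suc.prems(1)]
    by (simp add: of_nat_eq_mconst flip: mult.assoc mconst_mult) (simp add: mconst_def)
  have step: "gauss_mean (backward_heat L (mvar i * mpartial i p) * linear_form x ^ k)
      = real k * x i * (fact k' / fact (k' - m) * meval x (mpartial i p)
        * gauss_mean (linear_form x ^ (k' - m)))" for i
  proof -
    let ?b = "backward_heat L (mpartial i p)"
    have "backward_heat L (mvar i * mpartial i p) = mvar i * ?b - mpartial i ?b"
      unfolding L by (intro backward_heat_mvar_mult laplacian_pow_form_eq_0[OF form])
        (use Suc.prems L in auto)
    then have "gauss_mean (backward_heat L (mvar i * mpartial i p) * linear_form x ^ k)
        = gauss_mean (mvar i * (?b * linear_form x ^ k)) - gauss_mean (mpartial i ?b * linear_form x ^ k)"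
      by (simp add: left_diff_distrib gauss_mean_diff mult.assoc)
    also have "\<dots> = gauss_mean (?b * mpartial i (linear_form x ^ k))"
      unfolding gauss_mean_by_parts mpartial_mult by simp
    also have "\<dots> = real k * x i * gauss_mean (?b * linear_form x ^ k')"
      unfolding mpartial_linear_form_power by (simp add: k mult.left_commute[of ?b])
    also have "gauss_mean (?b * linear_form x ^ k') = fact k' / fact (k' - m) * meval x (mpartial i p)
        * gauss_mean (linear_form x ^ (k' - m))"
      by (rule Suc.IH[OF form]) (use Suc.prems k in auto)
    finally show ?thesis .
  qed
  have "gauss_mean (backward_heat L p * linear_form x ^ k)
      = 1 / real (Suc m) * (\<Sum>i\<in>UNIV. gauss_mean (backward_heat L (mvar i * mpartial i p) * linear_form x ^ k))"
    by (subst euler) (simp only: backward_heat_mconst_mult backward_heat_sum mult.assoc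
        gauss_mean_mconst_mult sum_distrib_right gauss_mean_sum)
  also have "\<dots> = (real k * fact k' / fact (k' - m) * gauss_mean (linear_form x ^ (k' - m)))
      * (1 / real (Suc m) * (\<Sum>i\<in>UNIV. x i * meval x (mpartial i p)))"
    unfolding step sum_distrib_left by (rule sum.cong) (auto simp: field_simps)
  also have "1 / real (Suc m) * (\<Sum>i\<in>UNIV. x i * meval x (mpartial i p)) = meval x p"
    using arg_cong[OF euler, of "meval x"] by simp
  finally show ?case by (simp add: k)
qed

definition norm_sq :: "('v::finite, real) mpoly" where
  "norm_sq = (\<Sum>v\<in>UNIV. (mvar v)\<^sup>2)"

lemma meval_norm_sq: "meval s norm_sq = (\<Sum>v\<in>UNIV. (s v)\<^sup>2)"
  by (simp add: norm_sq_def)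

lemma is_form_norm_sq_power: "is_form (2 * l) (norm_sq ^ l)"
proof (rule is_form_power)
  have "is_form 2 ((mvar v)\<^sup>2 :: ('v::finite, real) mpoly)" for v
    using is_form_power[OF is_form_mvar, of 2 v] by simp
  then show "is_form 2 (norm_sq :: ('v::finite, real) mpoly)"
    unfolding norm_sq_def by (intro is_form_sum)
qed

text \<open>After one integration by parts in each coordinate, the product rule gives
  \<open>CARD('v)\<close> copies of the mean, and Euler's identity gives \<open>d\<close>
  more.\<close>

lemma gauss_mean_norm_sq_mult:
  fixes p :: "('v::finite, real) mpoly"
  assumes "is_form d p"
  shows "gauss_mean (norm_sq * p) = real (CARD('v) + d) * gauss_mean p"
proof -
  have "gauss_mean (norm_sq * p) = (\<Sum>v\<in>UNIV. gauss_mean (mvar v * (mvar v * p)))"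
    by (simp add: norm_sq_def sum_distrib_right gauss_mean_sum power2_eq_square mult.assoc)
  also have "\<dots> = (\<Sum>v\<in>UNIV. gauss_mean p + gauss_mean (mvar v * mpartial v p))"
    by (subst gauss_mean_by_parts) (simp add: mpartial_mult)
  also have "\<dots> = real CARD('v) * gauss_mean p + gauss_mean (of_nat d * p)"
    unfolding euler_identity[OF assms, symmetric] by (simp add: sum.distrib gauss_mean_sum)
  finally show ?thesis by (simp add: gauss_mean_of_nat_mult distrib_right)
qed

lemma gauss_mean_norm_sq_power_mult:
  fixes p :: "('v::finite, real) mpoly"
  assumes "is_form d p"
  shows "gauss_mean (norm_sq ^ l * p) = (\<Prod>j<l. real (CARD('v) + d + 2 * j)) * gauss_mean p"
proof (induction l)
  case (Suc l)
  have "gauss_mean (norm_sq ^ Suc l * p) = gauss_mean (norm_sq * (norm_sq ^ l * p))"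
    by (simp add: mult.assoc)
  also have "\<dots> = real (CARD('v) + (2 * l + d)) * gauss_mean (norm_sq ^ l * p)"
    by (intro gauss_mean_norm_sq_mult is_form_mult is_form_norm_sq_power assms)
  finally show ?case using Suc by (simp add: algebra_simps)
qed simp

text \<open>
  The powers of the norm make the summands of \<^const>\<open>backward_heat\<close> homogeneous of degree \<open>m\<close>
  without changing the Gaussian mean against a form of degree \<open>m + 2 r\<close>.
\<close>

definition reznick_coeff :: "nat \<Rightarrow> nat \<Rightarrow> nat \<Rightarrow> nat \<Rightarrow> real" where
  "reznick_coeff n m r l
    = (- 1 / 2) ^ l / (fact l * (\<Prod>j<l. real (n + 2 * m + 2 * r) - 2 * real (Suc j)))"

definition reznick_form :: "nat \<Rightarrow> nat \<Rightarrow> ('v::finite, real) mpoly \<Rightarrow> ('v, real) mpoly" where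
  "reznick_form m r p
    = (\<Sum>l\<le>m div 2. mconst (reznick_coeff CARD('v) m r l) * (norm_sq ^ l * (laplacian ^^ l) p))"

lemma is_form_reznick_form:
  assumes "is_form m p"
  shows "is_form m (reznick_form m r p)"
  unfolding reznick_form_def
proof (intro is_form_sum is_form_mconst_mult)
  fix l assume "l \<in> {..m div 2}"
  then have "2 * l + (m - 2 * l) = m" by simp
  then show "is_form m (norm_sq ^ l * (laplacian ^^ l) p)"
    using is_form_mult[OF is_form_norm_sq_power is_form_laplacian_pow[OF assms], of l l] by metis
qed

text \<open>The denominators in \<open>reznick_coeff\<close> are the factors that
  \<open>norm_sq ^ l\<close> contributes to the mean. They cancel, and the mean is the one of
  \<open>backward_heat m p\<close> against the same power.\<close>

lemma gauss_mean_reznick_form: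
  fixes p :: "('v::finite, real) mpoly"
  assumes p: "is_form m p"
  shows "gauss_mean (reznick_form m r p * linear_form x ^ (m + 2 * r))
    = fact (m + 2 * r) / fact (2 * r) * gauss_moment (2 * r) * (\<Sum>v\<in>UNIV. (x v)\<^sup>2) ^ r * meval x p"
proof -
  let ?k = "m + 2 * r" and ?n = "CARD('v)"
  have summand: "reznick_coeff ?n m r l * gauss_mean (norm_sq ^ l * ((laplacian ^^ l) p * linear_form x ^ ?k))
      = (- 1 / 2) ^ l / fact l * gauss_mean ((laplacian ^^ l) p * linear_form x ^ ?k)"
    if "l \<le> m div 2" for l
  proof -
    have 1: "is_form (m - 2 * l + ?k) ((laplacian ^^ l) p * linear_form x ^ ?k)"
      using is_form_mult[OF is_form_laplacian_pow[OF p] is_form_power[OF is_form_linear_form]]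
      by (metis mult_1)
    \<comment> \<open>The same factors in reverse order, as they stand in the denominator of
      \<open>reznick_coeff\<close>.\<close>
    have 2: "(\<Prod>j<l. real (?n + (m - 2 * l + ?k) + 2 * j))
        = (\<Prod>j<l. real (?n + 2 * m + 2 * r) - 2 * real (Suc j))"
      by (subst prod.nat_diff_reindex[symmetric], rule prod.cong) (use that in \<open>auto simp: of_nat_diff\<close>)
    define P where "P = (\<Prod>j<l. real (?n + 2 * m + 2 * r) - 2 * real (Suc j))"
    have "P > 0"
      unfolding P_def by (intro prod_pos) (use that in auto)
    then show ?thesis
      unfolding gauss_mean_norm_sq_power_mult[OF 1] 2 reznick_coeff_def P_def[symmetric] by simp
  qed
  have "gauss_mean (reznick_form m r p * linear_form x ^ ?k)
      = (\<Sum>l\<le>m div 2. (- 1 / 2) ^ l / fact l * gauss_mean ((laplacian ^^ l) p * linear_form x ^ ?k))"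
    unfolding reznick_form_def sum_distrib_right gauss_mean_sum mult.assoc gauss_mean_mconst_mult
    by (rule sum.cong) (use summand in auto)
  also have "\<dots> = (\<Sum>l\<le>m. (- 1 / 2) ^ l / fact l * gauss_mean ((laplacian ^^ l) p * linear_form x ^ ?k))"
  proof (rule sum.mono_neutral_left)
    have "(laplacian ^^ l) p = 0" if "l \<notin> {..m div 2}" for l
      by (rule laplacian_pow_form_eq_0[OF p]) (use that in auto)
    then show "\<forall>l\<in>{..m} - {..m div 2}.
        (- 1 / 2) ^ l / fact l * gauss_mean ((laplacian ^^ l) p * linear_form x ^ ?k) = 0"
      by auto
  qed auto
  also have "\<dots> = gauss_mean (backward_heat m p * linear_form x ^ ?k)"
    by (simp add: backward_heat_def sum_distrib_right gauss_mean_sum mult.assoc)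
  also have "\<dots> = fact ?k / fact (?k - m) * meval x p * gauss_mean (linear_form x ^ (?k - m))"
    by (rule gauss_mean_backward_heat[OF p]) auto
  finally show ?thesis by (simp add: gauss_mean_linear_form_power_even)
qed

text \<open>The product of one-dimensional rules: the nodes form a grid and the weights multiply. No
  exponent of a monomial of degree \<open>N\<close> exceeds \<open>N\<close>, so each factor is
  integrated exactly.\<close>

lemma gauss_mean_cubature:
  obtains U :: "('v::finite \<Rightarrow> real) set" and W where "finite U" "\<And>u. u \<in> U \<Longrightarrow> W u \<ge> 0"
    "\<And>p. is_form N p \<Longrightarrow> gauss_mean p = (\<Sum>u\<in>U. W u * meval u p)"
proof -
  obtain A w where A: "finite A" "\<And>a. a \<in> A \<Longrightarrow> w a \<ge> (0::real)"
      "\<And>k. k \<le> N \<Longrightarrow> gauss_moment k = (\<Sum>a\<in>A. w a * a ^ k)"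
    using gauss_moment_quadrature[of N] by metis
  define U where "U = (PiE UNIV (\<lambda>_. A) :: ('v \<Rightarrow> real) set)"
  define W where "W u = (\<Prod>v\<in>UNIV. w (u v))" for u :: "'v \<Rightarrow> real"
  have fin: "finite U" unfolding U_def by (intro finite_PiE) (use A in auto)
  have W: "W u \<ge> 0" if "u \<in> U" for u
    unfolding W_def by (intro prod_nonneg) (use that A in \<open>auto simp: U_def\<close>)
  have mon: "(\<Prod>v\<in>UNIV. gauss_moment (Poly_Mapping.lookup m v)) = (\<Sum>u\<in>U. W u * mmon u m)"
    if "mdeg m \<le> N" for m
  proof -
    have "Poly_Mapping.lookup m v \<le> N" for v
      using that member_le_sum[of v UNIV "Poly_Mapping.lookup m"] by (simp add: mdeg_def)
    then have "(\<Prod>v\<in>UNIV. gauss_moment (Poly_Mapping.lookup m v))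
        = (\<Prod>v\<in>UNIV. \<Sum>a\<in>A. w a * a ^ Poly_Mapping.lookup m v)"
      by (simp add: A)
    also have "\<dots> = (\<Sum>u\<in>U. \<Prod>v\<in>UNIV. w (u v) * u v ^ Poly_Mapping.lookup m v)"
      unfolding U_def by (rule prod_sum_PiE) (use A in auto)
    finally show ?thesis by (simp add: W_def mmon_def prod.distrib)
  qed
  have "gauss_mean p = (\<Sum>u\<in>U. W u * meval u p)" if p: "is_form N p" for p
  proof -
    have "gauss_mean p = (\<Sum>m\<in>Poly_Mapping.keys p. Poly_Mapping.lookup p m * (\<Sum>u\<in>U. W u * mmon u m))"
      unfolding gauss_mean_def
      by (rule sum.cong) (use p in \<open>auto simp: mon is_form_iff in_keys_iff\<close>)
    also have "\<dots> = (\<Sum>u\<in>U. W u * (\<Sum>m\<in>Poly_Mapping.keys p. Poly_Mapping.lookup p m * mmon u m))"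
      unfolding sum_distrib_left by (subst sum.swap) (simp add: mult_ac)
    also have "\<dots> = (\<Sum>u\<in>U. W u * meval u p)"
      by (subst msubst_superset[of "Poly_Mapping.keys p" p]) auto
    finally show ?thesis .
  qed
  with fin W show ?thesis using that by blast
qed

section \<open>Sums of squares\<close>

text \<open>Symmetric Gaussian elimination: the pivot \<open>q a a\<close> splits off one rank-one
  matrix, and the Schur complement on the remaining indices is again positive semidefinite.\<close>

lemma psd_matrix_sum_rank_one:
  fixes q :: "'a \<Rightarrow> 'a \<Rightarrow> real"
  assumes "finite I" "\<And>i j. q i j = q j i" "\<And>z. (\<Sum>i\<in>I. \<Sum>j\<in>I. q i j * z i * z j) \<ge> 0"
  shows "\<exists>ls. \<forall>i\<in>I. \<forall>j\<in>I. q i j = (\<Sum>l\<leftarrow>ls. l i * l j)"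
  using assms
proof (induction I arbitrary: q rule: finite_induct)
  case empty
  then show ?case by simp
next
  case (insert a I)
  note sym = insert.prems(1)
  have expand: "(\<Sum>i\<in>insert a I. \<Sum>j\<in>insert a I. q i j * z i * z j)
      = q a a * (z a)\<^sup>2 + 2 * z a * (\<Sum>j\<in>I. q a j * z j) + (\<Sum>i\<in>I. \<Sum>j\<in>I. q i j * z i * z j)" for z
  proof -
    have 1: "(\<Sum>i\<in>I. q i a * z i * z a) = z a * (\<Sum>j\<in>I. q a j * z j)"
      unfolding sum_distrib_left by (intro sum.cong refl) (metis sym mult.commute mult.assoc)
    have 2: "(\<Sum>j\<in>I. q a j * z a * z j) = z a * (\<Sum>j\<in>I. q a j * z j)"
      unfolding sum_distrib_left by (intro sum.cong refl) simp
    show ?thesis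
      using insert.hyps by (simp add: sum.distrib 1 2 power2_eq_square)
  qed
  have psd: "q a a * t\<^sup>2 + 2 * t * (\<Sum>j\<in>I. q a j * z j) + (\<Sum>i\<in>I. \<Sum>j\<in>I. q i j * z i * z j) \<ge> 0" for z t
  proof -
    have "(\<Sum>j\<in>I. q a j * (z(a := t)) j) = (\<Sum>j\<in>I. q a j * z j)"
      using insert.hyps by (intro sum.cong) auto
    moreover have "(\<Sum>i\<in>I. \<Sum>j\<in>I. q i j * (z(a := t)) i * (z(a := t)) j) = (\<Sum>i\<in>I. \<Sum>j\<in>I. q i j * z i * z j)"
      using insert.hyps by (intro sum.cong) auto
    ultimately show ?thesis using insert.prems(2)[of "z(a := t)"] unfolding expand by simp
  qed
  have diag: "q a a \<ge> 0" using psd[of 1 "\<lambda>_. 0"] by simp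
  \<comment> \<open>The Schur complement. For a zero pivot, division by zero gives 0, so
    \<open>q'\<close> is \<open>q\<close>.\<close>
  define q' where "q' i j = q i j - q a i * q a j / q a a" for i j
  define S where "S z = (\<Sum>j\<in>I. q a j * z j)" for z
  have "(\<Sum>i\<in>I. \<Sum>j\<in>I. q' i j * z i * z j) \<ge> 0" for z
  proof -
    have "(\<Sum>i\<in>I. \<Sum>j\<in>I. q' i j * z i * z j)
        = (\<Sum>i\<in>I. \<Sum>j\<in>I. q i j * z i * z j) - S z * S z / q a a"
    proof -
      have "S z * S z / q a a = (\<Sum>i\<in>I. \<Sum>j\<in>I. q a i * q a j / q a a * z i * z j)"
        unfolding S_def sum_product sum_divide_distrib by (intro sum.cong refl) simp
      then show ?thesis by (simp add: q'_def sum_subtractf left_diff_distrib)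
    qed
    moreover have "\<dots> \<ge> 0"
    proof (cases "q a a = 0")
      case False
      \<comment> \<open>The entry at \<open>a\<close> that minimizes the quadratic form when
        \<open>z\<close> is fixed.\<close>
      then have "q a a * (- S z / q a a)\<^sup>2 + 2 * (- S z / q a a) * S z = - (S z * S z / q a a)"
        by (simp add: power2_eq_square)
      then show ?thesis
        using psd[of "- S z / q a a" z] unfolding S_def[symmetric] by linarith
    qed (use psd[of 0 z] in simp)
    ultimately show ?thesis by simp
  qed
  moreover have "q' i j = q' j i" for i j
    unfolding q'_def by (metis sym mult.commute)
  ultimately obtain ls where ls: "\<forall>i\<in>I. \<forall>j\<in>I. q' i j = (\<Sum>l\<leftarrow>ls. l i * l j)"
    using insert.IH[of q'] by blast
  \<comment> \<open>A zero pivot forces its row to vanish: otherwise the form would be affine and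
    nonconstant in the entry at \<open>a\<close>, and the value chosen below would make it
    \<open>- 1\<close>.\<close>
  have row: "q a i = 0" if "q a a = 0" "i \<in> I" for i
  proof (rule ccontr)
    assume nz: "q a i \<noteq> 0"
    define z where "z j = (if j = i then 1 else 0 :: real)" for j
    have 1: "(\<Sum>j\<in>I. q a j * z j) = q a i"
      using insert.hyps that by (simp add: z_def if_distrib sum.delta cong: if_cong)
    define R where "R = (\<Sum>i\<in>I. \<Sum>j\<in>I. q i j * z i * z j)"
    have "2 * t * q a i + R \<ge> 0" for t
      using psd[of t z] that unfolding 1 R_def[symmetric] by simp
    from this[of "(- 1 - R) / (2 * q a i)"] show False
      using nz by (simp add: field_simps)
  qed
  define l0 where "l0 i = q a i / sqrt (q a a)" for i
  define ext where "ext l = l(a := 0)" for l :: "'a \<Rightarrow> real"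
  have "q i j = (\<Sum>l\<leftarrow>l0 # map ext ls. l i * l j)" if "i \<in> insert a I" "j \<in> insert a I" for i j
  proof -
    have l0: "l0 i * l0 j = q a i * q a j / q a a"
      using diag by (simp add: l0_def)
    show ?thesis
    proof (cases "i = a \<or> j = a")
      case True
      then have zero: "(\<Sum>l\<leftarrow>map ext ls. l i * l j) = 0"
        by (auto simp: ext_def o_def)
      have "q i j = q a i * q a j / q a a"
      proof (cases "q a a = 0")
        case True
        then show ?thesis using \<open>i = a \<or> j = a\<close> row[of i] row[of j] that sym[of i j] by auto
      next
        case False
        then show ?thesis using \<open>i = a \<or> j = a\<close> sym[of i j] by auto
      qed
      then show ?thesis by (simp add: l0 zero del: map_map)
    next
      case False
      then have "(\<Sum>l\<leftarrow>map ext ls. l i * l j) = q' i j"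
        using that ls by (auto simp: ext_def o_def)
      then show ?thesis by (simp add: l0 q'_def)
    qed
  qed
  then show ?case by blast
qed

lemma sum_of_squares_0 [simp]: "sum_of_squares 0"
  unfolding sum_of_squares_def by (rule exI[of _ "[]"]) simp

lemma sum_of_squares_add: "sum_of_squares p \<Longrightarrow> sum_of_squares q \<Longrightarrow> sum_of_squares (p + q)"
  unfolding sum_of_squares_def by (metis map_append sum_list_append)

lemma sum_of_squares_sum: "(\<And>x. x \<in> A \<Longrightarrow> sum_of_squares (f x)) \<Longrightarrow> sum_of_squares (\<Sum>x\<in>A. f x)"
  by (induction A rule: infinite_finite_induct) (auto intro: sum_of_squares_add)

lemma sum_of_squares_mult_square:
  assumes "sum_of_squares p"
  shows "sum_of_squares (p * q\<^sup>2)"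
proof -
  obtain qs where "p = (\<Sum>s\<leftarrow>qs. s\<^sup>2)" using assms by (auto simp: sum_of_squares_def)
  then have "p * q\<^sup>2 = (\<Sum>s\<leftarrow>map (\<lambda>s. s * q) qs. s\<^sup>2)"
    by (simp add: sum_list_mult_const[symmetric] o_def power_mult_distrib)
  then show ?thesis unfolding sum_of_squares_def by blast
qed

lemma sum_of_squares_mconst_mult:
  assumes "c \<ge> 0" "sum_of_squares p"
  shows "sum_of_squares (mconst c * p)"
proof -
  have "mconst c = (mconst (sqrt c) :: ('a, real) mpoly)\<^sup>2"
    using assms(1) by (simp add: power2_eq_square flip: mconst_mult)
  then show ?thesis using sum_of_squares_mult_square[OF assms(2)] by (metis mult.commute)
qed

lemma sum_of_squares_sum_list: "sum_of_squares (\<Sum>l\<leftarrow>ls. (g l)\<^sup>2)"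
  unfolding sum_of_squares_def by (rule exI[of _ "map g ls"]) (simp add: o_def)

lemma meval_in_x: "meval s (in_x p) = meval (\<lambda>i. s (Inl i)) (p :: ('n::finite, real) mpoly)"
proof -
  interpret coeff_hom "mconst :: real \<Rightarrow> ('n + 'n, real) mpoly" by (rule coeff_hom_mconst)
  have "in_x (mvar v) = xvar v" for v :: 'n
    by (simp add: in_x_def mvar_def)
  then show ?thesis
    by (induction p rule: mpoly_ring_induct) (simp_all add: in_x_def msubst_add msubst_mult)
qed

lemma meval_sum_list: "meval s (\<Sum>l\<leftarrow>ls. g l) = (\<Sum>l\<leftarrow>ls. meval s (g l :: ('v::finite, real) mpoly))"
  by (induction ls) auto

text \<open>For a fixed real vector \<open>y\<close> this is a polynomial in \<open>x\<close> alone,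
  so that \<open>laplacian\<close> and \<open>reznick_form\<close> apply to it;
  \<open>hessian_form\<close> contains both groups of variables.\<close>

definition hessian_dir :: "('n::finite, real) mpoly \<Rightarrow> ('n \<Rightarrow> real) \<Rightarrow> ('n, real) mpoly" where
  "hessian_dir f y = (\<Sum>i\<in>UNIV. \<Sum>j\<in>UNIV. mconst (y i * y j) * hessian f $ i $ j)"

lemma meval_hessian_dir:
  "meval x (hessian_dir f y) = (\<Sum>i\<in>UNIV. \<Sum>j\<in>UNIV. y i * y j * meval x (hessian f $ i $ j))"
  by (simp add: hessian_dir_def)

lemma meval_hessian_form:
  "meval s (hessian_form f) = meval (\<lambda>i. s (Inl i)) (hessian_dir f (\<lambda>i. s (Inr i)))"
  by (simp add: hessian_form_def meval_hessian_dir meval_in_x mult_ac)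

lemma hessian_sym: "hessian f $ i $ j = hessian f $ j $ i"
  by (simp add: hessian_def mpartial_commute)

lemma is_form_hessian: "is_form d f \<Longrightarrow> is_form (d - 2) (hessian f $ i $ j)"
  by (simp add: hessian_def) (metis diff_diff_left is_form_mpartial one_add_one)

lemma is_form_hessian_dir: "is_form d f \<Longrightarrow> is_form (d - 2) (hessian_dir f y)"
  unfolding hessian_dir_def by (intro is_form_sum is_form_mconst_mult is_form_hessian)

lemma reznick_form_add: "reznick_form m r (p + q) = reznick_form m r p + reznick_form m r q"
  by (simp add: reznick_form_def laplacian_pow_add distrib_left sum.distrib)

lemma reznick_form_sum: "reznick_form m r (\<Sum>x\<in>A. f x) = (\<Sum>x\<in>A. reznick_form m r (f x))"
proof -
  have "reznick_form m r 0 = 0" by (simp add: reznick_form_def)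
  then show ?thesis
    by (induction A rule: infinite_finite_induct) (auto simp: reznick_form_add)
qed

lemma reznick_form_mconst_mult: "reznick_form m r (mconst c * p) = mconst c * reznick_form m r p"
  by (simp add: reznick_form_def laplacian_pow_mconst_mult sum_distrib_left mult.left_commute[of "mconst c"])

lemma gauss_moment_even_pos: "gauss_moment (2 * r) > 0"
  by (induction r) auto

text \<open>The representation is applied to every Hessian entry with the same nodes. At a node
  \<open>u\<close> the entries form a matrix that \<open>nonneg\<close> makes positive semidefinite,
  so it is a sum of rank-one matrices, that is, of squares of linear forms in \<open>y\<close>. They
  are multiplied by an even power of a linear form in \<open>x\<close>.\<close>

lemma r_sos_convex_reznick:
  fixes f :: "('n::finite, real) mpoly"
  assumes f: "is_form d f" and m: "d - 2 = 2 * s"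
    and nonneg: "\<And>u y. meval u (reznick_form (2 * s) r (hessian_dir f y)) \<ge> 0"
  shows "r_sos_convex r f"
proof -
  define m where "m = 2 * s"
  define h where "h i j = hessian f $ i $ j" for i j
  have h: "is_form m (h i j)" for i j
    using is_form_hessian[OF f] m by (simp add: m_def h_def)
  \<comment> \<open>The degree is \<open>m\<close> from the Reznick form plus
    \<open>m + 2 * r\<close> from the power of the linear form.\<close>
  obtain U :: "('n \<Rightarrow> real) set" and W where U: "finite U" "\<And>u. u \<in> U \<Longrightarrow> W u \<ge> 0"
    "\<And>p. is_form (m + (m + 2 * r)) p \<Longrightarrow> gauss_mean p = (\<Sum>u\<in>U. W u * meval u p)"
    by (rule gauss_mean_cubature[where N = "m + (m + 2 * r)"]) blast
  define C where "C = fact (m + 2 * r) / fact (2 * r) * gauss_moment (2 * r)"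
  have C: "C > 0" by (simp add: C_def gauss_moment_even_pos)
  define q where "q u i j = meval u (reznick_form m r (h i j))" for u i j
  have repr: "C * (\<Sum>v\<in>UNIV. (x v)\<^sup>2) ^ r * meval x (h i j)
      = (\<Sum>u\<in>U. W u * (q u i j * (\<Sum>v\<in>UNIV. x v * u v) ^ (m + 2 * r)))" for x i j
  proof -
    have "is_form (m + (m + 2 * r)) (reznick_form m r (h i j) * linear_form x ^ (m + 2 * r))"
      using is_form_mult[OF is_form_reznick_form[OF h] is_form_power[OF is_form_linear_form, of "m + 2 * r"]]
      by (simp only: mult_1)
    from U(3)[OF this] show ?thesis
      unfolding gauss_mean_reznick_form[OF h] by (simp add: C_def q_def meval_linear_form)
  qed
  have qsym: "q u i j = q u j i" for u i j
    by (simp add: q_def h_def hessian_sym[of f i j])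
  have qpsd: "(\<Sum>i\<in>UNIV. \<Sum>j\<in>UNIV. q u i j * z i * z j) \<ge> 0" for u z
  proof -
    have "meval u (reznick_form m r (hessian_dir f z)) = (\<Sum>i\<in>UNIV. \<Sum>j\<in>UNIV. q u i j * z i * z j)"
      by (simp add: hessian_dir_def reznick_form_sum reznick_form_mconst_mult q_def h_def mult_ac)
    then show ?thesis using nonneg[of u z] by (simp add: m_def)
  qed
  have "\<exists>ls. \<forall>i\<in>UNIV. \<forall>j\<in>UNIV. q u i j = (\<Sum>l\<leftarrow>ls. l i * l j)" for u
    by (rule psd_matrix_sum_rank_one) (auto intro: qsym qpsd)
  then obtain ls where ls: "\<And>u i j. q u i j = (\<Sum>l\<leftarrow>ls u. l i * l j)" by (metis UNIV_I)
  define P :: "('n + 'n, real) mpoly" where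
    "P = (\<Sum>u\<in>U. mconst (W u / C) * ((\<Sum>l\<leftarrow>ls u. (\<Sum>i\<in>UNIV. mconst (l i) * yvar i)\<^sup>2)
      * ((\<Sum>v\<in>UNIV. mconst (u v) * xvar v) ^ (s + r))\<^sup>2))"
  have "sum_of_squares P"
    unfolding P_def using U(2) C
    by (intro sum_of_squares_sum sum_of_squares_mconst_mult sum_of_squares_mult_square
        sum_of_squares_sum_list) auto
  moreover have "hessian_form f * (\<Sum>i\<in>UNIV. (xvar i)\<^sup>2) ^ r = P"
  proof (rule mpoly_eqI_meval)
    fix t :: "'n + 'n \<Rightarrow> real"
    define x where "x i = t (Inl i)" for i
    define y where "y i = t (Inr i)" for i
    let ?pw = "\<lambda>u. (\<Sum>v\<in>UNIV. x v * u v) ^ (m + 2 * r)"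
    have sq: "(\<Sum>l\<leftarrow>ls u. (\<Sum>i\<in>UNIV. l i * y i)\<^sup>2) = (\<Sum>i\<in>UNIV. \<Sum>j\<in>UNIV. y i * y j * q u i j)" for u
    proof -
      have "(\<Sum>l\<leftarrow>L. (\<Sum>i\<in>UNIV. l i * y i)\<^sup>2) = (\<Sum>i\<in>UNIV. \<Sum>j\<in>UNIV. y i * y j * (\<Sum>l\<leftarrow>L. l i * l j))" for L
        by (induction L) (auto simp: power2_eq_square sum_product distrib_left sum.distrib mult_ac)
      then show ?thesis by (simp add: ls)
    qed
    have pw: "((\<Sum>v\<in>UNIV. u v * x v) ^ (s + r))\<^sup>2 = ?pw u" for u
    proof -
      have "(a ^ (s + r))\<^sup>2 = a ^ (m + 2 * r)" for a :: real
        unfolding power_mult[symmetric] m_def by (rule arg_cong[of _ _ "power a"]) simp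
      then show ?thesis by (simp only: mult.commute[of "u _"])
    qed
    have "meval t P = (\<Sum>u\<in>U. W u / C * ((\<Sum>l\<leftarrow>ls u. (\<Sum>i\<in>UNIV. l i * y i)\<^sup>2)
        * ((\<Sum>v\<in>UNIV. u v * x v) ^ (s + r))\<^sup>2))"
      by (simp add: P_def meval_sum_list x_def y_def)
    also have "\<dots> = (\<Sum>u\<in>U. W u / C * ((\<Sum>i\<in>UNIV. \<Sum>j\<in>UNIV. y i * y j * q u i j) * ?pw u))"
      unfolding sq pw ..
    also have "\<dots> = (\<Sum>i\<in>UNIV. \<Sum>j\<in>UNIV. \<Sum>u\<in>U. W u / C * (y i * y j * q u i j * ?pw u))"
      unfolding sum_distrib_left sum_distrib_right sum.swap[of _ U] ..
    also have "\<dots> = (\<Sum>i\<in>UNIV. \<Sum>j\<in>UNIV. y i * y j / C * (\<Sum>u\<in>U. W u * (q u i j * ?pw u)))"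
      by (simp add: sum_distrib_left mult_ac)
    also have "\<dots> = (\<Sum>i\<in>UNIV. \<Sum>j\<in>UNIV. y i * y j * meval x (h i j)) * (\<Sum>v\<in>UNIV. (x v)\<^sup>2) ^ r"
      unfolding repr[symmetric] sum_distrib_right using C by (intro sum.cong refl) simp
    also have "\<dots> = meval t (hessian_form f * (\<Sum>i\<in>UNIV. (xvar i)\<^sup>2) ^ r)"
      by (simp add: meval_hessian_form meval_hessian_dir h_def x_def[abs_def] y_def[abs_def])
    finally show "meval t (hessian_form f * (\<Sum>i\<in>UNIV. (xvar i)\<^sup>2) ^ r) = meval t P" by simp
  qed
  ultimately show ?thesis by (simp add: r_sos_convex_def)
qed

section \<open>Second derivatives of forms on the sphere\<close>

fun chebyshev :: "nat \<Rightarrow> real poly" where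
  "chebyshev 0 = 1"
| "chebyshev (Suc 0) = [:0, 1:]"
| "chebyshev (Suc (Suc k)) = [:0, 2:] * chebyshev (Suc k) - chebyshev k"

lemma poly_chebyshev_cos: "poly (chebyshev k) (cos t) = cos (real k * t)"
proof (induction k rule: chebyshev.induct)
  case (3 k)
  define a where "a = real (Suc k) * t"
  have e1: "real (Suc (Suc k)) * t = a + t" and e2: "real k * t = a - t"
    by (simp_all add: a_def algebra_simps)
  have "cos (a + t) = 2 * cos t * cos a - cos (a - t)"
    by (simp add: cos_add cos_diff)
  moreover have "poly (chebyshev (Suc k)) (cos t) = cos a" "poly (chebyshev k) (cos t) = cos (a - t)"
    using 3 unfolding e2[symmetric] by (simp_all only: a_def)
  ultimately show ?case unfolding e1 by simp
qed auto

lemma degree_chebyshev_le: "degree (chebyshev k) \<le> k"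
proof (induction k rule: chebyshev.induct)
  case (3 k)
  have "degree ([:0, 2:] * chebyshev (Suc k)) \<le> Suc (Suc k)"
    using degree_mult_le[of "[:0, 2:]" "chebyshev (Suc k)"] 3(1) by simp
  then show ?case using 3(2) by (auto intro!: degree_diff_le)
qed auto

lemma chebyshev_at_1: "poly (chebyshev k) 1 = 1"
  using poly_chebyshev_cos[of k 0] by simp

lemma pderiv_chebyshev_at_1: "poly (pderiv (chebyshev k)) 1 = (real k)\<^sup>2"
  by (induction k rule: chebyshev.induct)
    (simp_all add: pderiv_diff pderiv_smult pderiv_pCons chebyshev_at_1 power2_eq_square algebra_simps)

text \<open>
  Lagrange interpolation at the extremal points of the Chebyshev polynomial \<open>T\<close>: on the basis
  polynomials the functional alternates in sign just as \<open>T\<close> does, so that \<open>T\<close> is extremal.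
\<close>

lemma chebyshev_endpoint_bound:
  fixes R :: "real poly"
  assumes deg: "degree R \<le> s" and s: "s > 0" and R: "\<And>x. \<bar>x\<bar> \<le> 1 \<Longrightarrow> \<bar>poly R x\<bar> \<le> M"
  shows "\<bar>2 * poly (pderiv R) 1 - real s * poly R 1\<bar> \<le> (2 * (real s)\<^sup>2 - real s) * M"
proof -
  define \<xi> where "\<xi> j = cos (real j * pi / real s)" for j
  define A where "A = \<xi> ` {..s}"
  \<comment> \<open>In \<open>second_derivative_bound\<close> this combination isolates
    \<open>- coeff h 2\<close>.\<close>
  define \<Lambda> where "\<Lambda> p = 2 * poly (pderiv p) 1 - real s * poly p 1" for p :: "real poly"
  define T where "T = chebyshev s"
  have less: "\<xi> j < \<xi> i" if "i < j" "j \<le> s" for i j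
    unfolding \<xi>_def by (rule cos_monotone_0_pi) (use that s in \<open>auto simp: divide_simps\<close>)
  have inj: "inj_on \<xi> {..s}"
  proof (rule inj_onI)
    fix i j assume "i \<in> {..s}" "j \<in> {..s}" "\<xi> i = \<xi> j"
    then show "i = j" using less[of i j] less[of j i] by (cases i j rule: linorder_cases) auto
  qed
  have A: "finite A" "card A = Suc s"
    using card_image[OF inj] by (auto simp: A_def)
  have \<xi>0: "\<xi> 0 = 1" by (simp add: \<xi>_def)
  have oneA: "1 \<in> A" using \<xi>0 by (force simp: A_def)
  have T_node: "poly T (\<xi> j) = (- 1) ^ j" if "j \<le> s" for j
    using s by (simp add: T_def \<xi>_def poly_chebyshev_cos)
  have expand: "\<Lambda> p = (\<Sum>a\<in>A. poly p a * \<Lambda> (lagrange_basis A a))" if "degree p \<le> s" for p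
  proof -
    have p: "p = (\<Sum>a\<in>A. smult (poly p a) (lagrange_basis A a))"
      using that A by (intro lagrange_interpolation) auto
    have 1: "poly p 1 = (\<Sum>a\<in>A. poly p a * poly (lagrange_basis A a) 1)"
      using arg_cong[OF p, of "\<lambda>p. poly p 1"] by (simp add: poly_sum)
    have 2: "poly (pderiv p) 1 = (\<Sum>a\<in>A. poly p a * poly (pderiv (lagrange_basis A a)) 1)"
      using arg_cong[OF p, of "\<lambda>p. poly (pderiv p) 1"]
      by (simp add: poly_sum pderiv_smult higher_pderiv_sum[of 1, simplified])
    show ?thesis
      unfolding \<Lambda>_def 1 2 by (simp add: sum_distrib_left sum_subtractf[symmetric] algebra_simps)
  qed
  have sign: "(- 1) ^ j * \<Lambda> (lagrange_basis A (\<xi> j)) \<ge> 0" if j: "j \<le> s" for j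
  proof (cases "j = 0")
    case True
    let ?f = "\<lambda>b. smult (1 / (1 - b)) [:-b, 1:]"
    have bnd: "b < 1 \<and> b \<ge> - 1" if b: "b \<in> A - {1}" for b
    proof -
      obtain i where i: "i \<le> s" "b = \<xi> i" using b by (auto simp: A_def)
      then have "i \<noteq> 0" using b \<xi>0 by (cases "i = 0") auto
      then show ?thesis using less[of 0 i] i \<xi>0 by (simp add: \<xi>_def)
    qed
    have one: "poly (?f b) 1 = 1" if "b \<in> A - {1}" for b
      using bnd[OF that] by (simp add: diff_divide_distrib[symmetric])
    have "poly (pderiv (lagrange_basis A 1)) 1
        = (\<Sum>b\<in>A - {1}. poly (prod ?f (A - {1} - {b})) 1 * poly (pderiv (?f b)) 1)"
      unfolding lagrange_basis_def pderiv_prod by (simp add: poly_sum)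
    also have "\<dots> = (\<Sum>b\<in>A - {1}. 1 / (1 - b))"
    proof (rule sum.cong)
      fix b assume b: "b \<in> A - {1}"
      have "poly (prod ?f (A - {1} - {b})) 1 = 1"
        unfolding poly_prod by (rule prod.neutral) (use one in auto)
      then show "poly (prod ?f (A - {1} - {b})) 1 * poly (pderiv (?f b)) 1 = 1 / (1 - b)"
        by (simp add: pderiv_smult pderiv_pCons)
    qed simp
    \<comment> \<open>All nodes are at least \<open>- 1\<close>. The \<open>s\<close> nodes other
      than 1 thus give \<open>s / 2\<close>, exactly what the term
      \<open>- real s * poly p 1\<close> of the functional requires.\<close>
    also have "\<dots> \<ge> (\<Sum>b\<in>A - {1}. 1 / 2)"
      by (rule sum_mono) (use bnd in \<open>force simp: divide_simps\<close>)
    also have "(\<Sum>b\<in>A - {1}. 1 / 2) = real s / 2"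
      using A oneA by simp
    finally have d: "poly (pderiv (lagrange_basis A 1)) 1 \<ge> real s / 2" .
    have "poly (lagrange_basis A 1) 1 = 1"
      using poly_lagrange_basis[OF A(1) oneA oneA] by simp
    then show ?thesis using d True \<xi>0 by (simp add: \<Lambda>_def)
  next
    case False
    define a where "a = \<xi> j"
    define g where "g b = smult (1 / (a - b)) [:-b, 1:]" for b
    have a: "a \<in> A" "a \<noteq> 1" "1 \<in> A - {a}"
      using less[of 0 j] j False \<xi>0 oneA by (auto simp: a_def A_def)
    have l: "lagrange_basis A a = g 1 * prod g (A - {a} - {1})"
      unfolding lagrange_basis_def g_def[symmetric] using A a(3) by (intro prod.remove) auto
    have "poly (lagrange_basis A a) 1 = 0"
      using poly_lagrange_basis[OF A(1), of a 1] a by auto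
    moreover have "poly (pderiv (lagrange_basis A a)) 1
        = 1 / (a - 1) * poly (prod g (A - {a} - {1})) 1"
    proof -
      have "poly (g 1) 1 = 0" "poly (pderiv (g 1)) 1 = 1 / (a - 1)"
        by (simp_all add: g_def pderiv_smult pderiv_pCons)
      then show ?thesis unfolding l pderiv_mult by simp
    qed
    ultimately have \<Lambda>: "\<Lambda> (lagrange_basis A a)
        = 2 * (1 / (a - 1) * (\<Prod>b\<in>A - {a} - {1}. (1 - b) / (a - b)))"
      by (simp add: \<Lambda>_def poly_prod g_def diff_divide_distrib)
    \<comment> \<open>The nodes decrease, so exactly the \<open>j\<close> nodes of smaller index lie
      to the right of \<open>a\<close>; their factors produce the sign
      \<open>(- 1) ^ j\<close>.\<close>
    have "(\<Prod>b\<in>A - {a}. a - b) = (\<Prod>i\<in>{..s} - {j}. a - \<xi> i)"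
    proof -
      have "A - {a} = \<xi> ` ({..s} - {j})"
        using inj j by (auto simp: A_def a_def inj_on_def)
      then show ?thesis
        using inj by (simp add: prod.reindex inj_on_diff)
    qed
    also have "{..s} - {j} = {..<j} \<union> {j<..s}" using j by auto
    also have "(\<Prod>i\<in>{..<j} \<union> {j<..s}. a - \<xi> i) = (\<Prod>i<j. a - \<xi> i) * (\<Prod>i\<in>{j<..s}. a - \<xi> i)"
      by (rule prod.union_disjoint) auto
    also have "(\<Prod>i<j. a - \<xi> i) = (- 1) ^ j * (\<Prod>i<j. \<xi> i - a)"
      using prod.distrib[of "\<lambda>_. - 1" "\<lambda>i. \<xi> i - a" "{..<j}"] by simp
    finally have P: "(\<Prod>b\<in>A - {a}. a - b) = (- 1) ^ j * ((\<Prod>i<j. \<xi> i - a) * (\<Prod>i\<in>{j<..s}. a - \<xi> i))"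
      by simp
    have pos: "(\<Prod>i<j. \<xi> i - a) * (\<Prod>i\<in>{j<..s}. a - \<xi> i) > 0"
      by (intro mult_pos_pos prod_pos) (use less j in \<open>auto simp: a_def\<close>)
    have "1 / (a - 1) * (\<Prod>b\<in>A - {a} - {1}. (1 - b) / (a - b))
        = (\<Prod>b\<in>A - {a} - {1}. 1 - b) / (\<Prod>b\<in>A - {a}. a - b)"
      using prod.remove[of "A - {a}" 1 "\<lambda>b. a - b"] A a(3) by (simp add: prod_dividef)
    also have "(- 1) ^ j * \<dots> = (\<Prod>b\<in>A - {a} - {1}. 1 - b)
        / ((\<Prod>i<j. \<xi> i - a) * (\<Prod>i\<in>{j<..s}. a - \<xi> i))"
      unfolding P by (cases "even j") auto
    also have "\<dots> \<ge> 0"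
    proof (intro divide_nonneg_pos[OF _ pos] prod_nonneg)
      fix b assume "b \<in> A - {a} - {1}"
      then show "1 - b \<ge> 0" by (auto simp: A_def \<xi>_def)
    qed
    finally show ?thesis
      unfolding a_def[symmetric] \<Lambda> by (simp add: mult.left_commute[of _ 2])
  qed
  have T: "\<Lambda> T = 2 * (real s)\<^sup>2 - real s"
    by (simp add: \<Lambda>_def T_def chebyshev_at_1 pderiv_chebyshev_at_1)
  have "\<bar>\<Lambda> R\<bar> \<le> (\<Sum>a\<in>A. \<bar>poly R a * \<Lambda> (lagrange_basis A a)\<bar>)"
    unfolding expand[OF deg] by (rule sum_abs)
  also have "\<dots> \<le> (\<Sum>a\<in>A. M * (poly T a * \<Lambda> (lagrange_basis A a)))"
  proof (rule sum_mono)
    fix a assume "a \<in> A"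
    then obtain j where j: "j \<le> s" "a = \<xi> j" by (auto simp: A_def)
    have "\<bar>\<Lambda> (lagrange_basis A a)\<bar> = poly T a * \<Lambda> (lagrange_basis A a)"
      using sign[OF j(1)] unfolding j(2) T_node[OF j(1)] by (cases "even j") auto
    moreover have "\<bar>poly R a\<bar> \<le> M" by (rule R) (simp add: j \<xi>_def)
    ultimately show "\<bar>poly R a * \<Lambda> (lagrange_basis A a)\<bar> \<le> M * (poly T a * \<Lambda> (lagrange_basis A a))"
      unfolding abs_mult by (metis abs_ge_zero mult_right_mono)
  qed
  also have "\<dots> = M * \<Lambda> T"
    unfolding sum_distrib_left[symmetric] using expand[of T] degree_chebyshev_le[of s] by (simp add: T_def)
  finally have "\<bar>\<Lambda> R\<bar> \<le> M * (2 * (real s)\<^sup>2 - real s)" unfolding T .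
  then show ?thesis by (simp add: \<Lambda>_def mult.commute)
qed

section \<open>Restriction of forms to lines and circles\<close>

abbreviation veval :: "real ^ 'n::finite \<Rightarrow> ('n, real) mpoly \<Rightarrow> real" where
  "veval x \<equiv> meval (\<lambda>i. x $ i)"

lemma veval_scaleR: "is_form d p \<Longrightarrow> veval (t *\<^sub>R x) p = t ^ d * veval x p"
  using meval_scale[of d p t "\<lambda>i. x $ i"] by simp

definition line_poly :: "real ^ 'n \<Rightarrow> real ^ 'n \<Rightarrow> ('n::finite, real) mpoly \<Rightarrow> real poly" where
  "line_poly x v p = msubst (\<lambda>c. [:c:]) (\<lambda>i. [:x $ i, v $ i:]) p"

lemma poly_line_poly: "poly (line_poly x v p) t = veval (x + t *\<^sub>R v) p"
  by (simp add: line_poly_def poly_msubst)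

lemma pderiv_line_poly: "pderiv (line_poly x v p) = (\<Sum>i\<in>UNIV. smult (v $ i) (line_poly x v (mpartial i p)))"
  by (simp add: line_poly_def pderiv_msubst pderiv_pCons)

lemma coeff_0_line_poly: "coeff (line_poly x v p) 0 = veval x p"
  using poly_line_poly[of x v p 0] by (simp add: poly_0_coeff_0)

lemma coeff_1_line_poly: "coeff (line_poly x v p) 1 = (\<Sum>i\<in>UNIV. v $ i * veval x (mpartial i p))"
  using arg_cong[OF pderiv_line_poly[of x v p], of "\<lambda>q. coeff q 0"]
  by (simp add: coeff_pderiv coeff_sum coeff_0_line_poly)

lemma coeff_2_line_poly: "2 * coeff (line_poly x v p) 2 = veval x (hessian_dir p (\<lambda>i. v $ i))"
proof -
  have "2 * coeff (line_poly x v p) 2 = coeff (pderiv (line_poly x v p)) 1"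
    by (simp add: coeff_pderiv numeral_2_eq_2)
  also have "\<dots> = (\<Sum>j\<in>UNIV. \<Sum>i\<in>UNIV. v $ i * v $ j * veval x (mpartial i (mpartial j p)))"
    by (simp add: pderiv_line_poly coeff_sum coeff_1_line_poly[unfolded One_nat_def] sum_distrib_left mult_ac)
  also have "\<dots> = veval x (hessian_dir p (\<lambda>i. v $ i))"
    by (subst sum.swap) (simp add: meval_hessian_dir hessian_def)
  finally show ?thesis .
qed

lemma degree_line_poly:
  assumes "is_form d p"
  shows "degree (line_poly x v p) \<le> d"
proof -
  have mon: "degree (mmon (\<lambda>i. [:x $ i, v $ i:]) m) \<le> mdeg m" for m :: "'a \<Rightarrow>\<^sub>0 nat"
  proof -
    have "degree (mmon (\<lambda>i. [:x $ i, v $ i:]) m)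
        \<le> (\<Sum>i\<in>UNIV. degree ([:x $ i, v $ i:] ^ Poly_Mapping.lookup m i))"
      unfolding mmon_def
      using degree_prod_sum_le[of "UNIV :: 'a set" "\<lambda>i. [:x $ i, v $ i:] ^ Poly_Mapping.lookup m i"]
      by (simp add: o_def)
    also have "\<dots> \<le> mdeg m"
      unfolding mdeg_def
    proof (rule sum_mono)
      fix i
      have "degree ([:x $ i, v $ i:] ^ Poly_Mapping.lookup m i)
          \<le> degree [:x $ i, v $ i:] * Poly_Mapping.lookup m i"
        by (rule degree_power_le)
      also have "\<dots> \<le> 1 * Poly_Mapping.lookup m i" by (rule mult_right_mono) auto
      finally show "degree ([:x $ i, v $ i:] ^ Poly_Mapping.lookup m i) \<le> Poly_Mapping.lookup m i" by simp
    qed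
    finally show ?thesis .
  qed
  have "line_poly x v p = (\<Sum>m\<in>Poly_Mapping.keys p.
      smult (Poly_Mapping.lookup p m) (mmon (\<lambda>i. [:x $ i, v $ i:]) m))"
    unfolding line_poly_def by (subst msubst_superset[of "Poly_Mapping.keys p"]) auto
  also have "degree \<dots> \<le> d"
  proof (rule degree_sum_le)
    fix m assume "m \<in> Poly_Mapping.keys p"
    then have "mdeg m = d" using assms by (simp add: is_form_iff in_keys_iff)
    then show "degree (smult (Poly_Mapping.lookup p m) (mmon (\<lambda>i. [:x $ i, v $ i:]) m)) \<le> d"
      using mon[of m] degree_smult_le[THEN order_trans] by metis
  qed simp
  finally show ?thesis .
qed

lemma veval_combination:
  assumes "is_form d p" "\<alpha> \<noteq> 0"
  shows "veval (\<alpha> *\<^sub>R x + \<beta> *\<^sub>R v) p = \<alpha> ^ d * poly (line_poly x v p) (\<beta> / \<alpha>)"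
proof -
  have "\<alpha> *\<^sub>R x + \<beta> *\<^sub>R v = \<alpha> *\<^sub>R (x + (\<beta> / \<alpha>) *\<^sub>R v)"
    using assms(2) by (simp add: scaleR_add_right)
  then show ?thesis by (simp only: veval_scaleR[OF assms(1)] poly_line_poly)
qed

lemma norm_orthonormal_combination:
  fixes x v :: "'a::real_inner"
  assumes "norm x = 1" "norm v = 1" "x \<bullet> v = 0"
  shows "(norm (a *\<^sub>R x + b *\<^sub>R v))\<^sup>2 = a\<^sup>2 + b\<^sup>2"
proof -
  have "x \<bullet> x = 1" "v \<bullet> v = 1" "v \<bullet> x = 0"
    using assms by (simp_all add: dot_square_norm inner_commute)
  then show ?thesis
    unfolding power2_norm_eq_inner using assms(3)
    by (simp add: inner_add_left inner_add_right power2_eq_square)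
qed

lemma poly_even_part:
  fixes h :: "real poly"
  assumes "degree h \<le> 2 * s"
  shows "(poly h t + poly h (- t)) / 2 = (\<Sum>i\<le>s. coeff h (2 * i) * (t\<^sup>2) ^ i)"
proof -
  have p: "poly h t = (\<Sum>k\<le>2 * s. coeff h k * t ^ k)" for t
    unfolding poly_altdef
    by (rule sum.mono_neutral_left) (use assms in \<open>auto simp: coeff_eq_0\<close>)
  have "(poly h t + poly h (- t)) / 2 = (\<Sum>k\<le>2 * s. if even k then coeff h k * t ^ k else 0)"
    unfolding p sum.distrib[symmetric] sum_divide_distrib by (rule sum.cong) auto
  also have "\<dots> = (\<Sum>k\<in>(\<lambda>i. 2 * i) ` {..s}. coeff h k * t ^ k)"
    by (rule sum.mono_neutral_cong_right) (auto elim!: evenE)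
  also have "\<dots> = (\<Sum>i\<le>s. coeff h (2 * i) * (t\<^sup>2) ^ i)"
    by (subst sum.reindex) (auto simp: inj_on_def power_mult)
  finally show ?thesis .
qed

text \<open>
  Averaging \<open>g\<close> over \<open>\<plusminus> v\<close> on the circle through \<open>x\<close> and \<open>v\<close> gives a polynomial of degree \<open>s\<close> in
  \<open>cos (2 \<theta>)\<close>, with the second derivative at \<open>x\<close> in the first-order term at the endpoint.
\<close>

lemma second_derivative_bound:
  fixes x v :: "real ^ 'n::finite"
  assumes g: "is_form (2 * s) g" and M: "\<And>w :: real ^ 'n. norm w = 1 \<Longrightarrow> \<bar>veval w g\<bar> \<le> M"
    and x: "norm x = 1" and v: "norm v = 1" and orth: "x \<bullet> v = 0"
  shows "\<bar>veval x (hessian_dir g (\<lambda>i. v $ i))\<bar> \<le> real (2 * s) * (real (2 * s) - 1) * M"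
proof (cases "s = 0")
  case True
  then have "degree (line_poly x v g) = 0" using degree_line_poly[OF g, of x v] by simp
  then show ?thesis
    using coeff_2_line_poly[of x v g] True by (simp add: coeff_eq_0)
next
  case False
  define h where "h = line_poly x v g"
  \<comment> \<open>In the variable \<open>cos (2 \<theta>)\<close>, \<open>A\<close> is the square
    of the sine and \<open>B\<close> that of the cosine; \<open>R\<close> is the averaged
    restriction to the circle.\<close>
  define A :: "real poly" where "A = [:1/2, -1/2:]"
  define B :: "real poly" where "B = [:1/2, 1/2:]"
  define R where "R = (\<Sum>i\<le>s. smult (coeff h (2 * i)) (A ^ i * B ^ (s - i)))"
  have deg_h: "degree h \<le> 2 * s" unfolding h_def by (rule degree_line_poly[OF g])
  have "degree (A ^ i * B ^ (s - i)) \<le> s" if "i \<le> s" for i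
  proof -
    have "degree (A ^ i * B ^ (s - i)) \<le> degree A * i + degree B * (s - i)"
      by (intro degree_mult_le[THEN order_trans] add_mono degree_power_le)
    also have "\<dots> \<le> 1 * i + 1 * (s - i)"
      by (intro add_mono mult_right_mono) (auto simp: A_def B_def)
    finally show ?thesis using that by simp
  qed
  then have deg_R: "degree R \<le> s"
    unfolding R_def by (intro degree_sum_le) (auto intro: degree_smult_le[THEN order_trans])
  \<comment> \<open>At \<open>- 1\<close> the point on the circle is \<open>v\<close> or
    \<open>- v\<close>, which is no multiple of a point on the line \<open>x + t v\<close>. This
    value is added by continuity afterwards.\<close>
  have open_bound: "\<bar>poly R \<xi>\<bar> \<le> M" if "\<bar>\<xi>\<bar> \<le> 1" "\<xi> \<noteq> - 1" for \<xi>
  proof -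
    define \<alpha> where "\<alpha> = sqrt ((1 + \<xi>) / 2)"
    define \<beta> where "\<beta> = sqrt ((1 - \<xi>) / 2)"
    have sq: "\<alpha>\<^sup>2 = (1 + \<xi>) / 2" "\<beta>\<^sup>2 = (1 - \<xi>) / 2" using that by (simp_all add: \<alpha>_def \<beta>_def)
    have \<alpha>: "\<alpha> \<noteq> 0" using that by (auto simp: \<alpha>_def)
    have unit: "norm (\<alpha> *\<^sub>R x + b *\<^sub>R v) = 1" if "b\<^sup>2 = \<beta>\<^sup>2" for b
    proof -
      have "(norm (\<alpha> *\<^sub>R x + b *\<^sub>R v))\<^sup>2 = 1"
        unfolding norm_orthonormal_combination[OF x v orth] that sq by (simp add: field_simps)
      then show ?thesis by (simp add: power2_eq_1_iff) (metis norm_ge_zero neg_0_le_iff_le not_one_le_zero)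
    qed
    have "poly R \<xi> = (\<Sum>i\<le>s. coeff h (2 * i) * ((\<beta>\<^sup>2) ^ i * (\<alpha>\<^sup>2) ^ (s - i)))"
      unfolding R_def poly_sum sq by (simp add: A_def B_def field_simps)
    also have "\<dots> = \<alpha> ^ (2 * s) * (\<Sum>i\<le>s. coeff h (2 * i) * ((\<beta> / \<alpha>)\<^sup>2) ^ i)"
      unfolding sum_distrib_left
    proof (rule sum.cong)
      fix i assume "i \<in> {..s}"
      then have "(\<alpha>\<^sup>2) ^ s = (\<alpha>\<^sup>2) ^ (s - i) * (\<alpha>\<^sup>2) ^ i" by (simp flip: power_add)
      then show "coeff h (2 * i) * ((\<beta>\<^sup>2) ^ i * (\<alpha>\<^sup>2) ^ (s - i))
          = \<alpha> ^ (2 * s) * (coeff h (2 * i) * ((\<beta> / \<alpha>)\<^sup>2) ^ i)"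
        using \<alpha> unfolding power_mult by (simp add: power_divide)
    qed simp
    also have "\<dots> = \<alpha> ^ (2 * s) * ((poly h (\<beta> / \<alpha>) + poly h (- \<beta> / \<alpha>)) / 2)"
      unfolding poly_even_part[OF deg_h, symmetric] by simp
    also have "\<dots> = (veval (\<alpha> *\<^sub>R x + \<beta> *\<^sub>R v) g + veval (\<alpha> *\<^sub>R x + (- \<beta>) *\<^sub>R v) g) / 2"
      unfolding veval_combination[OF g \<alpha>] h_def by (simp add: algebra_simps)
    finally show ?thesis
      using M[OF unit[of \<beta>]] M[OF unit[of "- \<beta>"]] by auto
  qed
  have bound: "\<bar>poly R \<xi>\<bar> \<le> M" if "\<bar>\<xi>\<bar> \<le> 1" for \<xi>
  proof (cases "\<xi> = - 1")
    case True
    have "((\<lambda>z. \<bar>poly R z\<bar>) \<longlongrightarrow> \<bar>poly R (- 1)\<bar>) (at_right (- 1))"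
      by (intro tendsto_rabs tendsto_within_subset[OF isCont_tendsto_compose[OF poly_isCont tendsto_ident_at]]) auto
    moreover have "\<forall>\<^sub>F z in at_right (- 1). \<bar>poly R z\<bar> \<le> M"
      by (rule eventually_mono[OF eventually_at_right_real[of "- 1" 1]]) (auto intro!: open_bound)
    ultimately show ?thesis
      unfolding True by (rule tendsto_upperbound) simp
  qed (use that open_bound in auto)
  have A1: "poly A 1 = 0" and B1: "poly B 1 = 1" by (auto simp: A_def B_def)
  have R1: "poly R 1 = coeff h 0"
  proof -
    have "poly R 1 = (\<Sum>i\<le>s. if i = 0 then coeff h 0 else 0)"
      unfolding R_def poly_sum by (rule sum.cong) (auto simp: A1 B1 poly_power)
    then show ?thesis by simp
  qed
  \<comment> \<open>As \<open>A\<close> vanishes at 1, only the indices 0 and 1 survive one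
    differentiation, that is, the value and the second-order coefficient of
    \<open>h\<close>.\<close>
  have pd: "poly (pderiv (A ^ i * B ^ (s - i))) 1
      = (if i = 0 then real s / 2 else if i = 1 then - 1 / 2 else 0)" if "i \<le> s" for i
  proof (cases "i \<le> 1")
    case True
    then consider "i = 0" | "i = 1" by linarith
    then show ?thesis
      by cases (auto simp: pderiv_mult pderiv_power A1 B1 poly_power, auto simp: A_def B_def pderiv_pCons)
  next
    case False
    then show ?thesis by (simp add: pderiv_mult pderiv_power A1 poly_power power_0_left)
  qed
  have "poly (pderiv R) 1 = (\<Sum>i\<le>s. coeff h (2 * i) * poly (pderiv (A ^ i * B ^ (s - i))) 1)"
    unfolding R_def by (simp add: poly_sum pderiv_smult higher_pderiv_sum[of 1, simplified])
  also have "\<dots> = (\<Sum>i\<le>s. (if i = 0 then coeff h 0 * (real s / 2) else 0) + (if i = 1 then - coeff h 2 / 2 else 0))"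
    by (rule sum.cong) (auto simp: pd)
  also have "\<dots> = coeff h 0 * (real s / 2) - coeff h 2 / 2"
    using False by (simp add: sum.distrib)
  finally have "2 * poly (pderiv R) 1 - real s * poly R 1 = - coeff h 2"
    by (simp add: R1)
  then have "\<bar>coeff h 2\<bar> \<le> (2 * (real s)\<^sup>2 - real s) * M"
    using chebyshev_endpoint_bound[OF deg_R _ bound] False by simp
  then show ?thesis
    unfolding coeff_2_line_poly[symmetric] h_def[symmetric]
    by (simp add: power2_eq_square algebra_simps)
qed

section \<open>Laplacians and the ratio of the extreme values\<close>

definition orthonormal_basis :: "(real ^ 'n::finite) set \<Rightarrow> bool" where
  "orthonormal_basis B \<longleftrightarrow> finite B \<and> card B = CARD('n) \<and> (\<forall>e\<in>B. norm e = 1)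
    \<and> (\<forall>e\<in>B. \<forall>e'\<in>B. e \<noteq> e' \<longrightarrow> e \<bullet> e' = 0) \<and> (\<forall>w. (\<Sum>e\<in>B. (w \<bullet> e) *\<^sub>R e) = w)"

lemma orthonormal_basisI:
  fixes B :: "(real ^ 'n::finite) set"
  assumes B: "pairwise orthogonal B" "\<And>e. e \<in> B \<Longrightarrow> norm e = 1" "card B = CARD('n)"
  shows "orthonormal_basis B"
proof -
  have "0 \<notin> B" using B(2) by force
  then have ind: "independent B" using B(1) by (intro pairwise_orthogonal_independent)
  then have fin: "finite B" by (rule independent_imp_finite)
  have "dim (span B) = DIM(real ^ 'n)" using B(3) ind by (simp add: dim_eq_card_independent)
  then have span: "span B = UNIV" by (metis dim_eq_full span_span dim_span)
  have "(\<Sum>e\<in>B. (w \<bullet> e) *\<^sub>R e) = w" for w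
    by (rule orthonormal_basis_expand) (use B fin span in auto)
  then show ?thesis
    using B fin by (auto simp: orthonormal_basis_def pairwise_def orthogonal_def)
qed

lemma ex_orthonormal_basis_containing:
  fixes x :: "real ^ 'n::finite"
  assumes "norm x = 1"
  shows "\<exists>B. x \<in> B \<and> orthonormal_basis B"
proof -
  obtain B where B: "x \<in> B" "pairwise orthogonal B" "\<And>e. e \<in> B \<Longrightarrow> norm e = 1"
      "independent B" "card B = DIM(real ^ 'n)" "span B = UNIV"
    using vector_in_orthonormal_basis[OF assms] by metis
  then have "orthonormal_basis B" by (intro orthonormal_basisI) auto
  with B(1) show ?thesis by blast
qed

lemma trace_orthonormal_basis:
  fixes B :: "(real ^ 'n::finite) set" and Q :: "'n \<Rightarrow> 'n \<Rightarrow> real"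
  assumes "orthonormal_basis B"
  shows "(\<Sum>e\<in>B. \<Sum>i\<in>UNIV. \<Sum>j\<in>UNIV. e $ i * e $ j * Q i j) = (\<Sum>i\<in>UNIV. Q i i)"
proof -
  have expand: "(\<Sum>e\<in>B. (w \<bullet> e) *\<^sub>R e) = w" for w
    using assms by (simp add: orthonormal_basis_def)
  have delta: "(\<Sum>e\<in>B. e $ i * e $ j) = (if i = j then 1 else 0)" for i j
    using arg_cong[OF expand[of "axis i 1"], of "\<lambda>w. w $ j"] unfolding inner_axis'
    by (cases "i = j") (simp_all add: axis_def)
  have "(\<Sum>e\<in>B. \<Sum>i\<in>UNIV. \<Sum>j\<in>UNIV. e $ i * e $ j * Q i j)
      = (\<Sum>i\<in>UNIV. \<Sum>j\<in>UNIV. (\<Sum>e\<in>B. e $ i * e $ j) * Q i j)"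
    unfolding sum_distrib_right sum.swap[of _ B] ..
  also have "\<dots> = (\<Sum>i\<in>UNIV. \<Sum>j\<in>UNIV. if i = j then Q i j else 0)"
    unfolding delta by (intro sum.cong refl) simp
  finally show ?thesis by simp
qed

abbreviation second_diff :: "('n::finite, real) mpoly \<Rightarrow> real ^ 'n \<Rightarrow> real ^ 'n \<Rightarrow> real" where
  "second_diff f x y \<equiv> veval x (hessian_dir f (\<lambda>i. y $ i))"

lemma veval_laplacian:
  fixes B :: "(real ^ 'n::finite) set"
  assumes "orthonormal_basis B"
  shows "veval x (laplacian g) = (\<Sum>e\<in>B. second_diff g x e)"
  using trace_orthonormal_basis[OF assms, of "\<lambda>i j. veval x (hessian g $ i $ j)"]
  by (simp add: meval_hessian_dir laplacian_def hessian_def)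

lemma veval_euler:
  assumes "is_form d g"
  shows "(\<Sum>i\<in>UNIV. x $ i * veval x (mpartial i g)) = real d * veval x g"
  using arg_cong[OF euler_identity[OF assms], of "veval x"] by (simp add: of_nat_eq_mconst)

lemma second_diff_self:
  assumes "is_form d g"
  shows "second_diff g x x = real d * (real d - 1) * veval x g"
proof -
  have "second_diff g x x = (\<Sum>j\<in>UNIV. x $ j * (\<Sum>i\<in>UNIV. x $ i * veval x (mpartial i (mpartial j g))))"
    unfolding meval_hessian_dir hessian_def sum_distrib_left by (subst sum.swap) (simp add: mult_ac)
  also have "\<dots> = real (d - 1) * (real d * veval x g)"
    unfolding veval_euler[OF is_form_mpartial[OF assms]] veval_euler[OF assms, symmetric]
    by (simp add: sum_distrib_left mult_ac)
  also have "real (d - 1) * (real d * veval x g) = real d * (real d - 1) * veval x g"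
    by (cases d) auto
  finally show ?thesis .
qed

text \<open>The trace of the Hessian is taken in an orthonormal basis that contains
  \<open>x\<close>. In the radial direction Euler's identity gives the factor
  \<open>m (m - 1)\<close>, and in the tangential ones \<open>second_derivative_bound\<close> gives
  the same constant.\<close>

lemma laplacian_bound:
  fixes x :: "real ^ 'n::finite"
  assumes g: "is_form m g" and "even m" and M: "\<And>w :: real ^ 'n. norm w = 1 \<Longrightarrow> \<bar>veval w g\<bar> \<le> M"
    and x: "norm x = 1"
  shows "\<bar>veval x (laplacian g)\<bar> \<le> real CARD('n) * (real m * (real m - 1)) * M"
proof -
  obtain s where s: "m = 2 * s" using \<open>even m\<close> by (auto elim: evenE)
  obtain B where onb: "x \<in> B" "orthonormal_basis B"
    using ex_orthonormal_basis_containing[OF x] by blast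
  note B = onb(1) onb(2)[unfolded orthonormal_basis_def]
  have "\<bar>second_diff g x e\<bar> \<le> real m * (real m - 1) * M" if e: "e \<in> B" for e
  proof (cases "e = x")
    case True
    have "real m * (real m - 1) \<ge> 0" by (cases m) auto
    then show ?thesis
      unfolding True second_diff_self[OF g]
      using M[OF x] by (simp only: abs_mult[of "real m * (real m - 1)"] abs_of_nonneg mult_left_mono)
  next
    case False
    then show ?thesis
      using second_derivative_bound[of s g M x e] g M x B e unfolding s by auto
  qed
  then have "\<bar>veval x (laplacian g)\<bar> \<le> (\<Sum>e\<in>B. real m * (real m - 1) * M)"
    unfolding veval_laplacian[OF onb(2)] by (intro order_trans[OF sum_abs] sum_mono)
  then show ?thesis using B by simp
qed

lemma laplacian_pow_bound:
  fixes x :: "real ^ 'n::finite"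
  assumes g: "is_form m g" and m: "even m" and M: "\<And>w :: real ^ 'n. norm w = 1 \<Longrightarrow> \<bar>veval w g\<bar> \<le> M"
    and x: "norm x = 1"
  shows "\<bar>veval x ((laplacian ^^ l) g)\<bar> \<le> (real CARD('n) * (real m * (real m - 1))) ^ l * M"
  using x
proof (induction l arbitrary: x)
  case (Suc l)
  let ?K = "real CARD('n) * (real m * (real m - 1))"
  have M0: "M \<ge> 0" using M[OF Suc.prems] by linarith
  \<comment> \<open>The degree drops with each Laplacian, but the constant for degree
    \<open>m\<close> is kept. Once the truncated degree is 0, the left side is 0.\<close>
  have mono: "real (m - 2 * l) * (real (m - 2 * l) - 1) \<le> real m * (real m - 1)"
  proof (cases "m - 2 * l = 0")
    case True
    have "real m * (real m - 1) \<ge> 0" by (cases m) auto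
    then show ?thesis unfolding True by simp
  next
    case False
    then show ?thesis by (intro mult_mono) auto
  qed
  have "\<bar>veval x (laplacian ((laplacian ^^ l) g))\<bar>
      \<le> real CARD('n) * (real (m - 2 * l) * (real (m - 2 * l) - 1)) * (?K ^ l * M)"
    using is_form_laplacian_pow[OF g, of l] m Suc by (intro laplacian_bound) auto
  also have "\<dots> \<le> ?K * (?K ^ l * M)"
  proof (rule mult_right_mono)
    have "real m * (real m - 1) \<ge> 0" by (cases m) auto
    then show "?K ^ l * M \<ge> 0" using M0 by simp
  qed (use mono in \<open>intro mult_left_mono, auto\<close>)
  finally show ?case by (simp add: mult.assoc)
qed (use M in simp)

lemma exp_partial_sum_le:
  fixes t :: real
  assumes "t \<ge> 0"
  shows "(\<Sum>l\<in>{1..s}. t ^ l / fact l) \<le> exp t - 1"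
proof -
  have "(\<Sum>l\<le>s. t ^ l / fact l) \<le> exp t"
    unfolding exp_def
    using sum_le_suminf[OF summable_exp_generic, of "{..s}" t] assms
    by (simp add: divide_inverse mult.commute)
  moreover have "(\<Sum>l\<le>s. t ^ l / fact l) = 1 + (\<Sum>l\<in>{1..s}. t ^ l / fact l)"
    by (simp add: atMost_atLeast0 sum.atLeast_Suc_atMost)
  ultimately show ?thesis by linarith
qed

lemma vec_eq_norm_times_unit:
  fixes w :: "real ^ 'n::finite"
  obtains e where "norm e = 1" "w = norm w *\<^sub>R e"
proof (cases "w = 0")
  case True
  then show ?thesis using that[of "axis undefined 1"] by simp
next
  case False
  then show ?thesis using that[of "w /\<^sub>R norm w"] by simp
qed

lemma form_nonneg_from_sphere:
  fixes g :: "('n::finite, real) mpoly"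
  assumes g: "is_form m g" and "even m" and pos: "\<And>x :: real ^ 'n. norm x = 1 \<Longrightarrow> veval x g \<ge> 0"
  shows "meval u g \<ge> 0"
proof -
  define w :: "real ^ 'n" where "w = (\<chi> i. u i)"
  obtain e where e: "norm e = 1" "w = norm w *\<^sub>R e"
    by (rule vec_eq_norm_times_unit)
  have "meval u g = veval (norm w *\<^sub>R e) g" unfolding e(2)[symmetric] by (simp add: w_def)
  also have "\<dots> = norm w ^ m * veval e g" by (rule veval_scaleR[OF g])
  also have "\<dots> \<ge> 0" using pos[OF e(1)] by simp
  finally show ?thesis .
qed

text \<open>The summand for \<open>l = 0\<close> is \<open>g\<close> itself, at least
  \<open>\<mu>\<close> on the sphere. The others are dominated by the terms of the exponential
  series times \<open>M\<close>.\<close>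

lemma reznick_form_nonneg:
  fixes g :: "('n::finite, real) mpoly" and x :: "real ^ 'n"
  defines "n \<equiv> CARD('n)"
  assumes g: "is_form m g" and m: "even m"
    and lower: "\<And>w :: real ^ 'n. norm w = 1 \<Longrightarrow> \<mu> \<le> veval w g"
    and upper: "\<And>w :: real ^ 'n. norm w = 1 \<Longrightarrow> veval w g \<le> M"
    and pos: "\<mu> \<ge> 0"
    and small: "(exp (real n * (real m * (real m - 1)) / (2 * real (n + m + 2 * r))) - 1) * M \<le> \<mu>"
    and x: "norm x = 1"
  shows "veval x (reznick_form m r g) \<ge> 0"
proof -
  define K where "K = real n * (real m * (real m - 1))"
  define W where "W = real (n + m + 2 * r)"
  define t where "t = K / (2 * W)"
  have K: "K \<ge> 0" unfolding K_def by (cases m) auto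
  have W: "W > 0" by (simp add: W_def n_def add_pos_nonneg)
  have t: "t \<ge> 0" using K W by (simp add: t_def)
  have M: "\<bar>veval w g\<bar> \<le> M" if "norm w = 1" for w :: "real ^ 'n"
    using lower[OF that] upper[OF that] pos by linarith
  have M0: "M \<ge> 0" using M[OF x] by linarith
  have nx: "veval x norm_sq = 1"
    using x by (simp add: meval_norm_sq norm_vec_def L2_set_def)
  define T where "T l = reznick_coeff n m r l * veval x ((laplacian ^^ l) g)" for l
  have bound: "\<bar>T l\<bar> \<le> t ^ l / fact l * M" if "l \<le> m div 2" for l
  proof -
    define P where "P = (\<Prod>j<l. real (n + 2 * m + 2 * r) - 2 * real (Suc j))"
    \<comment> \<open>Every factor of \<open>P\<close> is at least
      \<open>n + 2 * m + 2 * r - 2 * l\<close>, and \<open>2 * l \<le> m\<close>.\<close>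
    have "W ^ l = (\<Prod>j<l. W)" by simp
    also have "\<dots> \<le> P"
      unfolding P_def by (rule prod_mono) (use that W in \<open>auto simp: W_def\<close>)
    finally have P: "W ^ l \<le> P" .
    then have "P > 0" using W by (meson less_le_trans zero_less_power)
    have "\<bar>T l\<bar> = (1 / 2) ^ l / (fact l * P) * \<bar>veval x ((laplacian ^^ l) g)\<bar>"
      using \<open>P > 0\<close> unfolding T_def reznick_coeff_def P_def[symmetric]
      by (simp add: abs_mult power_abs)
    also have "\<dots> \<le> (1 / 2) ^ l / (fact l * W ^ l) * (K ^ l * M)"
      using laplacian_pow_bound[OF g m M x, of l] P W \<open>P > 0\<close> M0 K
      by (intro mult_mono divide_left_mono) (auto simp: K_def n_def)
    also have "\<dots> = t ^ l / fact l * M"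
      by (simp add: t_def power_divide power_mult_distrib)
    finally show ?thesis .
  qed
  have "veval x (reznick_form m r g) = (\<Sum>l\<le>m div 2. T l)"
    by (simp add: reznick_form_def nx T_def n_def)
  also have "\<dots> = veval x g + (\<Sum>l\<in>{1..m div 2}. T l)"
    by (simp add: atMost_atLeast0 sum.atLeast_Suc_atMost T_def reznick_coeff_def)
  finally have split: "veval x (reznick_form m r g) = veval x g + (\<Sum>l\<in>{1..m div 2}. T l)" .
  have "- (\<Sum>l\<in>{1..m div 2}. t ^ l / fact l * M) \<le> (\<Sum>l\<in>{1..m div 2}. T l)"
    unfolding sum_negf[symmetric]
  proof (rule sum_mono)
    fix l assume "l \<in> {1..m div 2}"
    then show "- (t ^ l / fact l * M) \<le> T l" using bound[of l] by (simp only: abs_le_iff) auto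
  qed
  then have "veval x (reznick_form m r g) \<ge> veval x g - (\<Sum>l\<in>{1..m div 2}. t ^ l / fact l) * M"
    unfolding split sum_distrib_right by linarith
  moreover have "(\<Sum>l\<in>{1..m div 2}. t ^ l / fact l) * M \<le> (exp t - 1) * M"
    by (intro mult_right_mono exp_partial_sum_le t M0)
  ultimately show ?thesis
    using small lower[OF x] by (simp add: t_def K_def W_def)
qed

lemma hessian_at_inner: "y \<bullet> (hessian_at f x *v y) = second_diff f x y"
  by (simp add: meval_hessian_dir hessian_at_def inner_vec_def matrix_vector_mult_def
      sum_distrib_left mult_ac)

lemma continuous_on_meval:
  assumes "\<And>i. continuous_on S (\<lambda>z. g z i)"
  shows "continuous_on S (\<lambda>z. meval (g z) (p :: ('v::finite, real) mpoly))"
  by (induction p rule: mpoly_ring_induct) (auto intro!: continuous_intros assms)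

lemma sphere_values_bounds:
  fixes f :: "('n::finite, real) mpoly"
  assumes pos: "\<And>x y :: real ^ 'n. norm x = 1 \<Longrightarrow> norm y = 1 \<Longrightarrow> second_diff f x y > 0"
  obtains \<mu> M where "0 < \<mu>" "\<mu> \<le> M" "eta f = \<mu> / M"
    "\<And>x y :: real ^ 'n. norm x = 1 \<Longrightarrow> norm y = 1 \<Longrightarrow> \<mu> \<le> second_diff f x y \<and> second_diff f x y \<le> M"
proof -
  let ?S = "sphere (0 :: real ^ 'n) 1"
  define \<phi> where "\<phi> z = second_diff f (fst z) (snd z)" for z
  have S: "sphere_values f = \<phi> ` (?S \<times> ?S)"
    by (force simp: sphere_values_def hessian_at_inner \<phi>_def)
  have "continuous_on (?S \<times> ?S) \<phi>"
    unfolding \<phi>_def meval_hessian_dir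
    by (intro continuous_intros continuous_on_meval)
  then have comp: "compact (sphere_values f)"
    unfolding S by (intro compact_continuous_image compact_Times compact_sphere)
  have e: "axis undefined 1 \<in> ?S" by simp
  then have "sphere_values f \<noteq> {}" unfolding S by blast
  then obtain \<mu> M where \<mu>: "\<mu> \<in> sphere_values f" "\<And>t. t \<in> sphere_values f \<Longrightarrow> \<mu> \<le> t"
    and M: "M \<in> sphere_values f" "\<And>t. t \<in> sphere_values f \<Longrightarrow> t \<le> M"
    using compact_attains_inf[OF comp] compact_attains_sup[OF comp] by metis
  have "(LEAST t. t \<in> sphere_values f) = \<mu>" "(GREATEST t. t \<in> sphere_values f) = M"
    by (rule Least_equality Greatest_equality; use \<mu> M in blast)+
  then have "eta f = \<mu> / M" by (simp add: eta_def)
  moreover have "0 < \<mu>" using \<mu>(1) pos by (auto simp: S \<phi>_def)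
  moreover have "\<mu> \<le> second_diff f x y \<and> second_diff f x y \<le> M"
    if "norm x = 1" "norm y = 1" for x y :: "real ^ 'n"
  proof -
    have "second_diff f x y \<in> sphere_values f"
      unfolding S using that by (intro image_eqI[of _ _ "(x, y)"]) (auto simp: \<phi>_def)
    then show ?thesis using \<mu>(2) M(2) by blast
  qed
  moreover have "\<mu> \<le> M" using \<mu> M by blast
  ultimately show ?thesis using that by blast
qed

text \<open>Adding the values at \<open>t\<close> and \<open>- t\<close> cancels the linear term;
  dividing by the square of \<open>t\<close> and letting \<open>t\<close> tend to 0 leaves twice the
  coefficient.\<close>

lemma nonneg_poly_coeff_2:
  fixes p :: "real poly"
  assumes nonneg: "\<And>t. poly p t \<ge> 0" and zero: "coeff p 0 = 0"
  shows "coeff p 2 \<ge> 0"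
proof -
  obtain b q where p: "p = pCons 0 (pCons b q)" using zero by (metis coeff_pCons_0 pCons_cases)
  have c: "coeff p 2 = poly q 0" by (simp add: p poly_0_coeff_0 numeral_2_eq_2)
  have "poly q t + poly q (- t) \<ge> 0" if "t \<noteq> 0" for t
  proof -
    have "t * t * (poly q t + poly q (- t)) \<ge> 0"
      using nonneg[of t] nonneg[of "- t"] by (simp add: p algebra_simps)
    moreover have "t * t > 0" using that by (metis not_real_square_gt_zero)
    ultimately show ?thesis by (simp add: zero_le_mult_iff)
  qed
  moreover have "((\<lambda>t. poly q t + poly q (- t)) \<longlongrightarrow> poly q 0 + poly q (- 0)) (at 0)"
    by (intro tendsto_intros)
  ultimately have "poly q 0 + poly q (- 0) \<ge> 0"
    by (intro tendsto_lowerbound[where F = "at (0::real)"]) (auto simp: eventually_at_filter)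
  then show ?thesis by (simp add: c)
qed

lemma coeff_power_one_plus_sq:
  "coeff ([:1, 0, 1:] ^ k :: real poly) 0 = 1 \<and> coeff ([:1, 0, 1:] ^ k :: real poly) 2 = real k"
  by (induction k) (auto simp: numeral_2_eq_2 coeff_pCons)

text \<open>
  At a maximum \<open>x\<close> of \<open>f\<close> on the sphere, \<open>y\<^sup>T H\<^sub>f(x) y \<le> d f(x)\<close> for \<open>y\<close> orthogonal to \<open>x\<close>, while
  \<open>x\<^sup>T H\<^sub>f(x) x = d (d - 1) f(x)\<close>.
\<close>

lemma sphere_values_ratio:
  fixes f :: "('n::finite, real) mpoly"
  assumes f: "is_form d f" and d: "even d" "d > 0" and n: "CARD('n) \<ge> 2"
    and bounds: "\<And>x y :: real ^ 'n. norm x = 1 \<Longrightarrow> norm y = 1 \<Longrightarrow> \<mu> \<le> second_diff f x y \<and> second_diff f x y \<le> M"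
  shows "(real d - 1) * \<mu> \<le> M"
proof -
  obtain k where k: "d = 2 * k" using d by (auto elim: evenE)
  let ?S = "sphere (0 :: real ^ 'n) 1"
  have cont: "continuous_on ?S (\<lambda>x. veval x f)"
    by (intro continuous_on_meval continuous_intros)
  have "axis undefined 1 \<in> ?S" by simp
  then have "?S \<noteq> {}" by blast
  then obtain x where "x \<in> ?S" "\<forall>w\<in>?S. veval w f \<le> veval x f"
    using continuous_attains_sup[OF compact_sphere _ cont] by blast
  then have x: "norm x = 1" and max: "\<And>w. norm w = 1 \<Longrightarrow> veval w f \<le> veval x f" by auto
  obtain B where onb: "x \<in> B" "orthonormal_basis B"
    using ex_orthonormal_basis_containing[OF x] by blast
  note B = onb(1) onb(2)[unfolded orthonormal_basis_def]
  have "card (B - {x}) > 0" using n B by simp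
  then have "B - {x} \<noteq> {}" by (metis card.empty less_irrefl)
  then obtain y where y: "y \<in> B" "y \<noteq> x" by auto
  define F where "F = veval x f"
  \<comment> \<open>By homogeneity, maximality of \<open>F\<close> on the sphere bounds
    \<open>f\<close> on the line by \<open>F\<close> times the \<open>d\<close>-th power of the
    norm. Comparing coefficients of order 2 gives
    \<open>second_diff f x y \<le> d F\<close>.\<close>
  define P where "P = smult F ([:1, 0, 1:] ^ k) - line_poly x y f"
  have "poly P t \<ge> 0" for t
  proof -
    define \<nu> where "\<nu> = norm (x + t *\<^sub>R y)"
    have "(norm (1 *\<^sub>R x + t *\<^sub>R y))\<^sup>2 = 1\<^sup>2 + t\<^sup>2"
      by (rule norm_orthonormal_combination) (use x y B in auto)
    then have sq: "\<nu>\<^sup>2 = 1 + t\<^sup>2" by (simp add: \<nu>_def)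
    then have "\<nu>\<^sup>2 > 0" by (simp add: add_pos_nonneg)
    then have "\<nu> \<noteq> 0" by auto
    have "x + t *\<^sub>R y = \<nu> *\<^sub>R ((x + t *\<^sub>R y) /\<^sub>R \<nu>)" using \<open>\<nu> \<noteq> 0\<close> by simp
    then have "veval (x + t *\<^sub>R y) f = veval (\<nu> *\<^sub>R ((x + t *\<^sub>R y) /\<^sub>R \<nu>)) f" by (rule arg_cong)
    also have "\<dots> = \<nu> ^ d * veval ((x + t *\<^sub>R y) /\<^sub>R \<nu>) f" by (rule veval_scaleR[OF f])
    also have "\<dots> \<le> \<nu> ^ d * F"
      unfolding F_def by (intro mult_left_mono max) (use \<open>\<nu> \<noteq> 0\<close> in \<open>auto simp: \<nu>_def\<close>)
    also have "\<nu> ^ d = (1 + t\<^sup>2) ^ k" by (simp add: k power_mult sq)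
    finally show ?thesis
      by (simp add: P_def poly_line_poly poly_power power2_eq_square mult.commute)
  qed
  moreover have "coeff P 0 = 0"
    by (simp add: P_def coeff_power_one_plus_sq coeff_0_line_poly F_def)
  ultimately have "coeff P 2 \<ge> 0" by (rule nonneg_poly_coeff_2)
  then have "second_diff f x y \<le> real d * F"
    using coeff_2_line_poly[of x y f] by (simp add: P_def coeff_power_one_plus_sq k algebra_simps)
  moreover have "\<mu> \<le> second_diff f x y" using bounds x y B by blast
  moreover have "real d * (real d - 1) * F \<le> M"
    using bounds[OF x x] unfolding second_diff_self[OF f] F_def by simp
  ultimately show ?thesis
    using mult_left_mono[of \<mu> "real d * F" "real d - 1"] d by (simp add: mult_ac)
qed

section \<open>Spectral decomposition and quartic tensors\<close>

lemma quadratic_nonpos_imp_eq_0: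
  fixes a c :: real
  assumes "\<And>t. 2 * t * a + t\<^sup>2 * c \<le> 0"
  shows "a = 0"
proof (rule ccontr)
  assume "a \<noteq> 0"
  define t where "t = a / (\<bar>c\<bar> + 1)"
  have a: "a = t * (\<bar>c\<bar> + 1)" by (simp add: t_def)
  then have "t\<^sup>2 > 0" using \<open>a \<noteq> 0\<close> by auto
  have "2 * t * a + t\<^sup>2 * c = t\<^sup>2 * (2 * \<bar>c\<bar> + 2 + c)"
    unfolding a by (simp add: power2_eq_square algebra_simps)
  moreover have "t\<^sup>2 * (2 * \<bar>c\<bar> + 2 + c) > 0"
    using \<open>t\<^sup>2 > 0\<close> by (intro mult_pos_pos) auto
  ultimately show False using assms[of t] by linarith
qed

text \<open>Rayleigh's principle on the orthogonal complement \<open>V\<close> of \<open>B\<close>: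
  a maximum of \<open>x \<bullet> L x\<close> on its unit sphere is an eigenvector. \<open>V\<close>
  is invariant because \<open>L\<close> is self-adjoint and maps each \<open>b\<close> to a multiple
  of itself, and it is not zero because \<open>B\<close> has too few elements to span.\<close>

lemma eigenvector_orthogonal_to:
  fixes L :: "real ^ 'n::finite \<Rightarrow> real ^ 'n"
  assumes lin: "linear L" and self_adjoint: "\<And>v w. L v \<bullet> w = v \<bullet> L w"
    and B: "\<And>b. b \<in> B \<Longrightarrow> L b = s b *\<^sub>R b" and card: "finite B" "card B < CARD('n)"
  obtains x \<kappa> where "norm x = 1" "\<And>b. b \<in> B \<Longrightarrow> b \<bullet> x = 0" "L x = \<kappa> *\<^sub>R x"
proof -
  define V where "V = {x. \<forall>b\<in>B. b \<bullet> x = 0}"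
  have V_add: "v + w \<in> V" if "v \<in> V" "w \<in> V" for v w
    using that by (auto simp: V_def inner_add_right)
  have V_scale: "t *\<^sub>R v \<in> V" if "v \<in> V" for v t
    using that by (auto simp: V_def)
  have L_V: "L v \<in> V" if "v \<in> V" for v
    using that B by (auto simp: V_def simp flip: self_adjoint)
  have "dim B < DIM(real ^ 'n)"
    using dim_le_card'[OF card(1)] card(2) by simp
  then obtain x0 where x0: "x0 \<noteq> 0" "\<And>y. y \<in> span B \<Longrightarrow> orthogonal x0 y"
    using orthogonal_to_subspace_exists[of B] by blast
  have "x0 \<in> V" using x0(2) span_base by (auto simp: V_def orthogonal_def inner_commute)
  then have "(1 / norm x0) *\<^sub>R x0 \<in> sphere 0 1 \<inter> V"
    using x0(1) V_scale by auto
  then have ne: "sphere 0 1 \<inter> V \<noteq> {}" by blast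
  have "V = (\<Inter>b\<in>B. {x. b \<bullet> x = 0})" by (auto simp: V_def)
  then have "closed V" by (simp add: closed_INT closed_hyperplane)
  then have comp: "compact (sphere 0 1 \<inter> V)" by (intro compact_Int_closed compact_sphere)
  have "continuous_on (sphere 0 1 \<inter> V) (\<lambda>x. x \<bullet> L x)"
    by (intro continuous_intros linear_continuous_on_compose[OF _ lin])
  then obtain x where x: "x \<in> sphere 0 1 \<inter> V" and max: "\<And>w. w \<in> sphere 0 1 \<inter> V \<Longrightarrow> w \<bullet> L w \<le> x \<bullet> L x"
    using continuous_attains_sup[OF comp ne] by blast
  define \<kappa> where "\<kappa> = x \<bullet> L x"
  have xx: "x \<bullet> x = 1" and xV: "x \<in> V" using x by (auto simp: dot_square_norm)
  have rayleigh: "w \<bullet> L w \<le> \<kappa> * (w \<bullet> w)" if "w \<in> V" for w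
  proof (cases "w = 0")
    case True
    then show ?thesis by simp
  next
    case False
    have "(1 / norm w) *\<^sub>R w \<in> sphere 0 1 \<inter> V" using False that V_scale by auto
    from max[OF this] have "(w \<bullet> L w) / (norm w)\<^sup>2 \<le> \<kappa>"
      by (simp add: \<kappa>_def linear_scale[OF lin] power2_eq_square)
    then show ?thesis using False by (simp add: divide_le_eq dot_square_norm)
  qed
  \<comment> \<open>The residual lies in \<open>V\<close>, so it is an admissible variation of
    \<open>x\<close>; the first-order term in this direction is
    \<open>2 * t * (z \<bullet> z)\<close>.\<close>
  define z where "z = L x - \<kappa> *\<^sub>R x"
  have zV: "z \<in> V" using V_add[OF L_V[OF xV] V_scale[OF xV, of "- \<kappa>"]] by (simp add: z_def)
  have "2 * t * (z \<bullet> z) + t\<^sup>2 * (z \<bullet> L z - \<kappa> * (z \<bullet> z)) \<le> 0" for t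
  proof -
    have zLx: "z \<bullet> L x = z \<bullet> z + \<kappa> * (z \<bullet> x)"
      by (simp add: z_def inner_diff_left inner_diff_right inner_commute algebra_simps)
    have xLz: "x \<bullet> L z = z \<bullet> L x" by (metis self_adjoint inner_commute)
    have r: "(x + t *\<^sub>R z) \<bullet> L (x + t *\<^sub>R z) \<le> \<kappa> * ((x + t *\<^sub>R z) \<bullet> (x + t *\<^sub>R z))"
      by (rule rayleigh) (intro V_add xV V_scale zV)
    have l: "(x + t *\<^sub>R z) \<bullet> L (x + t *\<^sub>R z) = \<kappa> + 2 * t * (z \<bullet> L x) + t\<^sup>2 * (z \<bullet> L z)"
      by (simp add: linear_add[OF lin] linear_scale[OF lin] inner_add_left inner_add_right xLz \<kappa>_def
          power2_eq_square algebra_simps)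
    have n: "(x + t *\<^sub>R z) \<bullet> (x + t *\<^sub>R z) = 1 + 2 * t * (z \<bullet> x) + t\<^sup>2 * (z \<bullet> z)"
      by (simp add: inner_add_left inner_add_right xx inner_commute[of x z] power2_eq_square algebra_simps)
    show ?thesis using r unfolding l n zLx by (simp add: algebra_simps)
  qed
  then have "z \<bullet> z = 0" by (rule quadratic_nonpos_imp_eq_0)
  then have "L x = \<kappa> *\<^sub>R x" by (simp add: z_def)
  then show ?thesis using that[of x \<kappa>] x by (auto simp: V_def)
qed

lemma self_adjoint_eigenbasis:
  fixes L :: "real ^ 'n::finite \<Rightarrow> real ^ 'n"
  assumes lin: "linear L" and self_adjoint: "\<And>v w. L v \<bullet> w = v \<bullet> L w"
  shows "\<exists>B s. orthonormal_basis B \<and> (\<forall>b\<in>B. L b = s b *\<^sub>R b)"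
proof -
  have "\<exists>B s. finite B \<and> card B = k \<and> pairwise orthogonal B \<and> (\<forall>b\<in>B. norm b = 1)
      \<and> (\<forall>b\<in>B. L b = s b *\<^sub>R b)" if "k \<le> CARD('n)" for k
    using that
  proof (induction k)
    case 0
    then show ?case by (intro exI[of _ "{}"]) auto
  next
    case (Suc k)
    then obtain B s where B: "finite B" "card B = k" "pairwise orthogonal B" "\<forall>b\<in>B. norm b = 1"
        "\<forall>b\<in>B. L b = s b *\<^sub>R b" by auto
    obtain x \<kappa> where x: "norm x = 1" "\<And>b. b \<in> B \<Longrightarrow> b \<bullet> x = 0" "L x = \<kappa> *\<^sub>R x"
      using eigenvector_orthogonal_to[OF lin self_adjoint, of B s] B Suc.prems by auto
    have "x \<notin> B" using x by force
    then show ?case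
      using B x by (intro exI[of _ "insert x B"] exI[of _ "s(x := \<kappa>)"])
        (auto simp: pairwise_def orthogonal_def inner_commute)
  qed
  from this[of "CARD('n)"] show ?thesis
    by (metis order_refl orthonormal_basisI)
qed

lemma symmetric_matrix_decomposition:
  fixes A :: "'n::finite \<Rightarrow> 'n \<Rightarrow> real"
  assumes sym: "\<And>i j. A i j = A j i"
  obtains B :: "(real ^ 'n) set" and s where "orthonormal_basis B"
    "\<And>i j. A i j = (\<Sum>e\<in>B. s e * e $ i * e $ j)"
proof -
  define L where "L w = (\<chi> i. \<Sum>j\<in>UNIV. A i j * w $ j)" for w :: "real ^ 'n"
  have lin: "linear L"
    by (rule linearI) (auto simp: L_def vec_eq_iff distrib_left sum.distrib sum_distrib_left mult_ac)
  have "L v \<bullet> w = v \<bullet> L w" for v w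
  proof -
    have "L v \<bullet> w = (\<Sum>i\<in>UNIV. \<Sum>j\<in>UNIV. A i j * v $ j * w $ i)"
      by (simp add: L_def inner_vec_def sum_distrib_right)
    also have "\<dots> = (\<Sum>j\<in>UNIV. \<Sum>i\<in>UNIV. A j i * v $ j * w $ i)"
      by (subst sum.swap) (simp add: sym)
    also have "\<dots> = v \<bullet> L w"
      by (simp add: L_def inner_vec_def sum_distrib_left mult_ac)
    finally show ?thesis .
  qed
  then obtain B s where B: "orthonormal_basis B" "\<And>b. b \<in> B \<Longrightarrow> L b = s b *\<^sub>R b"
    using self_adjoint_eigenbasis[OF lin] by blast
  have "A i j = (\<Sum>e\<in>B. s e * e $ i * e $ j)" for i j
  proof -
    have expand: "(\<Sum>e\<in>B. (axis j 1 \<bullet> e) *\<^sub>R e) = axis j 1"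
      using B(1) unfolding orthonormal_basis_def by blast
    have "A i j = L (axis j 1) $ i"
      by (simp add: L_def axis_def if_distrib cong: if_cong)
    also have "L (axis j 1) = (\<Sum>e\<in>B. (axis j 1 \<bullet> e) *\<^sub>R L e)"
      by (subst expand[symmetric]) (simp only: linear_sum[OF lin] linear_scale[OF lin])
    also have "\<dots> $ i = (\<Sum>e\<in>B. s e * e $ i * e $ j)"
      by (simp add: B(2) inner_axis' mult_ac)
    finally show ?thesis .
  qed
  with B(1) show ?thesis using that by blast
qed

text \<open>Fourth derivatives of a quartic form are constants, read off as the coefficient at
  exponent 0. A quadratic form is half the sum of its second derivatives times the variables, so
  with the factor 1/2 the tensor represents the Hessian form itself.\<close>

definition quartic_coeff :: "('n::finite, real) mpoly \<Rightarrow> 'n \<Rightarrow> 'n \<Rightarrow> 'n \<Rightarrow> 'n \<Rightarrow> real" where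
  "quartic_coeff f i j k l
    = Poly_Mapping.lookup (mpartial i (mpartial j (mpartial k (mpartial l f)))) 0 / 2"

definition quartic_tensor ::
    "('n::finite, real) mpoly \<Rightarrow> real ^ 'n \<Rightarrow> real ^ 'n \<Rightarrow> real ^ 'n \<Rightarrow> real ^ 'n \<Rightarrow> real" where
  "quartic_tensor f a b c e = (\<Sum>i\<in>UNIV. \<Sum>j\<in>UNIV. \<Sum>k\<in>UNIV. \<Sum>l\<in>UNIV.
     quartic_coeff f i j k l * a $ i * b $ j * c $ k * e $ l)"

lemma quartic_coeff_swap:
  "quartic_coeff f i j k l = quartic_coeff f j i k l"
  "quartic_coeff f i j k l = quartic_coeff f i k j l"
  "quartic_coeff f i j k l = quartic_coeff f i j l k"
  unfolding quartic_coeff_def by (metis mpartial_commute)+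

lemma quartic_coeff_swap_pairs: "quartic_coeff f k l i j = quartic_coeff f i j k l"
proof -
  have "quartic_coeff f k l i j = quartic_coeff f k i l j" by (rule quartic_coeff_swap(2))
  also have "\<dots> = quartic_coeff f i k l j" by (rule quartic_coeff_swap(1))
  also have "\<dots> = quartic_coeff f i k j l" by (rule quartic_coeff_swap(3))
  also have "\<dots> = quartic_coeff f i j k l" by (rule quartic_coeff_swap(2))
  finally show ?thesis .
qed

lemma quartic_tensor_swap:
  "quartic_tensor f a b c e = quartic_tensor f b a c e"
  "quartic_tensor f a b c e = quartic_tensor f a c b e"
  "quartic_tensor f a b c e = quartic_tensor f a b e c"
proof -
  let ?q = "quartic_coeff f"
  show "quartic_tensor f a b c e = quartic_tensor f b a c e"
    unfolding quartic_tensor_def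
    by (subst sum.swap, subst quartic_coeff_swap(1)) (simp only: mult.commute mult.left_commute)
  show "quartic_tensor f a b c e = quartic_tensor f a c b e"
    unfolding quartic_tensor_def
    by (rule sum.cong[OF refl], subst sum.swap, subst quartic_coeff_swap(2))
      (simp only: mult.commute mult.left_commute)
  show "quartic_tensor f a b c e = quartic_tensor f a b e c"
    unfolding quartic_tensor_def
    by (rule sum.cong[OF refl], rule sum.cong[OF refl], subst sum.swap, subst quartic_coeff_swap(3))
      (simp only: mult.commute mult.left_commute)
qed

lemma quartic_tensor_swap_pairs: "quartic_tensor f a b c e = quartic_tensor f c e a b"
proof -
  have "quartic_tensor f a b c e = quartic_tensor f a c b e" by (rule quartic_tensor_swap(2))
  also have "\<dots> = quartic_tensor f c a b e" by (rule quartic_tensor_swap(1))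
  also have "\<dots> = quartic_tensor f c a e b" by (rule quartic_tensor_swap(3))
  also have "\<dots> = quartic_tensor f c e a b" by (rule quartic_tensor_swap(2))
  finally show ?thesis .
qed

lemma quartic_tensor_linear_1:
  "quartic_tensor f (a + a') b c e = quartic_tensor f a b c e + quartic_tensor f a' b c e"
  "quartic_tensor f (a - a') b c e = quartic_tensor f a b c e - quartic_tensor f a' b c e"
  "quartic_tensor f (t *\<^sub>R a) b c e = t * quartic_tensor f a b c e"
  unfolding quartic_tensor_def
  by (simp_all add: algebra_simps sum.distrib sum_subtractf sum_distrib_left)

lemma quartic_tensor_linear:
  "quartic_tensor f a (b + b') c e = quartic_tensor f a b c e + quartic_tensor f a b' c e"
  "quartic_tensor f a (b - b') c e = quartic_tensor f a b c e - quartic_tensor f a b' c e"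
  "quartic_tensor f a (t *\<^sub>R b) c e = t * quartic_tensor f a b c e"
  "quartic_tensor f a b (c + c') e = quartic_tensor f a b c e + quartic_tensor f a b c' e"
  "quartic_tensor f a b (c - c') e = quartic_tensor f a b c e - quartic_tensor f a b c' e"
  "quartic_tensor f a b (t *\<^sub>R c) e = t * quartic_tensor f a b c e"
  "quartic_tensor f a b c (e + e') = quartic_tensor f a b c e + quartic_tensor f a b c e'"
  "quartic_tensor f a b c (e - e') = quartic_tensor f a b c e - quartic_tensor f a b c e'"
  "quartic_tensor f a b c (t *\<^sub>R e) = t * quartic_tensor f a b c e"
  unfolding quartic_tensor_def
  by (simp_all add: algebra_simps sum.distrib sum_subtractf sum_distrib_left)

text \<open>The Hessian entries are quadratic forms, recovered from their constant second
  derivatives by Euler's identity. Through the tensor the symmetry between \<open>x\<close> and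
  \<open>y\<close> becomes available.\<close>

lemma second_diff_quartic:
  assumes f: "is_form 4 f"
  shows "second_diff f x y = quartic_tensor f y y x x"
    and "second_diff (hessian_dir f (\<lambda>i. y $ i)) x e = 2 * quartic_tensor f y y e e"
proof -
  have const: "veval x (mpartial k (mpartial l (mpartial i (mpartial j f)))) = 2 * quartic_coeff f i j k l"
    for i j k l
  proof -
    have "is_form (4 - 1 - 1 - 1 - 1) (mpartial k (mpartial l (mpartial i (mpartial j f))))"
      by (intro is_form_mpartial f)
    then have *: "mpartial k (mpartial l (mpartial i (mpartial j f)))
        = mconst (Poly_Mapping.lookup (mpartial k (mpartial l (mpartial i (mpartial j f)))) 0)"
      by (intro form_0_eq_mconst) simp
    have "veval x (mpartial k (mpartial l (mpartial i (mpartial j f)))) = 2 * quartic_coeff f k l i j"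
      by (subst *) (simp add: quartic_coeff_def)
    then show ?thesis by (subst (asm) quartic_coeff_swap_pairs)
  qed
  have quad: "veval x (mpartial i (mpartial j f)) = (\<Sum>k\<in>UNIV. \<Sum>l\<in>UNIV. quartic_coeff f i j k l * x $ k * x $ l)" for i j
  proof -
    have "is_form 2 (mpartial i (mpartial j f))"
      using is_form_mpartial[OF is_form_mpartial[OF f]] by simp
    from second_diff_self[OF this, of x]
    have "(\<Sum>k\<in>UNIV. \<Sum>l\<in>UNIV. x $ k * x $ l * (2 * quartic_coeff f i j k l))
        = 2 * veval x (mpartial i (mpartial j f))"
      unfolding meval_hessian_dir hessian_def vec_lambda_beta const by simp
    moreover have "(\<Sum>k\<in>UNIV. \<Sum>l\<in>UNIV. x $ k * x $ l * (2 * quartic_coeff f i j k l))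
        = 2 * (\<Sum>k\<in>UNIV. \<Sum>l\<in>UNIV. quartic_coeff f i j k l * x $ k * x $ l)"
      unfolding sum_distrib_left by (intro sum.cong refl) simp
    ultimately show ?thesis by linarith
  qed
  show "second_diff f x y = quartic_tensor f y y x x"
    unfolding meval_hessian_dir hessian_def vec_lambda_beta quartic_tensor_def quad sum_distrib_left
    by (intro sum.cong refl) simp
  have "second_diff (hessian_dir f (\<lambda>i. y $ i)) x e = (\<Sum>k\<in>UNIV. \<Sum>l\<in>UNIV. \<Sum>i\<in>UNIV. \<Sum>j\<in>UNIV.
      2 * (quartic_coeff f i j k l * e $ k * e $ l * y $ i * y $ j))"
    unfolding meval_hessian_dir[of _ "hessian_dir f (\<lambda>i. y $ i)"] sum_distrib_left
    by (simp only: hessian_def hessian_dir_def vec_lambda_beta mpartial_sum mpartial_mconst_mult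
        meval_simps const sum_distrib_left) (intro sum.cong refl, simp)
  also have "\<dots> = 2 * quartic_tensor f e e y y"
    unfolding quartic_tensor_def sum_distrib_left
    by (intro sum.cong refl) (subst quartic_coeff_swap_pairs, rule refl)
  also have "quartic_tensor f e e y y = quartic_tensor f y y e e" by (rule quartic_tensor_swap_pairs)
  finally show "second_diff (hessian_dir f (\<lambda>i. y $ i)) x e = 2 * quartic_tensor f y y e e" .
qed

section \<open>Quartic forms\<close>

lemma r_sos_convex_reznick_sphere:
  fixes f :: "('n::finite, real) mpoly"
  assumes f: "is_form d f" and s: "d - 2 = 2 * s"
    and nonneg: "\<And>x y :: real ^ 'n. norm x = 1 \<Longrightarrow> norm y = 1
      \<Longrightarrow> veval x (reznick_form (2 * s) r (hessian_dir f (\<lambda>i. y $ i))) \<ge> 0"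
  shows "r_sos_convex r f"
proof (rule r_sos_convex_reznick[OF f s])
  fix u y :: "'n \<Rightarrow> real"
  obtain e where e: "norm e = 1" "vec_lambda y = norm (vec_lambda y) *\<^sub>R e"
    by (rule vec_eq_norm_times_unit)
  define t where "t = norm (vec_lambda y)"
  have "y i = t * e $ i" for i
    using arg_cong[OF e(2), of "\<lambda>w. w $ i"] by (simp add: t_def)
  then have yy: "y i * y j = t\<^sup>2 * (e $ i * e $ j)" for i j
    by (simp add: power2_eq_square)
  have "hessian_dir f y = mconst (t\<^sup>2) * hessian_dir f (\<lambda>i. e $ i)"
    unfolding hessian_dir_def sum_distrib_left yy by (simp only: mconst_mult mult.assoc)
  then have eq: "meval u (reznick_form (2 * s) r (hessian_dir f y))
      = t\<^sup>2 * meval u (reznick_form (2 * s) r (hessian_dir f (\<lambda>i. e $ i)))"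
    by (simp only: reznick_form_mconst_mult meval_simps)
  have "meval u (reznick_form (2 * s) r (hessian_dir f (\<lambda>i. e $ i))) \<ge> 0"
  proof (rule form_nonneg_from_sphere)
    show "is_form (2 * s) (reznick_form (2 * s) r (hessian_dir f (\<lambda>i. e $ i)))"
      using is_form_hessian_dir[OF f] unfolding s by (rule is_form_reznick_form)
  qed (use nonneg e(1) in auto)
  then show "meval u (reznick_form (2 * s) r (hessian_dir f y)) \<ge> 0"
    unfolding eq by (intro mult_nonneg_nonneg zero_le_power2)
qed

text \<open>A form in one variable is a multiple of a power, so the Hessian form is a constant times
  a square, and positivity at one point fixes the sign. \<open>sphere_values_ratio\<close> needs a
  second direction and does not cover this case.\<close>

lemma r_sos_convex_one_variable:
  fixes f :: "('n::finite, real) mpoly"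
  assumes f: "is_form d f" and s: "d - 2 = 2 * s" and n: "CARD('n) = 1"
    and pos: "\<And>x y :: real ^ 'n. norm x = 1 \<Longrightarrow> norm y = 1 \<Longrightarrow> second_diff f x y > 0"
  shows "r_sos_convex r f"
proof -
  obtain a :: 'n where univ: "UNIV = {a}" using n card_1_singletonE by blast
  have eq_a: "i = a" for i using univ by blast
  define h where "h = hessian f $ a $ a"
  define c where "c = meval (\<lambda>_. 1) h"
  have h: "is_form (2 * s) h" using is_form_hessian[OF f] unfolding s h_def .
  have ax: "axis a 1 $ i = (1::real)" for i using eq_a[of i] by (simp add: axis_def)
  have "norm (axis a 1 :: real ^ 'n) = 1" by simp
  from pos[OF this this] have "c > 0"
    unfolding meval_hessian_dir ax by (simp add: univ c_def h_def)
  moreover have hx: "meval x h = x a ^ (2 * s) * c" for x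
  proof -
    have "(\<lambda>i. x a * 1) = x"
    proof
      fix i show "x a * 1 = x i" using eq_a[of i] by simp
    qed
    then show ?thesis using meval_scale[OF h, of "x a" "\<lambda>_. 1"] by (simp only: c_def)
  qed
  have "hessian_form f * (\<Sum>i\<in>UNIV. (xvar i)\<^sup>2) ^ r = mconst c * (0 + (yvar a * xvar a ^ (s + r))\<^sup>2)"
  proof (rule mpoly_eqI_meval)
    fix t :: "'n + 'n \<Rightarrow> real"
    have "(X ^ (s + r))\<^sup>2 = X ^ (2 * s) * (X\<^sup>2) ^ r" for X :: real
      unfolding power_mult[symmetric] power_add[symmetric] by (rule arg_cong[of _ _ "power X"]) simp
    then show "meval t (hessian_form f * (\<Sum>i\<in>UNIV. (xvar i)\<^sup>2) ^ r)
        = meval t (mconst c * (0 + (yvar a * xvar a ^ (s + r))\<^sup>2))"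
      by (simp add: meval_hessian_form meval_hessian_dir univ hx h_def[symmetric] power_mult_distrib)
        (simp add: power2_eq_square)
  qed
  moreover have "sum_of_squares (0 + (yvar a * xvar a ^ (s + r))\<^sup>2 :: ('n + 'n, real) mpoly)"
    using sum_of_squares_sum_list[of "\<lambda>q. q" "[yvar a * xvar a ^ (s + r)]"] by simp
  ultimately show ?thesis
    unfolding r_sos_convex_def using sum_of_squares_mconst_mult[of c] by (metis less_imp_le)
qed

lemma quartic_bounds:
  fixes f :: "('n::finite, real) mpoly"
  assumes f: "is_form 4 f"
    and bounds: "\<forall>x y :: real ^ 'n. norm x = 1 \<longrightarrow> norm y = 1 \<longrightarrow> \<mu> \<le> second_diff f x y \<and> second_diff f x y \<le> M"
  shows "\<mu> * ((norm x)\<^sup>2 * (norm y)\<^sup>2) \<le> quartic_tensor f y y x x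
    \<and> quartic_tensor f y y x x \<le> M * ((norm x)\<^sup>2 * (norm y)\<^sup>2)"
proof -
  obtain a where a: "norm a = 1" "x = norm x *\<^sub>R a" by (rule vec_eq_norm_times_unit)
  obtain b where b: "norm b = 1" "y = norm y *\<^sub>R b" by (rule vec_eq_norm_times_unit)
  define p where "p = norm x"
  define q where "q = norm y"
  have x: "x = p *\<^sub>R a" and y: "y = q *\<^sub>R b" using a b by (simp_all add: p_def q_def)
  have "quartic_tensor f y y x x = (p\<^sup>2 * q\<^sup>2) * quartic_tensor f b b a a"
    unfolding x y by (simp add: quartic_tensor_linear_1 quartic_tensor_linear power2_eq_square)
  then have eq: "quartic_tensor f y y x x = quartic_tensor f b b a a * ((norm x)\<^sup>2 * (norm y)\<^sup>2)"
    by (simp only: p_def q_def mult.commute)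
  have "\<mu> \<le> quartic_tensor f b b a a" "quartic_tensor f b b a a \<le> M"
    using bounds[rule_format, OF a(1) b(1)] by (simp_all add: second_diff_quartic(1)[OF f])
  then show ?thesis
    unfolding eq by (intro conjI mult_right_mono) auto
qed

text \<open>The vectors \<open>x + y\<close> and \<open>x - y\<close> have squared norm 2. The sum
  of the values of the tensor on the two fourth powers gives the first inequality, since the terms
  odd in \<open>y\<close> cancel; the mixed value, with each vector twice, gives the second.\<close>

lemma quartic_polarization:
  fixes f :: "('n::finite, real) mpoly"
  assumes f: "is_form 4 f"
    and bounds: "\<forall>x y :: real ^ 'n. norm x = 1 \<longrightarrow> norm y = 1 \<longrightarrow> \<mu> \<le> second_diff f x y \<and> second_diff f x y \<le> M"
    and x: "norm x = 1" and y: "norm y = 1" and orth: "x \<bullet> y = 0"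
  shows "second_diff f x x + second_diff f y y + 6 * second_diff f x y \<le> 4 * M"
    and "second_diff f x x + second_diff f y y - 2 * second_diff f x y \<ge> 4 * \<mu>"
proof -
  let ?T = "quartic_tensor f"
  have norms: "(norm (x + y))\<^sup>2 = 2" "(norm (x - y))\<^sup>2 = 2"
    using norm_orthonormal_combination[OF x y orth, of 1 1]
      norm_orthonormal_combination[OF x y orth, of 1 "- 1"] by simp_all
  have two_two: "?T a a b b = ?T b b a a" "?T a b a b = ?T a a b b" "?T a b b a = ?T a a b b" for a b
    by (rule quartic_tensor_swap_pairs, rule quartic_tensor_swap(2),
        rule trans[OF quartic_tensor_swap(3) quartic_tensor_swap(2)])
  have three_one: "?T a a b a = ?T a a a b" "?T a b a a = ?T a a a b" "?T b a a a = ?T a a a b" for a b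
    by (rule quartic_tensor_swap(3),
        rule trans[OF quartic_tensor_swap(2) quartic_tensor_swap(3)],
        rule trans[OF quartic_tensor_swap(1) trans[OF quartic_tensor_swap(2) quartic_tensor_swap(3)]])
  have "?T (x + y) (x + y) (x + y) (x + y) + ?T (x - y) (x - y) (x - y) (x - y)
      = 2 * ?T x x x x + 12 * ?T y y x x + 2 * ?T y y y y"
    unfolding quartic_tensor_linear_1 quartic_tensor_linear
      two_two(2,3)[of x y] two_two(2,3)[of y x] two_two(1)[of x y] three_one[of x y] three_one[of y x]
    by simp
  moreover have "?T (x + y) (x + y) (x + y) (x + y) \<le> M * (2 * 2)"
    using quartic_bounds[OF f bounds, of "x + y" "x + y"] unfolding norms by (rule conjunct2)
  moreover have "?T (x - y) (x - y) (x - y) (x - y) \<le> M * (2 * 2)"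
    using quartic_bounds[OF f bounds, of "x - y" "x - y"] unfolding norms by (rule conjunct2)
  ultimately show "second_diff f x x + second_diff f y y + 6 * second_diff f x y \<le> 4 * M"
    unfolding second_diff_quartic(1)[OF f] by linarith
  have "?T (x + y) (x + y) (x - y) (x - y) = ?T x x x x + ?T y y y y - 2 * ?T y y x x"
    unfolding quartic_tensor_linear_1 quartic_tensor_linear
      two_two(2,3)[of x y] two_two(2,3)[of y x] two_two(1)[of x y] three_one[of x y] three_one[of y x]
    by simp
  moreover have "\<mu> * (2 * 2) \<le> ?T (x + y) (x + y) (x - y) (x - y)"
    using quartic_bounds[OF f bounds, of "x - y" "x + y"] unfolding norms by (rule conjunct1)
  ultimately show "second_diff f x x + second_diff f y y - 2 * second_diff f x y \<ge> 4 * \<mu>"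
    unfolding second_diff_quartic(1)[OF f] by linarith
qed

text \<open>For \<open>m = 2\<close> the Reznick form is the Hessian form minus one Laplacian term,
  which is a constant: twice the trace of \<open>second_diff f e y\<close>. Its coefficient is
  \<open>- 1 / (2 * N)\<close>, so no exponential estimate is needed.\<close>

lemma quartic_reznick:
  fixes f :: "('n::finite, real) mpoly"
  assumes f: "is_form 4 f"
    and trace: "\<And>x y B. norm x = 1 \<Longrightarrow> y \<in> B \<Longrightarrow> orthonormal_basis B \<Longrightarrow>
      (\<Sum>e\<in>B. second_diff f e y) \<le> real (CARD('n) + 2 * r + 2) * second_diff f x y"
  shows "r_sos_convex r f"
proof (rule r_sos_convex_reznick_sphere[OF f, of 1])
  fix x y :: "real ^ 'n" assume x: "norm x = 1" and y: "norm y = 1"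
  let ?g = "hessian_dir f (\<lambda>i. y $ i)"
  define N where "N = real (CARD('n) + 2 * r + 2)"
  have N: "N > 0" by (simp add: N_def)
  obtain B where B: "y \<in> B" "orthonormal_basis B"
    using ex_orthonormal_basis_containing[OF y] by blast
  have nx: "veval x norm_sq = 1"
    using x by (simp add: meval_norm_sq norm_vec_def L2_set_def)
  have c: "reznick_coeff CARD('n) 2 r 1 = - 1 / (2 * N)"
    by (simp add: reznick_coeff_def N_def algebra_simps)
  have "veval x (reznick_form 2 r ?g) = veval x ?g + reznick_coeff CARD('n) 2 r 1 * veval x (laplacian ?g)"
    by (simp add: reznick_form_def nx) (simp add: reznick_coeff_def)
  also have "veval x (laplacian ?g) = 2 * (\<Sum>e\<in>B. second_diff f e y)"
    unfolding veval_laplacian[OF B(2)]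
    by (simp add: second_diff_quartic[OF f] sum_distrib_left)
  finally have "veval x (reznick_form 2 r ?g) = second_diff f x y - (\<Sum>e\<in>B. second_diff f e y) / N"
    unfolding c using N by simp
  moreover have "(\<Sum>e\<in>B. second_diff f e y) / N \<le> second_diff f x y"
    using trace[OF x B] N by (simp add: N_def divide_le_eq mult.commute)
  ultimately show "veval x (reznick_form (2 * 1) r ?g) \<ge> 0" by simp
qed simp

lemma r_sos_convex_if_sum_of_squares:
  assumes "sum_of_squares (hessian_form f)"
  shows "r_sos_convex r f"
  unfolding r_sos_convex_def
proof (induction r)
  case (Suc r)
  have "hessian_form f * (\<Sum>i\<in>UNIV. (xvar i)\<^sup>2) ^ Suc r
      = (\<Sum>i\<in>UNIV. hessian_form f * (\<Sum>i\<in>UNIV. (xvar i)\<^sup>2) ^ r * (xvar i)\<^sup>2)"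
    unfolding sum_distrib_left[symmetric] by (simp add: mult_ac)
  then show ?case using Suc by (simp add: sum_of_squares_sum sum_of_squares_mult_square)
qed (use assms in simp)

text \<open>
  The Gram matrix of \<open>y\<^sup>T H\<^sub>f(x) y\<close> in the products \<open>y\<^sub>i x\<^sub>k\<close> that the coefficients of a quartic
  form provide; by symmetry of the coefficients it only sees the symmetric part of a matrix.
\<close>

lemma quartic_catalecticant:
  fixes f :: "('n::finite, real) mpoly"
  assumes f: "is_form 4 f"
    and psd: "\<And>(B :: (real ^ 'n) set) s. orthonormal_basis B \<Longrightarrow>
      (\<Sum>e\<in>B. \<Sum>e'\<in>B. s e * s e' * second_diff f e e') \<ge> 0"
  shows "r_sos_convex r f"
proof -
  let ?q = "quartic_coeff f"
  define G where "G a b = ?q (fst a) (fst b) (snd a) (snd b)" for a b :: "'n \<times> 'n"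
  have pairs: "(\<Sum>a\<in>UNIV. \<phi> a) = (\<Sum>i\<in>UNIV. \<Sum>k\<in>UNIV. \<phi> (i, k))" for \<phi> :: "'n \<times> 'n \<Rightarrow> real"
    by (simp add: sum.cartesian_product UNIV_Times_UNIV[symmetric] del: UNIV_Times_UNIV)
  have Gsym: "G a b = G b a" for a b
  proof -
    have "G a b = ?q (fst b) (fst a) (snd a) (snd b)" unfolding G_def by (rule quartic_coeff_swap(1))
    also have "\<dots> = G b a" unfolding G_def by (rule quartic_coeff_swap(3))
    finally show ?thesis .
  qed
  have Gpsd: "(\<Sum>a\<in>UNIV. \<Sum>b\<in>UNIV. G a b * Z a * Z b) \<ge> 0" for Z
  proof -
    define A where "A i k = (Z (i, k) + Z (k, i)) / 2" for i k
    \<comment> \<open>Diagonalizing the symmetric part reduces the quadratic form in all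
      \<open>Z (i, k)\<close> to one in the eigenvalues, with matrix
      \<open>second_diff f e e'\<close>.\<close>
    obtain B :: "(real ^ 'n) set" and s where B: "orthonormal_basis B"
        "\<And>i k. A i k = (\<Sum>e\<in>B. s e * e $ i * e $ k)"
      using symmetric_matrix_decomposition[of A] by (metis A_def add.commute)
    \<comment> \<open>Swapping the middle indices makes the coefficients symmetric within the pair
      \<open>(i, k)\<close> and within \<open>(j, l)\<close>.\<close>
    have G': "G (i, k) (j, l) = ?q i k j l" for i k j l
      unfolding G_def by (simp add: quartic_coeff_swap(2)[of f i j])
    have sym1: "(\<Sum>i\<in>UNIV. \<Sum>k\<in>UNIV. c i k * Z (i, k)) = (\<Sum>i\<in>UNIV. \<Sum>k\<in>UNIV. c i k * A i k)"
      if c: "\<And>i k. c i k = c k i" for c :: "'n \<Rightarrow> 'n \<Rightarrow> real"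
    proof -
      have "(\<Sum>i\<in>UNIV. \<Sum>k\<in>UNIV. c i k * Z (k, i)) = (\<Sum>i\<in>UNIV. \<Sum>k\<in>UNIV. c i k * Z (i, k))"
        by (subst sum.swap) (simp add: c)
      then show ?thesis
        by (simp add: A_def add_divide_distrib distrib_left sum.distrib flip: sum_divide_distrib)
    qed
    have "(\<Sum>a\<in>UNIV. \<Sum>b\<in>UNIV. G a b * Z a * Z b)
        = (\<Sum>i\<in>UNIV. \<Sum>k\<in>UNIV. (\<Sum>j\<in>UNIV. \<Sum>l\<in>UNIV. ?q i k j l * Z (j, l)) * Z (i, k))"
      unfolding pairs G' sum_distrib_right by (intro sum.cong refl) simp
    also have "\<dots> = (\<Sum>i\<in>UNIV. \<Sum>k\<in>UNIV. (\<Sum>j\<in>UNIV. \<Sum>l\<in>UNIV. ?q i k j l * Z (j, l)) * A i k)"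
      by (rule sym1) (simp add: quartic_coeff_swap(1)[of f])
    also have "\<dots> = (\<Sum>i\<in>UNIV. \<Sum>k\<in>UNIV. (\<Sum>j\<in>UNIV. \<Sum>l\<in>UNIV. ?q i k j l * A j l) * A i k)"
      by (subst sym1) (auto intro: quartic_coeff_swap(3))
    also have "\<dots> = (\<Sum>e\<in>B. \<Sum>e'\<in>B. s e * s e' * quartic_tensor f e e e' e')"
    proof -
      have contract: "(\<Sum>i\<in>UNIV. \<Sum>k\<in>UNIV. c i k * A i k)
          = (\<Sum>e\<in>B. s e * (\<Sum>i\<in>UNIV. \<Sum>k\<in>UNIV. c i k * e $ i * e $ k))" for c :: "'n \<Rightarrow> 'n \<Rightarrow> real"
        unfolding B(2) sum_distrib_left sum.swap[of _ UNIV B] by (intro sum.cong refl) simp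
      have "(\<Sum>i\<in>UNIV. \<Sum>k\<in>UNIV. (\<Sum>j\<in>UNIV. \<Sum>l\<in>UNIV. ?q i k j l * A j l) * A i k)
          = (\<Sum>e\<in>B. s e * (\<Sum>i\<in>UNIV. \<Sum>k\<in>UNIV. (\<Sum>j\<in>UNIV. \<Sum>l\<in>UNIV. ?q i k j l * A j l) * e $ i * e $ k))"
        by (rule contract)
      also have "\<dots> = (\<Sum>e\<in>B. \<Sum>e'\<in>B. s e * s e' * quartic_tensor f e e e' e')"
        unfolding contract quartic_tensor_def sum_distrib_left sum_distrib_right sum.swap[of _ UNIV B]
        by (intro sum.cong refl) simp
      finally show ?thesis .
    qed
    also have "\<dots> = (\<Sum>e\<in>B. \<Sum>e'\<in>B. s e * s e' * second_diff f e e')"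
      unfolding second_diff_quartic(1)[OF f] by (intro sum.cong refl arg_cong2[of _ _ _ _ "(*)"])
        (rule quartic_tensor_swap_pairs)
    also have "\<dots> \<ge> 0" by (rule psd[OF B(1)])
    finally show ?thesis .
  qed
  have "\<exists>ls. \<forall>a\<in>UNIV. \<forall>b\<in>UNIV. G a b = (\<Sum>l\<leftarrow>ls. l a * l b)"
    by (rule psd_matrix_sum_rank_one) (auto intro: Gsym Gpsd)
  then obtain ls where ls: "\<And>a b. G a b = (\<Sum>l\<leftarrow>ls. l a * l b)" by auto
  have "hessian_form f = (\<Sum>l\<leftarrow>ls. (\<Sum>a\<in>UNIV. mconst (l a) * (yvar (fst a) * xvar (snd a)))\<^sup>2)"
  proof (rule mpoly_eqI_meval)
    fix t :: "'n + 'n \<Rightarrow> real"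
    define x :: "real ^ 'n" where "x = (\<chi> i. t (Inl i))"
    define y :: "real ^ 'n" where "y = (\<chi> i. t (Inr i))"
    define Z where "Z a = y $ fst a * x $ snd a" for a
    have "meval t (hessian_form f) = quartic_tensor f y y x x"
      using second_diff_quartic(1)[OF f, of x y] by (simp add: meval_hessian_form x_def y_def)
    also have "\<dots> = (\<Sum>i\<in>UNIV. \<Sum>k\<in>UNIV. \<Sum>j\<in>UNIV. \<Sum>l\<in>UNIV. ?q i j k l * y $ i * y $ j * x $ k * x $ l)"
      unfolding quartic_tensor_def by (rule sum.cong[OF refl], rule sum.swap)
    also have "\<dots> = (\<Sum>a\<in>UNIV. \<Sum>b\<in>UNIV. G a b * Z a * Z b)"
      by (simp add: pairs G_def Z_def mult_ac)
    also have "\<dots> = (\<Sum>l\<leftarrow>ls. (\<Sum>a\<in>UNIV. l a * Z a)\<^sup>2)"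
    proof -
      have "(\<Sum>a\<in>UNIV. \<Sum>b\<in>UNIV. (\<Sum>l\<leftarrow>L. l a * l b) * Z a * Z b) = (\<Sum>l\<leftarrow>L. (\<Sum>a\<in>UNIV. l a * Z a)\<^sup>2)" for L
        by (induction L) (simp_all add: power2_eq_square sum_product distrib_left distrib_right sum.distrib mult_ac)
      then show ?thesis by (simp add: ls)
    qed
    also have "\<dots> = meval t (\<Sum>l\<leftarrow>ls. (\<Sum>a\<in>UNIV. mconst (l a) * (yvar (fst a) * xvar (snd a)))\<^sup>2)"
      by (simp add: meval_sum_list Z_def x_def y_def)
    finally show "meval t (hessian_form f)
        = meval t (\<Sum>l\<leftarrow>ls. (\<Sum>a\<in>UNIV. mconst (l a) * (yvar (fst a) * xvar (snd a)))\<^sup>2)" .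
  qed
  then show ?thesis by (intro r_sos_convex_if_sum_of_squares) (simp add: sum_of_squares_sum_list)
qed

section \<open>The bound on the exponent\<close>

text \<open>The exact value is about 0.7213; from here on 18/25 takes the place of the
  logarithm.\<close>

lemma inverse_ln_2_bound: "18/25 \<le> 1 / (2 * ln (2::real))"
proof -
  have "ln (2::real) > 0" by simp
  then show ?thesis using ln2_le_25_over_36 by (simp add: field_simps)
qed

text \<open>Multiplication by \<open>2 * \<mu>\<close> clears the fractions. The quantity
  \<open>n + m + 2 r\<close> of \<open>reznick_form_nonneg\<close>, with \<open>m = d - 2\<close>,
  appears with an excess of \<open>2 * d\<close>.\<close>

lemma rank_hypothesis_rearranged:
  fixes \<mu> M n d r c :: real
  assumes pos: "\<mu> > 0" "M > 0" "c \<ge> 0"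
    and r: "r \<ge> c / (4 * ln 2 * (\<mu> / M)) - (n + d - 2) / 2 - d"
  shows "(n + (d - 2) + 2 * r + 2 * d) * \<mu> \<ge> 18/25 * (c * M)"
proof -
  have "c / (4 * ln 2 * (\<mu> / M)) * (2 * \<mu>) = c * M * (1 / (2 * ln 2))"
    using pos by (simp add: field_simps)
  moreover have "c * M * (1 / (2 * ln 2)) \<ge> c * M * (18/25)"
    using pos inverse_ln_2_bound by (intro mult_left_mono) auto
  moreover have "c / (4 * ln 2 * (\<mu> / M)) * (2 * \<mu>) \<le> (r + (n + d - 2) / 2 + d) * (2 * \<mu>)"
    using pos r by (intro mult_right_mono) auto
  moreover have "(r + (n + d - 2) / 2 + d) * (2 * \<mu>) = (n + (d - 2) + 2 * r + 2 * d) * \<mu>"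
    by (simp add: field_simps)
  ultimately show ?thesis by linarith
qed

text \<open>
  Reznick's threshold comes from \<open>2 powr \<epsilon> \<le> 1 + \<epsilon>\<close>, where \<open>\<epsilon> = \<mu> / M\<close>. As \<open>\<epsilon> \<le> 1 / (m + 1) \<le> 1 / 5\<close>, the
  sharper \<open>exp t \<le> 1 + t + t\<^sup>2\<close> leaves room for the summand \<open>2 m + 4 = 2 d\<close>.
\<close>

lemma exp_rank_bound:
  fixes \<mu> M n m W :: real
  assumes pos: "\<mu> > 0" "M > 0" "W > 0" and n: "n \<ge> 2" and m: "m \<ge> 4"
    and ratio: "(m + 1) * \<mu> \<le> M"
    and W: "(W + 2 * m + 4) * \<mu> \<ge> 18/25 * (n * (m * (m - 1)) * M)"
  shows "(exp (n * (m * (m - 1)) / (2 * W)) - 1) * M \<le> \<mu>"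
proof -
  define K where "K = n * (m * (m - 1))"
  define t where "t = K / (2 * W)"
  have K: "K \<ge> 2 * (m * (m - 1))"
    unfolding K_def using n m by (intro mult_right_mono mult_nonneg_nonneg) auto
  have m3: "4 * 3 \<le> m * (m - 1)" using m by (intro mult_mono) auto
  have K_pos: "K > 0" using K m3 by linarith
  \<comment> \<open>The price of the excess: as \<open>K \<ge> 24\<close>, the bound on the ratio
    absorbs it into 3/25 of \<open>K * M\<close>, and 15/25 remain of 18/25.\<close>
  have "(2 * m + 4) * \<mu> \<le> 3/25 * (K * M)"
  proof -
    have "2 * m + 4 \<le> 3/25 * K * (m + 1)"
    proof -
      have "24 * (m + 1) \<le> K * (m + 1)"
        using K m3 m by (intro mult_right_mono) auto
      then show ?thesis using m by simp
    qed
    then have "(2 * m + 4) * \<mu> \<le> 3/25 * K * (m + 1) * \<mu>"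
      using pos by (intro mult_right_mono) auto
    also have "\<dots> = 3/25 * K * ((m + 1) * \<mu>)" by simp
    also have "\<dots> \<le> 3/25 * K * M"
      using ratio K_pos by (intro mult_left_mono) auto
    finally show ?thesis by simp
  qed
  then have "W * \<mu> \<ge> 3/5 * (K * M)"
    using W unfolding K_def[symmetric] by (simp add: algebra_simps)
  then have t_bound: "t * M \<le> 5/6 * \<mu>"
    using pos by (simp add: t_def field_simps)
  have t: "t > 0" using K_pos pos by (simp add: t_def)
  have "5 * \<mu> \<le> (m + 1) * \<mu>" using m pos by (intro mult_right_mono) auto
  then have eps: "5 * \<mu> \<le> M" using ratio by linarith
  have "t * M \<le> 1/6 * M" using t_bound eps by linarith
  then have t6: "t \<le> 1/6" using pos by (simp only: mult_le_cancel_right)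
  have "exp t - 1 \<le> t + t\<^sup>2" using exp_bound[of t] t t6 by simp
  then have "(exp t - 1) * M \<le> (t + t\<^sup>2) * M" using pos by (intro mult_right_mono) auto
  also have "\<dots> = (1 + t) * (t * M)" by (simp add: power2_eq_square algebra_simps)
  \<comment> \<open>The product of the constants is 35/36.\<close>
  also have "\<dots> \<le> (1 + 1/6) * (5/6 * \<mu>)"
    by (rule mult_mono) (use t t6 t_bound pos in auto)
  also have "\<dots> \<le> \<mu>" using pos by simp
  finally show ?thesis by (simp add: t_def K_def)
qed

section \<open>Quartic forms in few variables and the final case distinction\<close>

lemma psd_two:
  fixes a b c u v :: real
  assumes "a > 0" "b\<^sup>2 \<le> a * c"
  shows "a * u\<^sup>2 + 2 * b * u * v + c * v\<^sup>2 \<ge> 0"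
proof -
  have "a * (a * u\<^sup>2 + 2 * b * u * v + c * v\<^sup>2) = (a * u + b * v)\<^sup>2 + (a * c - b\<^sup>2) * v\<^sup>2"
    by (simp add: power2_eq_square algebra_simps)
  also have "\<dots> \<ge> 0" using assms by (intro add_nonneg_nonneg mult_nonneg_nonneg) auto
  finally show ?thesis using assms(1) by (simp add: zero_le_mult_iff)
qed

text \<open>Subtracting the matrix with all entries \<open>\<mu>\<close>, which gives a square,
  leaves a diagonally dominant matrix with nonnegative off-diagonal entries.\<close>

lemma psd_three:
  fixes \<mu> a1 a2 a3 h12 h13 h23 s1 s2 s3 :: real
  assumes \<mu>: "\<mu> \<ge> 0" and h: "h12 \<ge> \<mu>" "h13 \<ge> \<mu>" "h23 \<ge> \<mu>"
    and dom: "h12 + h13 - \<mu> \<le> a1" "h12 + h23 - \<mu> \<le> a2" "h13 + h23 - \<mu> \<le> a3"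
  shows "a1 * s1\<^sup>2 + a2 * s2\<^sup>2 + a3 * s3\<^sup>2 + 2 * h12 * s1 * s2 + 2 * h13 * s1 * s3 + 2 * h23 * s2 * s3 \<ge> 0"
proof -
  have "a1 * s1\<^sup>2 + a2 * s2\<^sup>2 + a3 * s3\<^sup>2 + 2 * h12 * s1 * s2 + 2 * h13 * s1 * s3 + 2 * h23 * s2 * s3
      = \<mu> * (s1 + s2 + s3)\<^sup>2 + (h12 - \<mu>) * (s1 + s2)\<^sup>2 + (h13 - \<mu>) * (s1 + s3)\<^sup>2 + (h23 - \<mu>) * (s2 + s3)\<^sup>2
        + (a1 - (h12 + h13 - \<mu>)) * s1\<^sup>2 + (a2 - (h12 + h23 - \<mu>)) * s2\<^sup>2 + (a3 - (h13 + h23 - \<mu>)) * s3\<^sup>2"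
    by (simp add: power2_eq_square algebra_simps)
  also have "\<dots> \<ge> 0" using \<mu> h dom by (intro add_nonneg_nonneg mult_nonneg_nonneg) auto
  finally show ?thesis .
qed

lemma quartic_case:
  fixes f :: "('n::finite, real) mpoly"
  assumes f: "is_form 4 f" and \<mu>: "\<mu> > 0" and n: "CARD('n) \<ge> 2"
    and bounds: "\<And>x y :: real ^ 'n. norm x = 1 \<Longrightarrow> norm y = 1 \<Longrightarrow> \<mu> \<le> second_diff f x y \<and> second_diff f x y \<le> M"
    and ratio: "3 * \<mu> \<le> M"
    and r: "(real CARD('n) + 2 + 2 * real r + 8) * \<mu> \<ge> 36/25 * (real CARD('n) * M)"
  shows "r_sos_convex r f"
proof -
  define p where "p = real CARD('n) - 1"
  define N where "N = real (CARD('n) + 2 * r + 2)"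
  have M: "M > 0" using \<mu> ratio by linarith
  have N: "N * \<mu> \<ge> 36/25 * (p + 1) * M - 8 * \<mu>"
    using r by (simp add: N_def p_def algebra_simps)
  have all_bounds: "\<forall>x y :: real ^ 'n. norm x = 1 \<longrightarrow> norm y = 1 \<longrightarrow> \<mu> \<le> second_diff f x y \<and> second_diff f x y \<le> M"
    using bounds by blast
  have sym: "second_diff f x y = second_diff f y x" for x y
    unfolding second_diff_quartic(1)[OF f] by (rule quartic_tensor_swap_pairs)
  \<comment> \<open>In a basis containing \<open>y\<close>, the trace consists of
    \<open>t = second_diff f y y\<close> and \<open>p\<close> further terms, each bounded by
    polarization together with \<open>second_diff f e e \<ge> \<mu>\<close>.\<close>
  have reznick: "r_sos_convex r f"
    if p: "\<And>t. \<mu> \<le> t \<Longrightarrow> t \<le> M \<Longrightarrow> t + p * ((4 * M - t - \<mu>) / 6) \<le> N * \<mu>"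
  proof (rule quartic_reznick[OF f])
    fix x y :: "real ^ 'n" and B assume x: "norm x = 1" and y: "y \<in> B" and onb: "orthonormal_basis B"
    note B = onb[unfolded orthonormal_basis_def]
    let ?t = "second_diff f y y"
    have ny: "norm y = 1" using B y by blast
    have "second_diff f e y \<le> (4 * M - ?t - \<mu>) / 6" if e: "e \<in> B - {y}" for e
    proof -
      have ne: "norm e = 1" and orth: "e \<bullet> y = 0" using B y e by auto
      show ?thesis
        using quartic_polarization(1)[OF f all_bounds ne ny orth] bounds[OF ne ne] by (simp add: field_simps)
    qed
    then have "(\<Sum>e\<in>B - {y}. second_diff f e y) \<le> (\<Sum>e\<in>B - {y}. (4 * M - ?t - \<mu>) / 6)"
      by (rule sum_mono)
    also have "\<dots> = p * ((4 * M - ?t - \<mu>) / 6)"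
      using B y n by (simp add: p_def of_nat_diff)
    finally have "(\<Sum>e\<in>B. second_diff f e y) \<le> ?t + p * ((4 * M - ?t - \<mu>) / 6)"
      using B y by (subst sum.remove[of B y]) auto
    also have "\<dots> \<le> N * \<mu>" using bounds[OF ny ny] by (intro p) auto
    also have "\<dots> \<le> N * second_diff f x y"
      using bounds[OF x ny] by (intro mult_left_mono) (auto simp: N_def)
    finally show "(\<Sum>e\<in>B. second_diff f e y) \<le> real (CARD('n) + 2 * r + 2) * second_diff f x y"
      by (simp add: N_def)
  qed
  consider "CARD('n) = 2" | "CARD('n) = 3" | "CARD('n) \<ge> 4" using n by linarith
  then show ?thesis
  proof cases
    case 1
    then have p: "p = 1" by (simp add: p_def)
    show ?thesis
    \<comment> \<open>The trace bound works for \<open>\<mu> / M\<close> up to about 0.1762, and the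
      catalecticant from \<open>3 - 2 * sqrt 2\<close>, about 0.1716; the threshold 7/40 lies
      between.\<close>
    proof (cases "40 * \<mu> \<le> 7 * M")
      case True
      then show ?thesis using N M by (intro reznick) (simp add: p field_simps)
    next
      case False
      show ?thesis
      proof (rule quartic_catalecticant[OF f])
        fix B :: "(real ^ 'n) set" and s assume onb: "orthonormal_basis B"
        note B = onb[unfolded orthonormal_basis_def]
        obtain x y where xy: "B = {x, y}" "x \<noteq> y" using B 1 by (metis card_2_iff)
        have nx: "norm x = 1" and ny: "norm y = 1" and orth: "x \<bullet> y = 0" using B xy by auto
        let ?a = "second_diff f x x" and ?b = "second_diff f x y" and ?c = "second_diff f y y"
        have pol: "?a + ?c - 2 * ?b \<ge> 4 * \<mu>" by (rule quartic_polarization(2)[OF f all_bounds nx ny orth])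
        have bd: "\<mu> \<le> ?a" "?a \<le> M" "\<mu> \<le> ?c" "?c \<le> M" "\<mu> \<le> ?b" "?b \<le> M"
          using bounds nx ny by auto
        \<comment> \<open>The product \<open>(M - ?a) * (M - ?c) \<ge> 0\<close> bounds
          \<open>?a * ?c\<close> from below by the sum, to which polarization applies. What remains
          to be shown is that the square of \<open>M - ?b\<close> is at most
          \<open>4 * \<mu> * M\<close>.\<close>
        have "(M - ?b)\<^sup>2 \<le> (M - \<mu>)\<^sup>2" using bd by (intro power_mono) auto
        also have "\<dots> \<le> (33/40 * M)\<^sup>2" using False \<mu> ratio by (intro power_mono) auto
        also have "\<dots> \<le> 4 * \<mu> * M"
        proof -
          have "7 * M * M \<le> 40 * \<mu> * M" using False M by (intro mult_right_mono) auto
          moreover have "M * M \<ge> 0" by simp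
          ultimately show ?thesis unfolding power2_eq_square by linarith
        qed
        finally have "(M - ?b)\<^sup>2 \<le> 4 * \<mu> * M" .
        moreover have "(M - ?a) * (M - ?c) \<ge> 0" using bd by (intro mult_nonneg_nonneg) auto
        moreover have "M * (?a + ?c) \<ge> M * (4 * \<mu> + 2 * ?b)" using pol M by (intro mult_left_mono) auto
        ultimately have "?b\<^sup>2 \<le> ?a * ?c" by (simp add: power2_eq_square algebra_simps)
        then have "?a * (s x)\<^sup>2 + 2 * ?b * s x * s y + ?c * (s y)\<^sup>2 \<ge> 0"
          using bd \<mu> by (intro psd_two) auto
        also have "?a * (s x)\<^sup>2 + 2 * ?b * s x * s y + ?c * (s y)\<^sup>2
            = (\<Sum>e\<in>B. \<Sum>e'\<in>B. s e * s e' * second_diff f e e')"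
          unfolding xy(1) using xy(2) by (simp add: sym[of y x] power2_eq_square)
        finally show "(\<Sum>e\<in>B. \<Sum>e'\<in>B. s e * s e' * second_diff f e e') \<ge> 0" .
      qed
    qed
  next
    case 2
    then have p: "p = 2" by (simp add: p_def)
    show ?thesis
    \<comment> \<open>The trace bound works up to about 0.3026, and the catalecticant as soon as
      \<open>M \<le> 5 * \<mu>\<close>.\<close>
    proof (cases "25 * \<mu> \<le> 7 * M")
      case True
      then show ?thesis using N M by (intro reznick) (simp add: p field_simps)
    next
      case False
      show ?thesis
      proof (rule quartic_catalecticant[OF f])
        fix B :: "(real ^ 'n) set" and s assume onb: "orthonormal_basis B"
        note B = onb[unfolded orthonormal_basis_def]
        obtain x y z where xyz: "B = {x, y, z}" "x \<noteq> y" "x \<noteq> z" "y \<noteq> z"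
          using B 2 by (metis card_3_iff)
        have nx: "norm x = 1" and ny: "norm y = 1" and nz: "norm z = 1"
          and orth: "x \<bullet> y = 0" "x \<bullet> z = 0" "y \<bullet> z = 0" using B xyz by auto
        note pol1 = quartic_polarization(1)[OF f all_bounds]
        note pol2 = quartic_polarization(2)[OF f all_bounds]
        note pols = pol1[OF nx ny orth(1)] pol1[OF nx nz orth(2)] pol1[OF ny nz orth(3)]
          pol2[OF nx ny orth(1)] pol2[OF nx nz orth(2)] pol2[OF ny nz orth(3)]
        note bd = bounds[OF nx nx] bounds[OF ny ny] bounds[OF nz nz]
          bounds[OF nx ny] bounds[OF nx nz] bounds[OF ny nz]
        \<comment> \<open>Adding the second polarization inequality for the two pairs containing
          \<open>x\<close> bounds \<open>h12 + h13 - \<mu>\<close> by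
          \<open>a1 + M - 5 * \<mu>\<close>; likewise for \<open>y\<close> and
          \<open>z\<close>.\<close>
        have "second_diff f x x * (s x)\<^sup>2 + second_diff f y y * (s y)\<^sup>2 + second_diff f z z * (s z)\<^sup>2
            + 2 * second_diff f x y * s x * s y + 2 * second_diff f x z * s x * s z
            + 2 * second_diff f y z * s y * s z \<ge> 0"
          by (rule psd_three[of \<mu>]) (use pols bd[THEN conjunct1] bd[THEN conjunct2] False \<mu> in linarith)+
        also have "second_diff f x x * (s x)\<^sup>2 + second_diff f y y * (s y)\<^sup>2 + second_diff f z z * (s z)\<^sup>2
            + 2 * second_diff f x y * s x * s y + 2 * second_diff f x z * s x * s z
            + 2 * second_diff f y z * s y * s z = (\<Sum>e\<in>B. \<Sum>e'\<in>B. s e * s e' * second_diff f e e')"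
          unfolding xyz(1) using xyz(2-4)
          by (simp add: sym[of y x] sym[of z x] sym[of z y] power2_eq_square algebra_simps)
        finally show "(\<Sum>e\<in>B. \<Sum>e'\<in>B. s e * s e' * second_diff f e e') \<ge> 0" .
      qed
    qed
  next
    case 3
    then have p: "p \<ge> 3" by (simp add: p_def)
    show ?thesis
    \<comment> \<open>From four variables on, \<open>3 * \<mu> \<le> M\<close> suffices for the
      trace bound, even when \<open>t\<close> is estimated by \<open>M\<close> in the first summand
      and by \<open>\<mu>\<close> in the second.\<close>
    proof (rule reznick)
      fix t assume t: "\<mu> \<le> t" "t \<le> M"
      have "p * ((4 * M - t - \<mu>) / 6) \<le> p * ((4 * M - 2 * \<mu>) / 6)"
        using p t by (intro mult_left_mono) auto
      also have "\<dots> = 2/3 * (p * M) - 1/3 * (p * \<mu>)"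
        by (simp add: field_simps)
      finally have "p * ((4 * M - t - \<mu>) / 6) \<le> 2/3 * (p * M) - 1/3 * (p * \<mu>)" .
      from add_mono[OF t(2) this]
      have 1: "t + p * ((4 * M - t - \<mu>) / 6) \<le> M + 2/3 * (p * M) - 1/3 * (p * \<mu>)"
        by (simp only: add_diff_eq)
      have "p * M \<ge> 3 * M" "p * \<mu> \<ge> 3 * \<mu>" using p M \<mu> by auto
      then have "M + 2/3 * (p * M) - 1/3 * (p * \<mu>) \<le> 36/25 * (p * M) + 36/25 * M - 8 * \<mu>"
        using ratio M by linarith
      also have "\<dots> \<le> N * \<mu>" using N by (simp add: algebra_simps)
      finally show "t + p * ((4 * M - t - \<mu>) / 6) \<le> N * \<mu>" using 1 by linarith
    qed
  qed
qed

theorem theorem6p4p7: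
  fixes f :: "('n::finite, real) mpoly" and d r :: nat
  assumes "even d" and "d > 0"
    and "is_form d f"
    and "\<And>x y :: real ^ 'n. (x, y) \<in> sphere 0 1 \<times> sphere 0 1 \<Longrightarrow> y \<bullet> (hessian_at f x *v y) > 0"
    and "real r \<ge> real CARD('n) * (real d - 2) * (real d - 3) / (4 * ln 2 * eta f)
                   - (real CARD('n) + real d - 2) / 2 - real d"
  shows "r_sos_convex r f"
proof -
  obtain k where k: "d = 2 * k" using assms(1) by (auto elim: evenE)
  define s where "s = k - 1"
  have s: "d = 2 * s + 2" using assms(2) k by (simp add: s_def)
  have ds: "d - 2 = 2 * s" by (simp add: s)
  have pos: "second_diff f x y > 0" if "norm x = 1" "norm y = 1" for x y :: "real ^ 'n"
    using assms(4)[of x y] that by (simp add: hessian_at_inner)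
  obtain \<mu> M where \<mu>: "0 < \<mu>" "\<mu> \<le> M" and eta: "eta f = \<mu> / M"
    and bounds: "\<And>x y :: real ^ 'n. norm x = 1 \<Longrightarrow> norm y = 1 \<Longrightarrow> \<mu> \<le> second_diff f x y \<and> second_diff f x y \<le> M"
    by (rule sphere_values_bounds[of f, OF pos]) blast+
  have M: "M > 0" using \<mu> by linarith
  let ?n = "real CARD('n)"
  \<comment> \<open>For \<open>d = 2\<close> the factor \<open>d - 3\<close> is negative, but the
    product is 0.\<close>
  have c: "?n * (real d - 2) * (real d - 3) \<ge> 0"
    by (cases "s = 0") (auto simp: s intro!: mult_nonneg_nonneg)
  have r: "(?n + (real d - 2) + 2 * real r + 2 * real d) * \<mu>
      \<ge> 18/25 * (?n * (real d - 2) * (real d - 3) * M)"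
    by (rule rank_hypothesis_rearranged[OF \<mu>(1) M c]) (use assms(5) in \<open>simp add: eta\<close>)
  show ?thesis
  proof (cases "CARD('n) = 1")
    case True
    then show ?thesis using r_sos_convex_one_variable[OF assms(3) ds _ pos] by blast
  next
    case False
    then have n: "CARD('n) \<ge> 2" using zero_less_card_finite[where 'a = 'n] by linarith
    have ratio: "(real d - 1) * \<mu> \<le> M"
      by (rule sphere_values_ratio[OF assms(3,1,2) n bounds])
    show ?thesis
    proof (cases "s = 1")
      case True
      then have "d = 4" by (simp add: s)
      then show ?thesis
        using quartic_case[of f \<mu> M r] assms(3) \<mu>(1) n bounds ratio r by simp
    next
      case False
      have small: "(exp (?n * (real (2 * s) * (real (2 * s) - 1)) / (2 * real (CARD('n) + 2 * s + 2 * r))) - 1) * M \<le> \<mu>"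
      \<comment> \<open>For \<open>d = 2\<close> the exponent is 0; otherwise
        \<open>m = 2 * s\<close> is at least 4, as \<open>exp_rank_bound\<close> requires.\<close>
      proof (cases "s = 0")
        case True
        then show ?thesis using \<mu> by simp
      next
        case s0: False
        show ?thesis
        proof (rule exp_rank_bound[OF \<mu>(1) M])
          show "real (2 * s) \<ge> 4" using s0 False by simp
          show "(real (2 * s) + 1) * \<mu> \<le> M" using ratio by (simp add: s algebra_simps)
          show "18/25 * (?n * (real (2 * s) * (real (2 * s) - 1)) * M)
              \<le> (real (CARD('n) + 2 * s + 2 * r) + 2 * real (2 * s) + 4) * \<mu>"
            using r by (simp add: s algebra_simps)
        qed (use n s0 in auto)
      qed
      show ?thesis
      proof (rule r_sos_convex_reznick_sphere[OF assms(3) ds])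
        fix x y :: "real ^ 'n" assume "norm x = 1" "norm y = 1"
        then show "veval x (reznick_form (2 * s) r (hessian_dir f (\<lambda>i. y $ i))) \<ge> 0"
          using is_form_hessian_dir[OF assms(3)] bounds \<mu>(1) small unfolding ds
          by (intro reznick_form_nonneg[where \<mu> = \<mu> and M = M]) auto
      qed
    qed
  qed
qed

end
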